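(* Work in the setting and under the standing assumptions given in the context. For $x_0\in\mathbb{R}^n$ and $\varepsilon>0$ let $y_t^{(\varepsilon)}$ be the strong solution of $$dy_t^{(\varepsilon)}=u(y_t^{(\varepsilon)},t)\,dt+\varepsilon\,\sigma(y_t^{(\varepsilon)},t)\,dW_t,\qquad y_0^{(\varepsilon)}=x_0,$$ with fixed deterministic initial condition $x_0$, and define the stochastic sensitivity $$S^2(x_0,t):=\lim_{\varepsilon\downarrow0}\ \sup\left\{\frac{1}{\varepsilon^2}\,\mathbb{V}\left[p^{\top}\left(y_t^{(\varepsilon)}-F_0^t(x_0)\right)\right]\ :\ p\in\mathbb{R}^n,\ \|p\|=1\right\}.$$ Then for any $x_0\in\mathbb{R}^n$ and $t\in[0,T]$, $$S^2(x_0,t)=\|\Sigma_0^t(x_0)\|,$$ where $$\Sigma_0^t(x_0)=\nabla F_0^t(x_0)\left(\int_0^tL(x_0,\tau)L(x_0,\tau)^{\top}d\tau\right)\left[\nabla F_0^t(x_0)\right]^{\top},\qquad L(x_0,\tau)=\left[\nabla F_0^\tau(x_0)\right]^{-1}\sigma(F_0^\tau(x_0),\tau).$$ Equivalently, $S^2(x_0,t)$ is the maximum eigenvalue of $\Sigma_0^t(x_0)$.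
   Context: $\mathbb{V}[\cdot]$ denotes variance. Fix $T>0$ and $n,m\ge1$. $W_t$ is a canonical $m$-dimensional Wiener process on $[0,T]$, and $u:\mathbb{R}^n\times[0,T]\to\mathbb{R}^n$, $\sigma:\mathbb{R}^n\times[0,T]\to\mathbb{R}^{n\times m}$ are deterministic. $\nabla$ is the derivative in the state variable (for $F_0^t$, with respect to the initial condition). $\|\cdot\|$ is the Euclidean norm on vectors, the induced spectral (operator) norm on matrices, and, on third-order tensors, the operator norm induced by the Euclidean norm on vectors and the spectral norm on matrices, e.g. $\|\nabla\sigma(z,t)\|=\sup_{\|h\|=1}\|D\sigma(z,t)[h]\|$. Integrals of matrices are elementwise. Flow map: $F_0^t(z)$ is the value at time $t$ of the solution of the deterministic equation $\frac{d}{dt}y_t=u(y_t,t)$, $y_0=z$, i.e. $F_0^t(z)=z+\int_0^t u(F_0^\tau(z),\tau)\,d\tau$. Standing assumptions: (1) for all $t\in[0,T]$ the flow map $F_0^t:\mathbb{R}^n\to\mathbb{R}^n$ is well-defined and continuously differentiable with invertible derivative $\nabla F_0^t$; (2) for each $t\in[0,T]$, $u(\cdot,t)$ is twice continuously differentiable and each component of $\sigma(\cdot,t)$ is differentiable on $\mathbb{R}^n$; (3) there is $K_{\nabla u}\ge0$ with $\|\nabla u(z,t)\|\le K_{\nabla u}$ for all $z\in\mathbb{R}^n$, $t\in[0,T]$; (4) for each $z\in\mathbb{R}^n$, $u(z,\cdot)$ and each component of $\sigma(z,\cdot)$ are Borel-measurable on $[0,T]$; (5) there is $K_L$ with $\|u(z,t)\|+\|\sigma(z,t)\|\le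 K_L(1+\|z\|)$ for all $z,t$; (6) there is $K_{\nabla\sigma}\ge0$ with $\|\nabla\sigma(z,t)\|\le K_{\nabla\sigma}$ for all $z,t$; (7) there is $K_{\nabla\nabla u}\ge0$ with $\|\nabla\nabla u(z,t)\|\le K_{\nabla\nabla u}$ for all $z,t$; (8) there is $K_\sigma\ge0$ with $\|\sigma(z,t)\|\le K_\sigma$ for all $z,t$. *)

theory Defs
  imports "HOL-Probability.Probability"
begin

subsection \<open>Norms, smoothness, eigenvalues\<close>

text \<open>The library norm on \<^typ>\<open>real ^ 'm ^ 'n\<close> is the Frobenius norm, hence a separate
  definition of the operator norm.\<close>

definition spectral_norm :: "real ^ 'm ^ 'n \<Rightarrow> real" where
  "spectral_norm A = onorm ((*v) A)"

definition tensor_norm :: "(real ^ 'k \<Rightarrow> real ^ 'm ^ 'n) \<Rightarrow> real" where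
  "tensor_norm D = (SUP h\<in>{h. norm h = 1}. spectral_norm (D h))"

text \<open>Continuity of the derivative refers to the operator norm carried by the type of bounded
  linear functions.\<close>

definition continuously_differentiable ::
    "('a::real_normed_vector \<Rightarrow> 'b::real_normed_vector) \<Rightarrow> bool" where
  "continuously_differentiable f \<longleftrightarrow>
     (\<exists>f'. (\<forall>x. (f has_derivative blinfun_apply (f' x)) (at x)) \<and> continuous_on UNIV f')"

definition twice_continuously_differentiable :: "(real ^ 'n \<Rightarrow> real ^ 'k) \<Rightarrow> bool" where
  "twice_continuously_differentiable f \<longleftrightarrow>
     (\<forall>x. f differentiable (at x)) \<and> continuously_differentiable (\<lambda>x. jacobian f (at x))"

definition eigenvalue :: "real ^ 'n ^ 'n \<Rightarrow> real \<Rightarrow> bool" where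
  "eigenvalue A c \<longleftrightarrow> (\<exists>v. v \<noteq> 0 \<and> A *v v = c *\<^sub>R v)"

subsection \<open>Flow map\<close>

text \<open>As \<open>u\<close> is only measurable in time, the differential equation is read in its integral
  (Caratheodory) form.\<close>

definition flow_map :: "(real ^ 'n \<Rightarrow> real \<Rightarrow> real ^ 'n) \<Rightarrow> real \<Rightarrow>
    (real \<Rightarrow> real ^ 'n \<Rightarrow> real ^ 'n) \<Rightarrow> bool" where
  "flow_map u T F \<longleftrightarrow>
     (\<forall>z. \<forall>t\<in>{0..T}.
        set_integrable lborel {0..t} (\<lambda>s. u (F s z) s) \<and>
        F t z = z + (LINT s:{0..t}|lborel. u (F s z) s))"

subsection \<open>Wiener process and its filtration\<close>

definition natural_filtration ::
    "'a measure \<Rightarrow> (real \<Rightarrow> 'a \<Rightarrow> real ^ 'm) \<Rightarrow> real \<Rightarrow> 'a measure" where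
  "natural_filtration M W t =
     sigma (space M) {W s -` B \<inter> space M | s B. s \<in> {0..t} \<and> B \<in> sets borel}"

definition augmented_filtration ::
    "'a measure \<Rightarrow> (real \<Rightarrow> 'a \<Rightarrow> real ^ 'm) \<Rightarrow> real \<Rightarrow> 'a measure" where
  "augmented_filtration M W t =
     sigma (space M) (sets (natural_filtration M W t) \<union> null_sets M)"

text \<open>The product density says that an increment over \<open>[s, t]\<close> is centred Gaussian with
  covariance matrix \<open>(t - s) I\<close>; note that \<^const>\<open>normal_density\<close> takes the standard
  deviation.\<close>

definition wiener_process ::
    "'a measure \<Rightarrow> real \<Rightarrow> (real \<Rightarrow> 'a \<Rightarrow> real ^ 'm) \<Rightarrow> bool" where
  "wiener_process M T W \<longleftrightarrow>
     prob_space M \<and>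
     (\<forall>t\<in>{0..T}. W t \<in> borel_measurable M) \<and>
     (AE \<omega> in M. W 0 \<omega> = 0) \<and>
     (\<forall>\<omega>\<in>space M. continuous_on {0..T} (\<lambda>t. W t \<omega>)) \<and>
     (\<forall>s t. 0 \<le> s \<and> s < t \<and> t \<le> T \<longrightarrow>
        distributed M lborel (\<lambda>\<omega>. W t \<omega> - W s \<omega>)
          (\<lambda>x. ennreal (\<Prod>i\<in>UNIV. normal_density 0 (sqrt (t - s)) (x $ i))) \<and>
        prob_space.indep_set M (sets (natural_filtration M W s))
          (sets (vimage_algebra (space M) (\<lambda>\<omega>. W t \<omega> - W s \<omega>) borel)))"

subsection \<open>Ito integral and strong solutions\<close>

text \<open>An elementary process on \<open>[0, t]\<close> is given by a partition
  \<open>0 = \<tau> 0 \<le> \<dots> \<le> \<tau> k = t\<close> and bounded coefficients \<open>e j\<close>, known at time \<open>\<tau> j\<close>, which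
  are its values on \<open>(\<tau> j, \<tau> (j + 1)]\<close>.\<close>

definition elementary_process :: "'a measure \<Rightarrow> (real \<Rightarrow> 'a measure) \<Rightarrow> real \<Rightarrow>
    nat \<Rightarrow> (nat \<Rightarrow> real) \<Rightarrow> (nat \<Rightarrow> 'a \<Rightarrow> real ^ 'm ^ 'n) \<Rightarrow> bool" where
  "elementary_process M \<F> t k \<tau> e \<longleftrightarrow>
     \<tau> 0 = 0 \<and> \<tau> k = t \<and>
     (\<forall>j<k. \<tau> j \<le> \<tau> (Suc j) \<and>
            e j \<in> borel_measurable (\<F> (\<tau> j)) \<and>
            (\<exists>C. \<forall>\<omega>\<in>space M. norm (e j \<omega>) \<le> C))"

definition elementary_value ::
    "nat \<Rightarrow> (nat \<Rightarrow> real) \<Rightarrow> (nat \<Rightarrow> 'a \<Rightarrow> real ^ 'm ^ 'n) \<Rightarrow> real \<Rightarrow> 'a \<Rightarrow> real ^ 'm ^ 'n" where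
  "elementary_value k \<tau> e s \<omega> = (\<Sum>j<k. indicator {\<tau> j<..\<tau> (Suc j)} s *\<^sub>R e j \<omega>)"

definition elementary_integral :: "(real \<Rightarrow> 'a \<Rightarrow> real ^ 'm) \<Rightarrow>
    nat \<Rightarrow> (nat \<Rightarrow> real) \<Rightarrow> (nat \<Rightarrow> 'a \<Rightarrow> real ^ 'm ^ 'n) \<Rightarrow> 'a \<Rightarrow> real ^ 'n" where
  "elementary_integral W k \<tau> e \<omega> = (\<Sum>j<k. e j \<omega> *v (W (\<tau> (Suc j)) \<omega> - W (\<tau> j) \<omega>))"

text \<open>The Ito integral of \<open>H\<close> over \<open>[0, t]\<close>, for jointly measurable adapted \<open>H\<close> in
  \<open>L\<^sup>2(dt \<times> P)\<close>: the \<open>L\<^sup>2(P)\<close> limit of the integrals of elementary processes that converge to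
  \<open>H\<close> in \<open>L\<^sup>2(dt \<times> P)\<close>. It is unique up to null sets and does not depend on the approximating
  sequence, so it is rendered as a relation.\<close>

definition has_ito_integral :: "'a measure \<Rightarrow> (real \<Rightarrow> 'a measure) \<Rightarrow> (real \<Rightarrow> 'a \<Rightarrow> real ^ 'm) \<Rightarrow>
    real \<Rightarrow> (real \<Rightarrow> 'a \<Rightarrow> real ^ 'm ^ 'n) \<Rightarrow> ('a \<Rightarrow> real ^ 'n) \<Rightarrow> bool" where
  "has_ito_integral M \<F> W t H I \<longleftrightarrow>
     (\<lambda>(s, \<omega>). H s \<omega>) \<in> borel_measurable (restrict_space borel {0..t} \<Otimes>\<^sub>M M) \<and>
     (\<forall>s\<in>{0..t}. H s \<in> borel_measurable (\<F> s)) \<and>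
     (\<integral>\<^sup>+\<omega>. (\<integral>\<^sup>+s\<in>{0..t}. ennreal ((norm (H s \<omega>))\<^sup>2) \<partial>lborel) \<partial>M) < \<infinity> \<and>
     I \<in> borel_measurable M \<and>
     (\<exists>k \<tau> e.
        (\<forall>i. elementary_process M \<F> t (k i) (\<tau> i) (e i)) \<and>
        (\<lambda>i::nat. \<integral>\<^sup>+\<omega>. (\<integral>\<^sup>+s\<in>{0..t}.
            ennreal ((norm (elementary_value (k i) (\<tau> i) (e i) s \<omega> - H s \<omega>))\<^sup>2) \<partial>lborel) \<partial>M)
          \<longlonglongrightarrow> 0 \<and>
        (\<lambda>i. \<integral>\<^sup>+\<omega>. ennreal ((norm (elementary_integral W (k i) (\<tau> i) (e i) \<omega> - I \<omega>))\<^sup>2) \<partial>M)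
          \<longlonglongrightarrow> 0)"

text \<open>Strong solution on \<open>[0, T]\<close> of \<open>dX = b(X, t) dt + s(X, t) dW\<close> with \<open>X\<^sub>0 = x0\<close>
  deterministic: continuous, and adapted to the augmented filtration of the driving Wiener process.
  The usual definition only asks for \<open>s(X, t)\<close> to be almost surely square integrable in time;
  this makes no difference for bounded \<open>s\<close>, the case in which the definition is used.\<close>

definition strong_solution :: "'a measure \<Rightarrow> (real \<Rightarrow> 'a \<Rightarrow> real ^ 'm) \<Rightarrow> real \<Rightarrow>
    (real ^ 'n \<Rightarrow> real \<Rightarrow> real ^ 'n) \<Rightarrow> (real ^ 'n \<Rightarrow> real \<Rightarrow> real ^ 'm ^ 'n) \<Rightarrow>
    real ^ 'n \<Rightarrow> (real \<Rightarrow> 'a \<Rightarrow> real ^ 'n) \<Rightarrow> bool" where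
  "strong_solution M W T b s x0 X \<longleftrightarrow>
     (\<forall>t\<in>{0..T}. X t \<in> borel_measurable (augmented_filtration M W t)) \<and>
     (\<forall>\<omega>\<in>space M. continuous_on {0..T} (\<lambda>t. X t \<omega>)) \<and>
     (AE \<omega> in M. X 0 \<omega> = x0) \<and>
     (\<forall>t\<in>{0..T}.
        (AE \<omega> in M. set_integrable lborel {0..t} (\<lambda>r. b (X r \<omega>) r)) \<and>
        (\<exists>I. has_ito_integral M (augmented_filtration M W) W t (\<lambda>r \<omega>. s (X r \<omega>) r) I \<and>
             (AE \<omega> in M. X t \<omega> = x0 + (LINT r:{0..t}|lborel. b (X r \<omega>) r) + I \<omega>)))"

subsection \<open>Stochastic sensitivity and the deviation covariance matrix\<close>

definition scaled_max_variance :: "'a measure \<Rightarrow> (real \<Rightarrow> real ^ 'n \<Rightarrow> real ^ 'n) \<Rightarrow>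
    (real \<Rightarrow> real \<Rightarrow> 'a \<Rightarrow> real ^ 'n) \<Rightarrow> real ^ 'n \<Rightarrow> real \<Rightarrow> real \<Rightarrow> real" where
  "scaled_max_variance M F y x0 t \<epsilon> =
     (SUP p\<in>{p. norm p = 1}.
        1 / \<epsilon>\<^sup>2 * prob_space.variance M (\<lambda>\<omega>. p \<bullet> (y \<epsilon> t \<omega> - F t x0)))"

definition stochastic_sensitivity :: "'a measure \<Rightarrow> (real \<Rightarrow> real ^ 'n \<Rightarrow> real ^ 'n) \<Rightarrow>
    (real \<Rightarrow> real \<Rightarrow> 'a \<Rightarrow> real ^ 'n) \<Rightarrow> real ^ 'n \<Rightarrow> real \<Rightarrow> real" where
  "stochastic_sensitivity M F y x0 t = Lim (at_right 0) (scaled_max_variance M F y x0 t)"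

definition L_matrix :: "(real \<Rightarrow> real ^ 'n \<Rightarrow> real ^ 'n) \<Rightarrow> (real ^ 'n \<Rightarrow> real \<Rightarrow> real ^ 'm ^ 'n) \<Rightarrow>
    real ^ 'n \<Rightarrow> real \<Rightarrow> real ^ 'm ^ 'n" where
  "L_matrix F \<sigma> x0 \<tau> = matrix_inv (jacobian (F \<tau>) (at x0)) ** \<sigma> (F \<tau> x0) \<tau>"

definition Sigma_matrix :: "(real \<Rightarrow> real ^ 'n \<Rightarrow> real ^ 'n) \<Rightarrow>
    (real ^ 'n \<Rightarrow> real \<Rightarrow> real ^ 'm ^ 'n) \<Rightarrow> real ^ 'n \<Rightarrow> real \<Rightarrow> real ^ 'n ^ 'n" where
  "Sigma_matrix F \<sigma> x0 t =
     jacobian (F t) (at x0) **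
     (\<chi> i j. LINT \<tau>:{0..t}|lborel.
        (L_matrix F \<sigma> x0 \<tau> ** transpose (L_matrix F \<sigma> x0 \<tau>)) $ i $ j) **
     transpose (jacobian (F t) (at x0))"

end

theory Submission
  imports Defs
begin

text \<open>Let \<open>V = (y - F) / \<epsilon>\<close> be the scaled deviation from the flow, \<open>J = \<integral> \<sigma>(y) dW\<close> the driving noise and
  \<open>A\<close> the derivative of \<open>u\<close> along the flow. Subtracting the two integral equations gives
  \<open>V = J + \<integral> (A V + rem)\<close>, a linear equation up to the Taylor remainder of \<open>u\<close>. For a direction \<open>p\<close>, the
  costate \<open>\<pi> s = (\<nabla>F\<^sub>t inverse (\<nabla>F\<^sub>s))\<^sup>T p\<close> solves the adjoint equation (\<open>costate_equation\<close>), and integration by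
  parts against it eliminates \<open>V\<close> path by path:
  \<open>p \<bullet> V\<^sub>t = p \<bullet> J\<^sub>t + \<integral> A\<^sup>T \<pi> \<bullet> J + \<integral> \<pi> \<bullet> rem\<close> (\<open>deviation_eq_main_plus_error\<close>). No stochastic integral other
  than \<open>J\<close> at single times is needed.

  The first two terms have mean zero. The Ito isometry for the noise at two different times
  (\<open>ito_isometry\<close>) and Fubini's theorem give their variance as \<open>\<integral> E \<bar>\<sigma>(y)\<^sup>T \<pi>\<bar>\<^sup>2\<close>, which tends to
  \<open>\<integral> \<bar>\<sigma>(F)\<^sup>T \<pi>\<bar>\<^sup>2 = p \<bullet> \<Sigma> p\<close> because \<open>\<sigma>\<close> is Lipschitz and \<open>y - F\<close> is of order \<open>\<epsilon>\<close> in mean square.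

  The remainder is at most \<open>\<bar>V\<bar> min (2 K) (C \<epsilon> \<bar>V\<bar>)\<close>. It vanishes in mean square if \<open>\<bar>V\<bar>\<^sup>2\<close> is uniformly
  integrable in \<open>\<epsilon>\<close>. By Gronwall's inequality \<open>V\<close> is controlled by \<open>J\<close>, and by the isometry the noise at
  strength \<open>\<epsilon>\<close> differs from the noise at a fixed strength \<open>\<delta>\<close> by \<open>O(\<epsilon>\<^sup>2 + \<delta>\<^sup>2)\<close> in mean square
  (\<open>JP_difference\<close>); truncating the latter (\<open>rem_bound\<close>) gives the claim with second moments only.

  All estimates are uniform over unit vectors \<open>p\<close>, so the suprema converge to the maximum of
  \<open>p \<bullet> \<Sigma> p\<close> on the unit sphere. For the symmetric positive semidefinite matrix \<open>\<Sigma>\<close> this is both the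
  largest eigenvalue and the spectral norm (\<open>rayleigh_quotient\<close>).\<close>

section \<open>Matrix norms and the Rayleigh quotient\<close>

lemma norm_matrix_vector_le_spectral_norm:
  fixes A :: "real ^ 'm ^ 'n"
  shows "norm (A *v x) \<le> spectral_norm A * norm x"
  unfolding spectral_norm_def by (rule onorm[OF matrix_vector_mul_bounded_linear])

lemma spectral_norm_nonneg: "0 \<le> spectral_norm A"
  unfolding spectral_norm_def by (rule onorm_pos_le[OF matrix_vector_mul_bounded_linear])

lemma norm_vector_matrix_mult_le:
  fixes A :: "real ^ 'm ^ 'n"
  shows "norm (p v* A) \<le> norm p * norm A"
proof -
  have "p v* A = (\<Sum>i\<in>UNIV. p $ i *\<^sub>R A $ i)"
    by (simp add: vec_eq_iff vector_matrix_mult_def mult.commute)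
  then have "norm (p v* A) \<le> (\<Sum>i\<in>UNIV. \<bar>p $ i\<bar> * \<bar>norm (A $ i)\<bar>)"
    by (simp add: sum_norm_le)
  also have "\<dots> \<le> norm p * norm A"
    unfolding norm_vec_def[of p] norm_vec_def[of A] real_norm_def
    using L2_set_mult_ineq[of "\<lambda>i. p $ i" "\<lambda>i. norm (A $ i)" UNIV]
    by (simp add: L2_set_def)
  finally show ?thesis .
qed

lemma norm_matrix_vector_mult_le:
  fixes A :: "real ^ 'm ^ 'n"
  shows "norm (A *v x) \<le> norm A * norm x"
proof -
  have "norm (A *v x) = L2_set (\<lambda>i. A $ i \<bullet> x) UNIV"
    by (simp add: norm_vec_def L2_set_def matrix_vector_mul_component)
  also have "\<dots> \<le> L2_set (\<lambda>i. norm (A $ i) * norm x) UNIV"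
    unfolding L2_set_def
    by (intro real_sqrt_le_mono sum_mono)
       (metis Cauchy_Schwarz_ineq2 abs_ge_zero power2_abs power_mono)
  also have "\<dots> = norm A * norm x"
    by (simp add: L2_set_left_distrib[symmetric] norm_vec_def)
  finally show ?thesis .
qed

lemma bounded_bilinear_vector_matrix_mult:
  "bounded_bilinear ((v*) :: real ^ 'n \<Rightarrow> real ^ 'm ^ 'n \<Rightarrow> real ^ 'm)"
proof
  show "\<exists>K. \<forall>a b. norm ((a :: real ^ 'n) v* (b :: real ^ 'm ^ 'n)) \<le> norm a * norm b * K"
    by (rule exI[of _ 1]) (simp add: norm_vector_matrix_mult_le)
qed (simp_all add: vec_eq_iff vector_matrix_mult_def algebra_simps sum.distrib sum_distrib_left)

lemma bounded_bilinear_matrix_vector_mult: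
  "bounded_bilinear ((*v) :: real ^ 'm ^ 'n \<Rightarrow> real ^ 'm \<Rightarrow> real ^ 'n)"
proof
  show "\<exists>K. \<forall>a b. norm ((a :: real ^ 'm ^ 'n) *v (b :: real ^ 'm)) \<le> norm a * norm b * K"
    by (rule exI[of _ 1]) (simp add: norm_matrix_vector_mult_le)
qed (simp_all add: vec_eq_iff matrix_vector_mult_def algebra_simps sum.distrib sum_distrib_left)

lemma inner_matrix_vector_mult: "p \<bullet> ((A :: real ^ 'm ^ 'n) *v w) = (p v* A) \<bullet> w"
  by (simp add: dot_lmul_matrix)

lemma norm_le_spectral_norm:
  fixes A :: "real ^ 'm ^ 'n"
  shows "norm A \<le> real CARD('n) * real CARD('m) * spectral_norm A"
proof -
  have "norm A \<le> (\<Sum>i\<in>UNIV. norm (A $ i))"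
    unfolding norm_vec_def[of A] by (rule L2_set_le_sum) simp
  also have "\<dots> \<le> (\<Sum>i\<in>(UNIV :: 'n set). \<Sum>j\<in>(UNIV :: 'm set). \<bar>A $ i $ j\<bar>)"
    by (intro sum_mono norm_le_l1_cart)
  also have "\<dots> \<le> (\<Sum>i\<in>(UNIV :: 'n set). \<Sum>j\<in>(UNIV :: 'm set). spectral_norm A)"
    unfolding spectral_norm_def by (intro sum_mono matrix_component_le_onorm)
  finally show ?thesis by (simp add: mult.assoc)
qed

lemma spectral_norm_le_norm: "spectral_norm (A :: real ^ 'm ^ 'n) \<le> norm A"
  unfolding spectral_norm_def by (rule onorm_le) (rule norm_matrix_vector_mult_le)

text \<open>The supremum defining \<^const>\<open>tensor_norm\<close> is finite because a linear map on a
  finite-dimensional space is bounded; without this the bound on the supremum would say nothing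
  about the single values.\<close>

lemma norm_le_tensor_norm:
  fixes D :: "real ^ 'k \<Rightarrow> real ^ 'm ^ 'n"
  assumes D: "bounded_linear D"
  shows "norm (D h) \<le> real CARD('n) * real CARD('m) * tensor_norm D * norm h"
proof (cases "h = 0")
  case True
  then show ?thesis using linear_0[OF bounded_linear.linear[OF D]] by simp
next
  case False
  let ?e = "h /\<^sub>R norm h"
  have "bdd_above ((\<lambda>h. spectral_norm (D h)) ` {h. norm h = 1})"
  proof (rule bdd_aboveI2)
    show "spectral_norm (D h) \<le> onorm D" if "h \<in> {h. norm h = 1}" for h
      using spectral_norm_le_norm[of "D h"] onorm[OF D, of h] that by simp
  qed
  then have "spectral_norm (D ?e) \<le> tensor_norm D"
    unfolding tensor_norm_def by (rule cSUP_upper[rotated]) (use False in simp)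
  then have "norm (D ?e) \<le> real CARD('n) * real CARD('m) * tensor_norm D"
    by (intro order_trans[OF norm_le_spectral_norm] mult_left_mono) auto
  moreover have "norm (D ?e) = norm (D h) / norm h"
    by (simp add: linear_cmul[OF bounded_linear.linear[OF D]] divide_inverse mult.commute)
  ultimately show ?thesis
    using False by (simp add: divide_le_eq)
qed

lemma lipschitz_of_tensor_norm_bound:
  fixes f :: "real ^ 'k \<Rightarrow> real ^ 'm ^ 'n"
  assumes f: "\<And>z. f differentiable (at z)"
    and K: "\<And>z. tensor_norm (frechet_derivative f (at z)) \<le> K"
  shows "norm (f z - f w) \<le> real CARD('n) * real CARD('m) * K * norm (z - w)"
proof (rule differentiable_bound[of UNIV f "\<lambda>z. frechet_derivative f (at z)"])
  fix x
  have D: "(f has_derivative frechet_derivative f (at x)) (at x)"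
    using f frechet_derivative_works by blast
  then have bl: "bounded_linear (frechet_derivative f (at x))"
    by (rule has_derivative_bounded_linear)
  show "onorm (frechet_derivative f (at x)) \<le> real CARD('n) * real CARD('m) * K"
  proof (rule onorm_le)
    fix h
    show "norm (frechet_derivative f (at x) h) \<le> real CARD('n) * real CARD('m) * K * norm h"
      by (intro order_trans[OF norm_le_tensor_norm[OF bl]] mult_right_mono mult_left_mono K) auto
  qed
  show "(f has_derivative frechet_derivative f (at x)) (at x within UNIV)"
    using D by simp
qed auto

lemma lipschitz_of_jacobian_bound:
  fixes f :: "real ^ 'k \<Rightarrow> real ^ 'n"
  assumes f: "\<And>z. f differentiable (at z)"
    and K: "\<And>z. spectral_norm (jacobian f (at z)) \<le> K"
  shows "norm (f z - f w) \<le> K * norm (z - w)"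
proof (rule differentiable_bound[of UNIV f "\<lambda>z. (*v) (jacobian f (at z))"])
  show "(f has_derivative (*v) (jacobian f (at x))) (at x within UNIV)" for x
    using f jacobian_works by auto
  show "onorm ((*v) (jacobian f (at x))) \<le> K" for x
    using K unfolding spectral_norm_def .
qed auto

text \<open>Apply the mean value inequality to \<open>z \<mapsto> f z - Df(w) z\<close> on a ball about \<open>w\<close> of radius
  \<open>\<bar>z - w\<bar>\<close>: there the derivative of this map is at most \<open>K \<bar>z - w\<bar>\<close>.\<close>

lemma taylor_quadratic:
  fixes f :: "real ^ 'k \<Rightarrow> real ^ 'n"
  assumes f: "\<And>z. f differentiable (at z)"
    and K: "\<And>z w. norm (jacobian f (at z) - jacobian f (at w)) \<le> K * norm (z - w)"
    and K0: "0 \<le> K"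
  shows "norm (f z - f w - jacobian f (at w) *v (z - w)) \<le> K * (norm (z - w))\<^sup>2"
proof -
  let ?J = "\<lambda>x. jacobian f (at x)"
  let ?r = "norm (z - w)"
  let ?g = "\<lambda>x. f x - ?J w *v x"
  have "norm (?g z - ?g w) \<le> K * ?r * norm (z - w)"
  proof (rule differentiable_bound[of "cball w ?r" ?g "\<lambda>x h. ?J x *v h - ?J w *v h"])
    fix x assume x: "x \<in> cball w ?r"
    have "(f has_derivative (*v) (?J x)) (at x)"
      using f jacobian_works by blast
    then show "(?g has_derivative (\<lambda>h. ?J x *v h - ?J w *v h)) (at x within cball w ?r)"
      by (intro has_derivative_diff has_derivative_at_withinI[where s = "cball w ?r"]
          bounded_linear_imp_has_derivative matrix_vector_mul_bounded_linear)
    show "onorm (\<lambda>h. ?J x *v h - ?J w *v h) \<le> K * ?r"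
    proof (rule onorm_le)
      fix h
      have "norm (?J x *v h - ?J w *v h) \<le> norm (?J x - ?J w) * norm h"
        by (metis matrix_vector_mult_diff_rdistrib norm_matrix_vector_mult_le)
      also have "\<dots> \<le> K * ?r * norm h"
        using x K0
        by (intro mult_right_mono order_trans[OF K] mult_left_mono)
           (auto simp: dist_norm norm_minus_commute)
      finally show "norm (?J x *v h - ?J w *v h) \<le> K * ?r * norm h" .
    qed
  qed (auto simp: dist_norm norm_minus_commute)
  then show ?thesis
    by (simp add: power2_eq_square matrix_vector_mult_diff_distrib algebra_simps)
qed

lemma nonneg_quadratic_discriminant:
  fixes A B C :: real
  assumes q: "\<And>s. 0 \<le> A + 2 * s * B + s\<^sup>2 * C" and C: "0 \<le> C"
  shows "B\<^sup>2 \<le> A * C"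
proof (cases "C = 0")
  case True
  have "B = 0"
  proof (rule ccontr)
    assume B: "B \<noteq> 0"
    have "2 * (- (A + 1) / (2 * B)) * B = - (A + 1)" using B by simp
    then show False using q[of "- (A + 1) / (2 * B)"] True by simp
  qed
  then show ?thesis using True by simp
next
  case False
  then have C: "0 < C" using C by simp
  have "2 * (- B / C) * B = - 2 * (B\<^sup>2 / C)" "(- B / C)\<^sup>2 * C = B\<^sup>2 / C"
    using C by (simp_all add: power2_eq_square)
  then have "B\<^sup>2 / C \<le> A" using q[of "- B / C"] by linarith
  then show ?thesis using C by (simp add: divide_le_eq)
qed

text \<open>A maximiser of the quadratic form on the (compact) unit sphere is an eigenvector, since the
  nonpositive form \<open>x \<bullet> S x - \<lambda> \<bar>x\<bar>\<^sup>2\<close> has a critical point there. The bound \<open>\<bar>S v\<bar> \<le> \<lambda> \<bar>v\<bar>\<close> is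
  the Cauchy--Schwarz inequality of the positive semidefinite form \<open>v \<bullet> S w\<close> for \<open>w = S v\<close>.\<close>

lemma rayleigh_quotient:
  fixes S :: "real ^ 'n ^ 'n"
  assumes sym: "\<And>v w. v \<bullet> (S *v w) = (S *v v) \<bullet> w"
    and pos: "\<And>v. 0 \<le> v \<bullet> (S *v v)"
  defines "lam \<equiv> SUP v\<in>{v. norm v = 1}. v \<bullet> (S *v v)"
  shows "spectral_norm S = lam" "eigenvalue S lam" "\<And>c. eigenvalue S c \<Longrightarrow> c \<le> lam"
proof -
  let ?q = "\<lambda>v. v \<bullet> (S *v v)"
  have sphere: "{v :: real ^ 'n. norm v = 1} = sphere 0 1" by auto
  have cont: "continuous_on (sphere 0 1) ?q"
    by (intro continuous_intros bounded_linear.continuous_on[OF matrix_vector_mul_bounded_linear])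
  have ne: "sphere (0 :: real ^ 'n) 1 \<noteq> {}" by simp
  obtain m where m: "m \<in> sphere 0 1" "\<And>v. v \<in> sphere 0 1 \<Longrightarrow> ?q v \<le> ?q m"
    using continuous_attains_sup[OF compact_sphere ne cont] by blast
  have lam: "lam = ?q m"
    unfolding lam_def sphere using m by (intro cSup_eq_maximum) auto
  have m1: "norm m = 1" using m by simp
  have le: "?q v \<le> lam * (v \<bullet> v)" for v
  proof (cases "v = 0")
    case False
    let ?e = "v /\<^sub>R norm v"
    have "?q ?e \<le> lam" using m(2)[of ?e] False by (simp add: lam)
    moreover have "?q ?e = ?q v / (v \<bullet> v)"
      by (simp add: matrix_vector_mult_scaleR divide_inverse dot_square_norm power2_eq_square)
    ultimately show ?thesis using False by (simp add: divide_le_eq)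
  qed simp
  have lam0: "0 \<le> lam" using pos[of m] lam by simp
  have crit: "h \<bullet> (S *v m - lam *\<^sub>R m) = 0" for h
  proof -
    let ?b = "h \<bullet> (S *v m - lam *\<^sub>R m)" and ?c = "lam * (h \<bullet> h) - ?q h"
    have *: "2 * s * ?b \<le> s\<^sup>2 * ?c" for s
    proof -
      have "?q (m + s *\<^sub>R h) = lam + 2 * s * (h \<bullet> (S *v m)) + s\<^sup>2 * ?q h"
        using sym[of m h]
        by (simp add: matrix_vector_right_distrib matrix_vector_mult_scaleR inner_simps lam
            power2_eq_square inner_commute algebra_simps)
      moreover have "(m + s *\<^sub>R h) \<bullet> (m + s *\<^sub>R h) = 1 + 2 * s * (h \<bullet> m) + s\<^sup>2 * (h \<bullet> h)"
        using m1 by (simp add: inner_simps power2_eq_square inner_commute norm_eq_1)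
      ultimately have "lam + 2 * s * (h \<bullet> (S *v m)) + s\<^sup>2 * ?q h
          \<le> lam * (1 + 2 * s * (h \<bullet> m) + s\<^sup>2 * (h \<bullet> h))"
        using le[of "m + s *\<^sub>R h"] by metis
      then show ?thesis
        by (simp add: inner_diff_right inner_scaleR_right algebra_simps)
    qed
    have "?b\<^sup>2 \<le> 0 * ?c"
    proof (rule nonneg_quadratic_discriminant)
      show "0 \<le> 0 + 2 * s * ?b + s\<^sup>2 * ?c" for s using *[of "- s"] by simp
      show "0 \<le> ?c" using le[of h] by simp
    qed
    then show ?thesis by simp
  qed
  have "S *v m - lam *\<^sub>R m = 0"
    using crit[of "S *v m - lam *\<^sub>R m"] by simp
  then have eig: "S *v m = lam *\<^sub>R m" by simp
  moreover have "m \<noteq> 0" using m1 by auto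
  ultimately show "eigenvalue S lam" unfolding eigenvalue_def by blast
  have bound: "norm (S *v v) \<le> lam * norm v" for v
  proof -
    let ?w = "S *v v"
    have CS: "(v \<bullet> (S *v w))\<^sup>2 \<le> ?q v * ?q w" for w
    proof -
      have *: "0 \<le> ?q v + 2 * s * (v \<bullet> (S *v w)) + s\<^sup>2 * ?q w" for s
      proof -
        have "?q (v + s *\<^sub>R w) = ?q v + 2 * s * (v \<bullet> (S *v w)) + s\<^sup>2 * ?q w"
          using sym[of v w]
          by (simp add: matrix_vector_right_distrib matrix_vector_mult_scaleR inner_simps
              power2_eq_square inner_commute algebra_simps)
        then show ?thesis using pos[of "v + s *\<^sub>R w"] by simp
      qed
      show ?thesis
        by (rule nonneg_quadratic_discriminant[OF * pos])
    qed
    have "(norm ?w)\<^sup>2 = v \<bullet> (S *v ?w)"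
      using sym[of v ?w] by (simp add: dot_square_norm)
    then have "((norm ?w)\<^sup>2)\<^sup>2 \<le> ?q v * ?q ?w" using CS[of ?w] by simp
    also have "\<dots> \<le> (lam * (norm v)\<^sup>2) * (lam * (norm ?w)\<^sup>2)"
      using le[of v] le[of ?w] pos lam0 by (intro mult_mono) (auto simp: dot_square_norm)
    finally have "(norm ?w)\<^sup>2 * (norm ?w)\<^sup>2 \<le> (lam * norm v)\<^sup>2 * (norm ?w)\<^sup>2"
      by (simp add: power2_eq_square algebra_simps)
    then have *: "(norm ?w)\<^sup>2 \<le> (lam * norm v)\<^sup>2" if "?w \<noteq> 0"
      by (rule mult_right_le_imp_le) (use that in simp)
    show ?thesis
    proof (cases "?w = 0")
      case True
      then show ?thesis using lam0 by simp
    next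
      case False
      show ?thesis by (rule power2_le_imp_le[OF *[OF False]]) (use lam0 in simp)
    qed
  qed
  show "spectral_norm S = lam"
  proof (rule antisym)
    show "spectral_norm S \<le> lam"
      unfolding spectral_norm_def by (rule onorm_le) (rule bound)
    show "lam \<le> spectral_norm S"
      using norm_matrix_vector_le_spectral_norm[of S m] eig m1 lam0 by simp
  qed
  show "c \<le> lam" if "eigenvalue S c" for c
  proof -
    from that obtain v where v: "v \<noteq> 0" "S *v v = c *\<^sub>R v"
      by (auto simp: eigenvalue_def)
    have "c * (v \<bullet> v) \<le> lam * (v \<bullet> v)" using le[of v] v(2) by simp
    moreover have "0 < v \<bullet> v" using v(1) by simp
    ultimately show ?thesis by (rule mult_right_le_imp_le)
  qed
qed

lemma matrix_differentiableI:
  fixes f :: "'x::real_normed_vector \<Rightarrow> real ^ 'm ^ 'n"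
  assumes "\<And>i j. (\<lambda>x. f x $ i $ j) differentiable (at z)"
  shows "f differentiable (at z)"
  unfolding differentiable_componentwise_within[of f]
proof
  fix b :: "real ^ 'm ^ 'n" assume "b \<in> Basis"
  then obtain i j where "b = axis i (axis j 1)" by (auto simp: Basis_vec_def)
  then have "(\<lambda>x. f x \<bullet> b) = (\<lambda>x. f x $ i $ j)" by (auto simp: inner_axis)
  then show "(\<lambda>x. f x \<bullet> b) differentiable (at z)" using assms by simp
qed

lemma borel_measurable_vector_matrix_mult:
  fixes H :: "'x \<Rightarrow> real ^ 'm ^ 'n"
  assumes "H \<in> borel_measurable N"
  shows "(\<lambda>x. p v* H x) \<in> borel_measurable N"
proof -
  have "bounded_linear ((v*) p :: real ^ 'm ^ 'n \<Rightarrow> real ^ 'm)"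
    by (rule bounded_bilinear.bounded_linear_right[OF bounded_bilinear_vector_matrix_mult])
  then have "continuous_on UNIV ((v*) p :: real ^ 'm ^ 'n \<Rightarrow> real ^ 'm)"
    by (rule linear_continuous_on)
  then show ?thesis
    using assms borel_measurable_continuous_onI measurable_compose by blast
qed

lemma vector_matrix_mult_sum:
  fixes f :: "'j \<Rightarrow> real ^ 'm ^ 'n"
  shows "p v* (\<Sum>j\<in>J. f j) = (\<Sum>j\<in>J. p v* f j)"
  by (rule linear_sum[OF bounded_linear.linear
        [OF bounded_bilinear.bounded_linear_right[OF bounded_bilinear_vector_matrix_mult]]])

lemma vector_matrix_mult_scaleR: "p v* (c *\<^sub>R A) = c *\<^sub>R (p v* A)"
  for A :: "real ^ 'm ^ 'n"
  by (rule bounded_bilinear.scaleR_right[OF bounded_bilinear_vector_matrix_mult])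

lemma vector_matrix_mult_diff: "p v* (A - B) = p v* A - p v* B"
  for A :: "real ^ 'm ^ 'n"
  by (rule bounded_bilinear.diff_right[OF bounded_bilinear_vector_matrix_mult])

lemma borel_measurable_matrixI:
  fixes f :: "'x \<Rightarrow> real ^ 'm ^ 'n"
  assumes "\<And>i j. (\<lambda>x. f x $ i $ j) \<in> borel_measurable N"
  shows "f \<in> borel_measurable N"
proof (rule iffD2[OF borel_measurable_euclidean_space], rule ballI)
  fix b :: "real ^ 'm ^ 'n" assume "b \<in> Basis"
  then obtain i j where "b = axis i (axis j 1)" by (auto simp: Basis_vec_def)
  then have "(\<lambda>x. f x \<bullet> b) = (\<lambda>x. f x $ i $ j)" by (auto simp: inner_axis)
  then show "(\<lambda>x. f x \<bullet> b) \<in> borel_measurable N" using assms by simp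
qed

section \<open>Elementary real analysis\<close>

text \<open>The function \<open>s \<mapsto> exp (- K s) \<integral>\<^sub>0\<^sup>s f - \<integral>\<^sub>0\<^sup>s g\<close> vanishes at \<open>0\<close> and its derivative is nonpositive.\<close>

lemma gronwall_integral:
  fixes f g :: "real \<Rightarrow> real"
  assumes f: "continuous_on {0..t} f" and g: "continuous_on {0..t} g"
    and g0: "\<And>s. s \<in> {0..t} \<Longrightarrow> 0 \<le> g s" and K: "0 \<le> K"
    and le: "\<And>s. s \<in> {0..t} \<Longrightarrow> f s \<le> g s + K * integral {0..s} f"
    and t: "0 \<le> t"
  shows "integral {0..t} f \<le> exp (K * t) * integral {0..t} g"
proof -
  let ?h = "\<lambda>s. exp (- K * s) * integral {0..s} f - integral {0..s} g"
  have "?h t \<le> ?h 0"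
  proof (rule DERIV_nonpos_imp_decreasing_open[OF t])
    fix s assume s: "0 < s" "s < t"
    have "at s within {0..t} = at s"
      using s by (simp add: at_within_Icc_at)
    then have "((\<lambda>s. integral {0..s} f) has_real_derivative f s) (at s)"
      "((\<lambda>s. integral {0..s} g) has_real_derivative g s) (at s)"
      using integral_has_real_derivative[OF f, of s] integral_has_real_derivative[OF g, of s] s
      by auto
    then have D: "(?h has_real_derivative
        exp (- K * s) * (f s - K * integral {0..s} f) - g s) (at s)"
      by (auto intro!: derivative_eq_intros simp: algebra_simps)
    have "exp (- K * s) * (f s - K * integral {0..s} f) \<le> exp (- K * s) * g s"
      using le[of s] s by (intro mult_left_mono) auto
    also have "\<dots> \<le> 1 * g s"
      using g0[of s] s K by (intro mult_right_mono) auto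
    finally show "\<exists>y. (?h has_real_derivative y) (at s) \<and> y \<le> 0"
      using D by (intro exI[of _ "exp (- K * s) * (f s - K * integral {0..s} f) - g s"]) simp
  next
    show "continuous_on {0..t} ?h"
      by (intro continuous_intros indefinite_integral_continuous_1 integrable_continuous_real f g)
  qed
  then have "exp (- K * t) * integral {0..t} f \<le> integral {0..t} g" by simp
  then have "exp (K * t) * (exp (- K * t) * integral {0..t} f) \<le> exp (K * t) * integral {0..t} g"
    by (intro mult_left_mono) auto
  then show ?thesis by (simp add: mult.assoc[symmetric] exp_add[symmetric])
qed

lemma continuous_on_of_lipschitz:
  fixes f :: "real \<Rightarrow> 'c::real_normed_vector"
  assumes "\<And>a b. a \<in> S \<Longrightarrow> b \<in> S \<Longrightarrow> a \<le> b \<Longrightarrow> norm (f b - f a) \<le> L * (b - a)" and "0 \<le> L"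
  shows "continuous_on S f"
proof -
  have "L-lipschitz_on S f"
  proof (rule lipschitz_onI)
    fix a b assume "a \<in> S" "b \<in> S"
    then show "dist (f a) (f b) \<le> L * dist a b"
      using assms(1)[of a b] assms(1)[of b a]
      by (cases "a \<le> b") (auto simp: dist_norm norm_minus_commute)
  qed (rule assms)
  then show ?thesis by (rule lipschitz_on_continuous_on)
qed

text \<open>The derivative exists and vanishes everywhere.\<close>

lemma constant_of_quadratic_increment:
  fixes g :: "real \<Rightarrow> real"
  assumes inc: "\<And>a b. a \<in> {0..t} \<Longrightarrow> b \<in> {0..t} \<Longrightarrow> a \<le> b \<Longrightarrow> \<bar>g b - g a\<bar> \<le> C * (b - a)\<^sup>2"
    and ab: "a \<in> {0..t}" "b \<in> {0..t}"
  shows "g a = g b"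
proof -
  have inc': "\<bar>g b - g a\<bar> \<le> C * (b - a)\<^sup>2" if "a \<in> {0..t}" "b \<in> {0..t}" for a b
    using inc[OF that] inc[OF that(2,1)]
    by (cases "a \<le> b") (auto simp: abs_minus_commute power2_commute)
  have "(g has_derivative (\<lambda>h. 0)) (at x within {0..t})" if x: "x \<in> {0..t}" for x
    unfolding has_derivative_within
  proof (intro conjI)
    show "((\<lambda>y. (1 / norm (y - x)) *\<^sub>R (g y - (g x + 0))) \<longlongrightarrow> 0) (at x within {0..t})"
    proof (rule Lim_null_comparison)
      show "\<forall>\<^sub>F y in at x within {0..t}. norm ((1 / norm (y - x)) *\<^sub>R (g y - (g x + 0))) \<le> C * \<bar>y - x\<bar>"
        unfolding eventually_at_filter
      proof (rule always_eventually, intro allI impI)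
        fix y assume y: "y \<noteq> x" "y \<in> {0..t}"
        have "\<bar>g y - g x\<bar> \<le> C * \<bar>y - x\<bar> * \<bar>y - x\<bar>"
          using inc'[OF x y(2)] by (simp add: power2_eq_square mult.assoc flip: power2_abs)
        then show "norm ((1 / norm (y - x)) *\<^sub>R (g y - (g x + 0))) \<le> C * \<bar>y - x\<bar>"
          using y(1) by (simp add: abs_mult divide_le_eq)
      qed
      have "((\<lambda>y. C * \<bar>y - x\<bar>) \<longlongrightarrow> C * \<bar>x - x\<bar>) (at x within {0..t})"
        by (intro tendsto_intros)
      then show "((\<lambda>y. C * \<bar>y - x\<bar>) \<longlongrightarrow> 0) (at x within {0..t})" by simp
    qed
  qed simp
  then obtain c where "\<And>x. x \<in> {0..t} \<Longrightarrow> g x = c"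
    using has_derivative_zero_constant[of "{0..t}" g] by auto
  then show ?thesis using ab by simp
qed

lemma directional_difference_quotient:
  fixes f :: "'v::real_normed_vector \<Rightarrow> 'w::real_normed_vector"
  assumes D: "(f has_derivative D) (at x)"
  shows "(\<lambda>n. real (Suc n) *\<^sub>R (f (x + h /\<^sub>R real (Suc n)) - f x)) \<longlonglongrightarrow> D h"
proof (cases "h = 0")
  case True
  then show ?thesis using linear_0[OF has_derivative_linear[OF D]] by simp
next
  case False
  have lin: "linear D" by (rule has_derivative_linear[OF D])
  let ?y = "\<lambda>n. h /\<^sub>R real (Suc n)"
  have "(?y \<longlongrightarrow> 0 *\<^sub>R h) sequentially"
    by (intro tendsto_scaleR tendsto_const LIMSEQ_inverse_real_of_nat)
  then have y: "filterlim ?y (at 0) sequentially"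
    using False by (auto simp: filterlim_at)
  have "((\<lambda>y. norm (f (x + y) - f x - D y) / norm y) \<longlongrightarrow> 0) (at 0)"
    using D unfolding has_derivative_at by blast
  from filterlim_compose[OF this y]
  have "(\<lambda>n. norm (f (x + ?y n) - f x - D (?y n)) / norm (?y n) * norm h) \<longlonglongrightarrow> 0 * norm h"
    by (intro tendsto_mult tendsto_const)
  moreover have "norm (f (x + ?y n) - f x - D (?y n)) / norm (?y n) * norm h
      = norm (real (Suc n) *\<^sub>R (f (x + ?y n) - f x) - D h)" for n
  proof -
    have "real (Suc n) *\<^sub>R (f (x + ?y n) - f x) - D h = real (Suc n) *\<^sub>R (f (x + ?y n) - f x - D (?y n))"
      by (simp add: linear_cmul[OF lin] scaleR_diff_right del: of_nat_Suc)
    then have "norm (real (Suc n) *\<^sub>R (f (x + ?y n) - f x) - D h)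
        = real (Suc n) * norm (f (x + ?y n) - f x - D (?y n))"
      by (simp only: norm_scaleR abs_of_nat)
    moreover have "norm (?y n) = norm h / real (Suc n)" by (simp add: divide_inverse_commute)
    ultimately show ?thesis using False by (simp only: divide_divide_eq_right times_divide_eq_left) simp
  qed
  ultimately have "(\<lambda>n. norm (real (Suc n) *\<^sub>R (f (x + ?y n) - f x) - D h)) \<longlonglongrightarrow> 0" by simp
  then show ?thesis by (rule LIM_zero_cancel[OF tendsto_norm_zero_cancel])
qed

lemma sum_squares_2: "(a + b)\<^sup>2 \<le> 2 * a\<^sup>2 + 2 * (b :: real)\<^sup>2"
  using sum_squares_bound[of a b] by (simp add: power2_sum)

lemma sum_squares_3: "(a + b + c)\<^sup>2 \<le> 3 * a\<^sup>2 + 3 * b\<^sup>2 + 3 * (c :: real)\<^sup>2"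
  using sum_squares_bound[of a b] sum_squares_bound[of a c] sum_squares_bound[of b c]
  by (simp add: power2_eq_square algebra_simps)

lemma abs_SUP_diff_le:
  fixes f g :: "'p \<Rightarrow> real"
  assumes S: "S \<noteq> {}" and g: "\<And>p. p \<in> S \<Longrightarrow> g p \<le> c" and fg: "\<And>p. p \<in> S \<Longrightarrow> \<bar>f p - g p\<bar> \<le> e"
  shows "\<bar>(SUP p\<in>S. f p) - (SUP p\<in>S. g p)\<bar> \<le> e"
proof -
  have bg: "bdd_above (g ` S)" by (rule bdd_aboveI2) (rule g)
  have f: "f p \<le> g p + e" "g p \<le> f p + e" if "p \<in> S" for p using fg[OF that] by auto
  have bf: "bdd_above (f ` S)"
  proof (rule bdd_aboveI2)
    show "f p \<le> c + e" if "p \<in> S" for p using f(1)[OF that] g[OF that] by linarith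
  qed
  have "(SUP p\<in>S. f p) \<le> (SUP p\<in>S. g p) + e"
  proof (rule cSUP_least[OF S])
    fix p assume p: "p \<in> S"
    show "f p \<le> (SUP p\<in>S. g p) + e" using f(1)[OF p] cSUP_upper[OF p bg] by linarith
  qed
  moreover have "(SUP p\<in>S. g p) \<le> (SUP p\<in>S. f p) + e"
  proof (rule cSUP_least[OF S])
    fix p assume p: "p \<in> S"
    show "g p \<le> (SUP p\<in>S. f p) + e" using f(2)[OF p] cSUP_upper[OF p bf] by linarith
  qed
  ultimately show ?thesis by linarith
qed

section \<open>Measurability and integration on an initial interval\<close>

text \<open>A function that is measurable in one variable and continuous in the other is a pointwise
  limit of functions that depend on the latter variable only through a simple function.\<close>

lemma caratheodory_measurable:
  fixes f :: "'x::{metric_space, second_countable_topology} \<Rightarrow> 'b \<Rightarrow>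
    'c::{metric_space, second_countable_topology}"
  assumes f: "\<And>x. f x \<in> borel_measurable N"
    and cont: "\<And>b. b \<in> space N \<Longrightarrow> continuous_on UNIV (\<lambda>x. f x b)"
  shows "(\<lambda>z. f (fst z) (snd z)) \<in> borel_measurable (borel \<Otimes>\<^sub>M N)"
proof -
  have id: "(\<lambda>x :: 'x. x) \<in> borel_measurable borel" by simp
  obtain F :: "nat \<Rightarrow> 'x \<Rightarrow> 'x" where F: "\<And>i. simple_function borel (F i)"
    and lim: "\<And>x. (\<lambda>i. F i x) \<longlonglongrightarrow> x"
    using borel_measurable_implies_sequence_metric[OF id, of undefined] by auto
  show ?thesis
  proof (rule borel_measurable_LIMSEQ_metric)
    fix i
    show "(\<lambda>z. f (F i (fst z)) (snd z)) \<in> borel_measurable (borel \<Otimes>\<^sub>M N)"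
    proof (rule measurable_compose_countable'[where I = "range (F i)" and g = "\<lambda>z. F i (fst z)"])
      show "countable (range (F i))"
        using F[of i] by (simp add: simple_function_def countable_finite)
      have "F i \<in> borel \<rightarrow>\<^sub>M count_space (range (F i))"
        using F[of i] by (subst measurable_count_space_eq2) (auto simp: simple_function_def)
      then show "(\<lambda>z. F i (fst z)) \<in> borel \<Otimes>\<^sub>M N \<rightarrow>\<^sub>M count_space (range (F i))"
        by (rule measurable_compose[OF measurable_fst])
      show "(\<lambda>z. f x (snd z)) \<in> borel_measurable (borel \<Otimes>\<^sub>M N)" for x
        by (rule measurable_compose[OF measurable_snd f])
    qed
  next
    fix z :: "'x \<times> 'b" assume "z \<in> space (borel \<Otimes>\<^sub>M N)"
    then have "snd z \<in> space N" by (auto simp: space_pair_measure)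
    then have "isCont (\<lambda>x. f x (snd z)) (fst z)"
      using cont continuous_on_eq_continuous_at open_UNIV by blast
    then show "(\<lambda>i. f (F i (fst z)) (snd z)) \<longlonglongrightarrow> f (fst z) (snd z)"
      using lim isCont_tendsto_compose by blast
  qed
qed

text \<open>Set integrals over \<open>{0..t}\<close> are plain integrals for this finite measure, so that the theorems on
  product measures apply to them directly.\<close>

definition lborel_upto :: "real \<Rightarrow> real measure" where
  "lborel_upto t = restrict_space lborel {0..t}"

lemma space_lborel_upto [simp]: "space (lborel_upto t) = {0..t}"
  by (simp add: lborel_upto_def space_restrict_space)

lemma sets_lborel_upto: "sets (lborel_upto t) = sets (restrict_space borel {0..t})"
  by (simp add: lborel_upto_def sets_restrict_space)

lemma measurable_lborel_upto_cong:
  "measurable (lborel_upto t) N = measurable (restrict_space borel {0..t}) N"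
  by (rule measurable_cong_sets[OF sets_lborel_upto refl])

lemma measurable_lborel_upto_id: "(\<lambda>s. s) \<in> borel_measurable (lborel_upto t)"
  by (simp add: lborel_upto_def measurable_restrict_space1)

lemma finite_measure_lborel_upto: "finite_measure (lborel_upto t)"
proof
  show "emeasure (lborel_upto t) (space (lborel_upto t)) \<noteq> \<infinity>"
    unfolding space_lborel_upto
    by (cases "0 \<le> t") (simp_all add: lborel_upto_def emeasure_restrict_space)
qed

lemma sigma_finite_lborel_upto: "sigma_finite_measure (lborel_upto t)"
  by (rule finite_measure.axioms(1)[OF finite_measure_lborel_upto])

lemma measure_lborel_upto: "0 \<le> t \<Longrightarrow> measure (lborel_upto t) {0..t} = t"
  by (simp add: lborel_upto_def measure_restrict_space)

lemma integral_lborel_upto: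
  "(\<integral>s. f s \<partial>lborel_upto t) = (LINT s:{0..t}|lborel. f s)"
  for f :: "real \<Rightarrow> 'c::{banach, second_countable_topology}"
  by (simp add: lborel_upto_def integral_restrict_space set_lebesgue_integral_def)

lemma integrable_lborel_upto:
  "integrable (lborel_upto t) f \<longleftrightarrow> set_integrable lborel {0..t} f"
  for f :: "real \<Rightarrow> 'c::{banach, second_countable_topology}"
  by (simp add: lborel_upto_def integrable_restrict_space set_integrable_def)

lemma nn_integral_lborel_upto:
  "(\<integral>\<^sup>+s. f s \<partial>lborel_upto t) = (\<integral>\<^sup>+s\<in>{0..t}. f s \<partial>lborel)"
  by (simp add: lborel_upto_def nn_integral_restrict_space)

lemma integrable_bounded_lborel_upto:
  fixes f :: "real \<Rightarrow> 'c::{banach, second_countable_topology}"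
  assumes "f \<in> borel_measurable (lborel_upto t)" "\<And>s. s \<in> {0..t} \<Longrightarrow> norm (f s) \<le> C"
  shows "integrable (lborel_upto t) f"
  by (rule finite_measure.integrable_const_bound[OF finite_measure_lborel_upto, of _ C])
     (use assms in auto)

lemma integral_initial_segment:
  fixes f :: "real \<Rightarrow> 'c::{banach, second_countable_topology}"
  assumes "r \<le> t"
  shows "(\<integral>s. indicator {0..r} s *\<^sub>R f s \<partial>lborel_upto t) = (\<integral>s. f s \<partial>lborel_upto r)"
  unfolding integral_lborel_upto set_lebesgue_integral_def using assms
  by (intro Bochner_Integration.integral_cong) (auto simp: indicator_def)

lemma measurable_continuous_path:
  fixes X :: "real \<Rightarrow> 'a \<Rightarrow> 'c::{metric_space, second_countable_topology}"
  assumes t: "0 \<le> t"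
    and X: "\<And>s. s \<in> {0..t} \<Longrightarrow> X s \<in> borel_measurable M"
    and cont: "\<And>\<omega>. \<omega> \<in> space M \<Longrightarrow> continuous_on {0..t} (\<lambda>s. X s \<omega>)"
  shows "(\<lambda>z. X (fst z) (snd z)) \<in> borel_measurable (lborel_upto t \<Otimes>\<^sub>M M)"
proof -
  let ?c = "\<lambda>s. max 0 (min t s)"
  have "(\<lambda>z. X (?c (fst z)) (snd z)) \<in> borel_measurable (borel \<Otimes>\<^sub>M M)"
  proof (rule caratheodory_measurable)
    show "X (?c s) \<in> borel_measurable M" for s using t by (intro X) auto
    show "continuous_on UNIV (\<lambda>s. X (?c s) \<omega>)" if "\<omega> \<in> space M" for \<omega>
      using t by (intro continuous_on_compose2[OF cont[OF that], of UNIV ?c] continuous_intros) auto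
  qed
  moreover have "(\<lambda>z. z) \<in> lborel_upto t \<Otimes>\<^sub>M M \<rightarrow>\<^sub>M borel \<Otimes>\<^sub>M M"
    by (rule measurable_pair)
       (auto simp: comp_def intro: measurable_compose[OF measurable_fst measurable_lborel_upto_id])
  ultimately have "(\<lambda>z. X (?c (fst z)) (snd z)) \<in> borel_measurable (lborel_upto t \<Otimes>\<^sub>M M)"
    by (rule measurable_compose[rotated])
  then show ?thesis
    by (rule measurable_cong[THEN iffD1, rotated]) (auto simp: space_pair_measure)
qed

lemma
  fixes f :: "real \<Rightarrow> real"
  assumes "continuous_on {0..s} f"
  shows integral_lborel_upto_continuous: "(\<integral>r. f r \<partial>lborel_upto s) = integral {0..s} f"
    and integrable_lborel_upto_continuous: "integrable (lborel_upto s) f"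
proof -
  have i: "set_integrable lborel {0..s} f"
    by (rule borel_integrable_atLeastAtMost'[OF assms])
  then show "integrable (lborel_upto s) f" by (simp add: integrable_lborel_upto)
  show "(\<integral>r. f r \<partial>lborel_upto s) = integral {0..s} f"
    unfolding integral_lborel_upto by (rule set_borel_integral_eq_integral(2)[OF i])
qed

lemma gronwall:
  fixes f g :: "real \<Rightarrow> real"
  assumes f: "continuous_on {0..t} f" and g: "continuous_on {0..t} g"
    and g0: "\<And>s. s \<in> {0..t} \<Longrightarrow> 0 \<le> g s" and K: "0 \<le> K"
    and le: "\<And>s. s \<in> {0..t} \<Longrightarrow> f s \<le> g s + K * (\<integral>r. f r \<partial>lborel_upto s)"
    and s: "s \<in> {0..t}"
  shows "f s \<le> g s + K * exp (K * t) * (\<integral>r. g r \<partial>lborel_upto t)"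
proof -
  have sub: "continuous_on {0..r} f" "continuous_on {0..r} g" if "r \<le> t" for r
    using that by (auto intro: continuous_on_subset[OF f] continuous_on_subset[OF g])
  have "integral {0..s} f \<le> exp (K * s) * integral {0..s} g"
  proof (rule gronwall_integral)
    fix r assume "r \<in> {0..s}"
    then have r: "r \<in> {0..t}" using s by auto
    show "f r \<le> g r + K * integral {0..r} f"
      using le[OF r] integral_lborel_upto_continuous[OF sub(1), of r] r by simp
  qed (use s g0 K sub in auto)
  also have "\<dots> \<le> exp (K * t) * integral {0..t} g"
  proof (rule mult_mono)
    show "exp (K * s) \<le> exp (K * t)" using s K by (simp add: mult_left_mono)
    show "integral {0..s} g \<le> integral {0..t} g"
      using s g0 by (intro integral_subset_le integrable_continuous_real sub) auto
    show "0 \<le> integral {0..s} g"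
      using s g0 by (intro Henstock_Kurzweil_Integration.integral_nonneg integrable_continuous_real sub) auto
  qed simp
  finally have "K * integral {0..s} f \<le> K * (exp (K * t) * integral {0..t} g)"
    using K by (rule mult_left_mono)
  then show ?thesis
    using le[OF s] s integral_lborel_upto_continuous[OF sub(1), of s] integral_lborel_upto_continuous[OF g]
    by (simp add: mult.assoc)
qed

lemma integral_final_segment:
  fixes f :: "real \<Rightarrow> 'c::{banach, second_countable_topology}"
  assumes f: "integrable (lborel_upto t) f" and s: "0 \<le> s" "s \<le> t"
  shows "(\<integral>r. indicator {s..t} r *\<^sub>R f r \<partial>lborel_upto t) = (\<integral>r. f r \<partial>lborel_upto t) - (\<integral>r. f r \<partial>lborel_upto s)"
proof -
  have ft: "integrable lborel (\<lambda>r. indicator {0..t} r *\<^sub>R f r)"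
    using f by (simp add: integrable_lborel_upto set_integrable_def)
  have fs: "integrable lborel (\<lambda>r. indicator {0..s} r *\<^sub>R f r)"
    using set_integrable_subset[of lborel "{0..t}" f "{0..s}"] f s
    by (auto simp: integrable_lborel_upto set_integrable_def)
  have m: "(\<lambda>r. indicator {0..t} r *\<^sub>R indicator {s..t} r *\<^sub>R f r) \<in> borel_measurable lborel"
  proof -
    have "(\<lambda>r. indicator {0..t} r *\<^sub>R indicator {s..t} r *\<^sub>R f r) = (\<lambda>r. indicator {s..t} r *\<^sub>R (indicator {0..t} r *\<^sub>R f r))"
      by (auto simp: indicator_def)
    moreover have "(\<lambda>r. indicator {s..t} r *\<^sub>R (indicator {0..t} r *\<^sub>R f r)) \<in> borel_measurable lborel"
      by (rule borel_measurable_scaleR[OF _ borel_measurable_integrable[OF ft]]) simp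
    ultimately show ?thesis by (simp only:)
  qed
  have "(\<integral>r. indicator {s..t} r *\<^sub>R f r \<partial>lborel_upto t)
      = (\<integral>r. indicator {0..t} r *\<^sub>R f r - indicator {0..s} r *\<^sub>R f r \<partial>lborel)"
    unfolding integral_lborel_upto set_lebesgue_integral_def
  proof (rule integral_cong_AE[OF m])
    show "(\<lambda>r. indicator {0..t} r *\<^sub>R f r - indicator {0..s} r *\<^sub>R f r) \<in> borel_measurable lborel"
      using ft fs by auto
    show "AE r in lborel. indicator {0..t} r *\<^sub>R indicator {s..t} r *\<^sub>R f r
        = indicator {0..t} r *\<^sub>R f r - indicator {0..s} r *\<^sub>R f r"
      using AE_lborel_singleton[of s] by eventually_elim (use s in \<open>auto simp: indicator_def\<close>)
  qed
  then show ?thesis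
    using ft fs by (simp add: integral_lborel_upto set_lebesgue_integral_def)
qed

lemma norm_integral_segment_le:
  fixes f :: "real \<Rightarrow> 'c::{banach, second_countable_topology}"
  assumes [measurable]: "f \<in> borel_measurable (lborel_upto t)"
    and C: "\<And>r. r \<in> {s..t} \<Longrightarrow> norm (f r) \<le> C"
    and f: "integrable (lborel_upto t) f" and s: "0 \<le> s" "s \<le> t"
  shows "norm ((\<integral>r. f r \<partial>lborel_upto t) - (\<integral>r. f r \<partial>lborel_upto s)) \<le> C * (t - s)"
proof -
  have C0: "0 \<le> C" by (rule order_trans[OF norm_ge_zero C[of s]]) (use s in auto)
  have indm: "(\<lambda>r. indicator {s..t} r :: real) \<in> borel_measurable (lborel_upto t)"
    by (rule measurable_compose[OF measurable_lborel_upto_id]) simp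
  have le: "norm (indicator {s..t} r *\<^sub>R f r) \<le> C * indicator {s..t} r" for r
    using C[of r] by (cases "r \<in> {s..t}") auto
  have ind: "integrable (lborel_upto t) (\<lambda>r. C * indicator {s..t} r)"
    using C0 by (intro integrable_bounded_lborel_upto[of _ _ C] borel_measurable_times indm)
      (auto simp: indicator_def)
  have "integrable (lborel_upto t) (\<lambda>r. indicator {s..t} r *\<^sub>R f r)"
    by (rule Bochner_Integration.integrable_bound[OF ind borel_measurable_scaleR[OF indm assms(1)]])
       (use order_trans[OF le abs_ge_self] in \<open>simp only: real_norm_def, blast intro: AE_I2\<close>)
  then have "norm (\<integral>r. indicator {s..t} r *\<^sub>R f r \<partial>lborel_upto t) \<le> (\<integral>r. C * indicator {s..t} r \<partial>lborel_upto t)"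
    by (rule Bochner_Integration.integral_norm_bound_integral[OF _ ind]) (rule le)
  also have "(\<integral>r. C * indicator {s..t} r \<partial>lborel_upto t) = C * (t - s)"
  proof -
    have "indicator {0..t} r *\<^sub>R indicator {s..t} r = (indicator {s..t} r :: real)" for r
      using s by (auto simp: indicator_def)
    then have "(\<integral>r. indicator {s..t} r \<partial>lborel_upto t) = measure lborel {s..t}"
      unfolding integral_lborel_upto set_lebesgue_integral_def
      by (simp only: Bochner_Integration.integral_indicator space_lborel space_borel Int_UNIV_right)
    then show ?thesis using s by (simp only: integral_mult_right_zero measure_lborel_Icc)
  qed
  finally show ?thesis unfolding integral_final_segment[OF f s] .
qed

text \<open>Integration by parts for two indefinite integrals, which is Fubini's theorem on the triangle
  \<open>s \<le> r\<close>.\<close>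

lemma integral_by_parts_lborel_upto:
  fixes a g :: "real \<Rightarrow> 'v::euclidean_space" and p :: 'v
  assumes [measurable]: "a \<in> borel_measurable (lborel_upto t)" "g \<in> borel_measurable (lborel_upto t)"
    and a: "\<And>s. s \<in> {0..t} \<Longrightarrow> norm (a s) \<le> Ca" and g: "\<And>s. s \<in> {0..t} \<Longrightarrow> norm (g s) \<le> Cg"
    and t: "0 \<le> t"
  defines "\<pi> \<equiv> \<lambda>s. p + (\<integral>r. indicator {s..t} r *\<^sub>R a r \<partial>lborel_upto t)"
    and "U \<equiv> \<lambda>r. \<integral>s. g s \<partial>lborel_upto r"
  shows "p \<bullet> U t = (\<integral>s. \<pi> s \<bullet> g s \<partial>lborel_upto t) - (\<integral>r. a r \<bullet> U r \<partial>lborel_upto t)"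
proof -
  note measurable_lborel_upto_id [measurable]
  let ?P = "lborel_upto t"
  interpret P: finite_measure ?P by (rule finite_measure_lborel_upto)
  interpret PP: pair_sigma_finite ?P ?P ..
  have Ca: "0 \<le> Ca" using a[of 0] t by (auto intro: order_trans[OF norm_ge_zero])
  have int: "integrable ?P a" "integrable ?P g"
    by (rule integrable_bounded_lborel_upto[OF assms(1) a], assumption)
       (rule integrable_bounded_lborel_upto[OF assms(2) g], assumption)
  have m: "(\<lambda>z. indicator {fst z..t} (snd z) *\<^sub>R (a (snd z) \<bullet> g (fst z)))
      \<in> borel_measurable (?P \<Otimes>\<^sub>M ?P)"
  proof -
    have "(\<lambda>z. indicator {fst z..t} (snd z) :: real) = (\<lambda>z. if fst z \<le> snd z \<and> snd z \<le> t then 1 else 0)"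
      by (auto simp: indicator_def)
    then have [measurable]: "(\<lambda>z. indicator {fst z..t} (snd z) :: real) \<in> borel_measurable (?P \<Otimes>\<^sub>M ?P)"
      by simp
    show ?thesis by measurable
  qed
  have "finite_measure (?P \<Otimes>\<^sub>M ?P)"
    by (intro finite_measure_pair_measure P.finite_measure_axioms)
  then have ii: "integrable (?P \<Otimes>\<^sub>M ?P) (\<lambda>z. indicator {fst z..t} (snd z) *\<^sub>R (a (snd z) \<bullet> g (fst z)))"
  proof (rule finite_measure.integrable_const_bound[OF _ _ m, of "Ca * Cg"])
    show "AE z in ?P \<Otimes>\<^sub>M ?P. norm (indicator {fst z..t} (snd z) *\<^sub>R (a (snd z) \<bullet> g (fst z))) \<le> Ca * Cg"
    proof (rule AE_I2)
      fix z assume "z \<in> space (?P \<Otimes>\<^sub>M ?P)"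
      then have z: "fst z \<in> {0..t}" "snd z \<in> {0..t}" by (auto simp: space_pair_measure)
      have "norm (indicator {fst z..t} (snd z) *\<^sub>R (a (snd z) \<bullet> g (fst z)))
          \<le> \<bar>a (snd z) \<bullet> g (fst z)\<bar>" by (auto simp: indicator_def)
      also have "\<dots> \<le> norm (a (snd z)) * norm (g (fst z))" by (rule Cauchy_Schwarz_ineq2)
      also have "\<dots> \<le> Ca * Cg" by (intro mult_mono a g z) (auto simp: Ca)
      finally show "norm (indicator {fst z..t} (snd z) *\<^sub>R (a (snd z) \<bullet> g (fst z))) \<le> Ca * Cg" .
    qed
  qed
  have inda: "integrable ?P (\<lambda>r. indicator {s..t} r *\<^sub>R a r)" for s
    using a by (intro integrable_bounded_lborel_upto[where C = Ca])
      (auto simp: indicator_def Ca intro: order_trans)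
  have indg: "integrable ?P (\<lambda>s. indicator {0..r} s *\<^sub>R g s)" for r
    using g t by (intro integrable_bounded_lborel_upto[where C = Cg])
      (auto simp: indicator_def intro: order_trans[OF norm_ge_zero g])
  have L: "(\<integral>s. (\<integral>r. indicator {s..t} r *\<^sub>R (a r \<bullet> g s) \<partial>?P) \<partial>?P)
      = (\<integral>s. (\<integral>r. indicator {s..t} r *\<^sub>R a r \<partial>?P) \<bullet> g s \<partial>?P)"
    by (intro Bochner_Integration.integral_cong refl)
       (simp add: integral_inner_left[OF inda, symmetric])
  have R: "(\<integral>r. (\<integral>s. indicator {s..t} r *\<^sub>R (a r \<bullet> g s) \<partial>?P) \<partial>?P) = (\<integral>r. a r \<bullet> U r \<partial>?P)"
  proof (rule Bochner_Integration.integral_cong[OF refl])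
    fix r assume "r \<in> space ?P"
    then have r: "0 \<le> r" "r \<le> t" by auto
    have "(\<integral>s. indicator {s..t} r *\<^sub>R (a r \<bullet> g s) \<partial>?P)
        = (\<integral>s. a r \<bullet> (indicator {0..r} s *\<^sub>R g s) \<partial>?P)"
      using r by (intro Bochner_Integration.integral_cong refl) (auto simp: indicator_def)
    also have "\<dots> = a r \<bullet> (\<integral>s. indicator {0..r} s *\<^sub>R g s \<partial>?P)"
      by (rule integral_inner_right[OF indg])
    finally show "(\<integral>s. indicator {s..t} r *\<^sub>R (a r \<bullet> g s) \<partial>?P) = a r \<bullet> U r"
      unfolding U_def integral_initial_segment[OF r(2)] .
  qed
  have F: "(\<integral>s. (\<integral>r. indicator {s..t} r *\<^sub>R a r \<partial>?P) \<bullet> g s \<partial>?P) = (\<integral>r. a r \<bullet> U r \<partial>?P)"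
    unfolding L[symmetric] R[symmetric]
    using PP.Fubini_integral[of "\<lambda>s r. indicator {s..t} r *\<^sub>R (a r \<bullet> g s)"] ii
    by (simp add: case_prod_unfold)
  have iF: "integrable ?P (\<lambda>s. (\<integral>r. indicator {s..t} r *\<^sub>R a r \<partial>?P) \<bullet> g s)"
  proof -
    have "integrable ?P (\<lambda>s. \<integral>r. indicator {s..t} r *\<^sub>R (a r \<bullet> g s) \<partial>?P)"
      using PP.integrable_fst'[OF ii] by simp
    moreover have "(\<lambda>s. \<integral>r. indicator {s..t} r *\<^sub>R (a r \<bullet> g s) \<partial>?P)
        = (\<lambda>s. (\<integral>r. indicator {s..t} r *\<^sub>R a r \<partial>?P) \<bullet> g s)"
      by (simp add: integral_inner_left[OF inda, symmetric])
    ultimately show ?thesis by simp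
  qed
  have "p \<bullet> U t = (\<integral>s. p \<bullet> g s \<partial>?P)"
    unfolding U_def by (rule integral_inner_right[OF int(2), symmetric])
  also have "\<dots> = (\<integral>s. \<pi> s \<bullet> g s \<partial>?P) - (\<integral>s. (\<integral>r. indicator {s..t} r *\<^sub>R a r \<partial>?P) \<bullet> g s \<partial>?P)"
    unfolding \<pi>_def inner_add_left
    using iF integrable_inner_right[OF int(2), of p] by simp
  finally show ?thesis unfolding F .
qed

lemma measurable_lborel_upto_pair_mono:
  assumes f: "f \<in> borel_measurable (restrict_space borel {0..s} \<Otimes>\<^sub>M M)" and us: "u \<le> s"
  shows "f \<in> borel_measurable (lborel_upto u \<Otimes>\<^sub>M M)"
proof -
  have "(\<lambda>x :: real. x) \<in> lborel_upto u \<rightarrow>\<^sub>M restrict_space borel {0..s}"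
    using us by (intro measurable_restrict_space2 measurable_lborel_upto_id) auto
  then have "(\<lambda>z. (fst z, snd z)) \<in> lborel_upto u \<Otimes>\<^sub>M M \<rightarrow>\<^sub>M restrict_space borel {0..s} \<Otimes>\<^sub>M M"
    by (intro measurable_Pair measurable_snd measurable_compose[OF measurable_fst])
  then show ?thesis
    using measurable_compose[OF _ f] by simp
qed

lemma nn_integral_lborel_upto_pair:
  assumes M: "sigma_finite_measure M" and [measurable]: "G \<in> borel_measurable (lborel_upto u \<Otimes>\<^sub>M M)"
  shows "(\<integral>\<^sup>+z. G z \<partial>(lborel_upto u \<Otimes>\<^sub>M M)) = (\<integral>\<^sup>+\<omega>. (\<integral>\<^sup>+s\<in>{0..u}. G (s, \<omega>) \<partial>lborel) \<partial>M)"
proof -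
  interpret M: sigma_finite_measure M by (rule M)
  interpret U: sigma_finite_measure "lborel_upto u" by (rule sigma_finite_lborel_upto)
  interpret pair_sigma_finite "lborel_upto u" M ..
  show ?thesis
    unfolding nn_integral_lborel_upto[symmetric]
    using nn_integral_snd[of G] by simp
qed

lemma integral_indicator_pair:
  fixes f :: "real \<times> 'a \<Rightarrow> real"
  assumes M: "sigma_finite_measure M" and f: "integrable (lborel_upto t \<Otimes>\<^sub>M M) f"
    and fu: "integrable (lborel_upto r \<Otimes>\<^sub>M M) f" and r: "r \<le> t"
  shows "(\<integral>z. f z \<partial>(lborel_upto r \<Otimes>\<^sub>M M)) = (\<integral>z. indicator {0..r} (fst z) * f z \<partial>(lborel_upto t \<Otimes>\<^sub>M M))"
proof -
  interpret M: sigma_finite_measure M by (rule M)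
  interpret R: sigma_finite_measure "lborel_upto r" by (rule sigma_finite_lborel_upto)
  interpret L: sigma_finite_measure "lborel_upto t" by (rule sigma_finite_lborel_upto)
  interpret RM: pair_sigma_finite "lborel_upto r" M ..
  interpret LM: pair_sigma_finite "lborel_upto t" M ..
  have m: "(\<lambda>z. indicator {0..r} (fst z) :: real) \<in> borel_measurable (lborel_upto t \<Otimes>\<^sub>M M)"
    by (rule measurable_compose[OF measurable_compose[OF measurable_fst measurable_lborel_upto_id]]) simp
  have "integrable (lborel_upto t \<Otimes>\<^sub>M M) (\<lambda>z. indicator {0..r} (fst z) * f z)"
    by (rule Bochner_Integration.integrable_bound[OF f borel_measurable_times[OF m borel_measurable_integrable[OF f]]])
       (auto simp: indicator_def)
  from LM.integral_fst'[OF this]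
  have "(\<integral>z. indicator {0..r} (fst z) * f z \<partial>(lborel_upto t \<Otimes>\<^sub>M M))
      = (\<integral>s. indicator {0..r} s *\<^sub>R (\<integral>\<omega>. f (s, \<omega>) \<partial>M) \<partial>lborel_upto t)"
    by simp
  also have "\<dots> = (\<integral>s. (\<integral>\<omega>. f (s, \<omega>) \<partial>M) \<partial>lborel_upto r)"
    by (rule integral_initial_segment[OF r])
  also have "\<dots> = (\<integral>z. f z \<partial>(lborel_upto r \<Otimes>\<^sub>M M))"
    by (rule RM.integral_fst'[OF fu])
  finally show ?thesis ..
qed

section \<open>Square integrable functions\<close>

definition sq_integrable :: "'x measure \<Rightarrow> ('x \<Rightarrow> 'v::euclidean_space) \<Rightarrow> bool" where
  "sq_integrable N f \<longleftrightarrow> f \<in> borel_measurable N \<and> integrable N (\<lambda>x. (norm (f x))\<^sup>2)"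

lemma sq_integrableD [dest]:
  assumes "sq_integrable N f"
  shows "f \<in> borel_measurable N" "integrable N (\<lambda>x. (norm (f x))\<^sup>2)"
  using assms by (auto simp: sq_integrable_def)

lemma sq_integrable_bound:
  assumes f: "sq_integrable N f" and [measurable]: "g \<in> borel_measurable N"
    and le: "AE x in N. norm (g x) \<le> C * norm (f x)"
  shows "sq_integrable N g"
proof -
  have *: "integrable N (\<lambda>x. C\<^sup>2 * (norm (f x))\<^sup>2)" using sq_integrableD(2)[OF f] by simp
  have "AE x in N. norm ((norm (g x))\<^sup>2) \<le> norm (C\<^sup>2 * (norm (f x))\<^sup>2)"
    using le
  proof eventually_elim
    fix x assume "norm (g x) \<le> C * norm (f x)"
    then have "(norm (g x))\<^sup>2 \<le> (C * norm (f x))\<^sup>2" by (intro power_mono) auto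
    then show "norm ((norm (g x))\<^sup>2) \<le> norm (C\<^sup>2 * (norm (f x))\<^sup>2)"
      by (simp add: power_mult_distrib)
  qed
  then have "integrable N (\<lambda>x. (norm (g x))\<^sup>2)"
    by (rule Bochner_Integration.integrable_bound[OF *, rotated]) measurable
  then show ?thesis by (simp add: sq_integrable_def)
qed

lemma integrable_inner_of_sq_integrable:
  assumes f: "sq_integrable N f" and g: "sq_integrable N g"
  shows "integrable N (\<lambda>x. f x \<bullet> g x)"
proof (rule Bochner_Integration.integrable_bound)
  show "integrable N (\<lambda>x. (norm (f x))\<^sup>2 + (norm (g x))\<^sup>2)" using f g by auto
  show "(\<lambda>x. f x \<bullet> g x) \<in> borel_measurable N"
    using f g by (auto dest!: sq_integrableD(1))
  show "AE x in N. norm (f x \<bullet> g x) \<le> norm ((norm (f x))\<^sup>2 + (norm (g x))\<^sup>2)"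
  proof (rule AE_I2)
    fix x
    have "\<bar>f x \<bullet> g x\<bar> \<le> norm (f x) * norm (g x)" by (rule Cauchy_Schwarz_ineq2)
    also have "\<dots> \<le> (norm (f x))\<^sup>2 + (norm (g x))\<^sup>2"
    proof -
      have "0 \<le> norm (f x) * norm (g x)" by simp
      then show ?thesis
        using sum_squares_bound[of "norm (f x)" "norm (g x)"] unfolding mult.assoc by linarith
    qed
    finally show "norm (f x \<bullet> g x) \<le> norm ((norm (f x))\<^sup>2 + (norm (g x))\<^sup>2)" by simp
  qed
qed

lemma sq_integrable_add:
  assumes f: "sq_integrable N f" and g: "sq_integrable N g"
  shows "sq_integrable N (\<lambda>x. f x + g x)"
proof -
  have "integrable N (\<lambda>x. (norm (f x))\<^sup>2 + 2 * (f x \<bullet> g x) + (norm (g x))\<^sup>2)"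
    using sq_integrableD(2)[OF f] sq_integrableD(2)[OF g] integrable_inner_of_sq_integrable[OF f g]
    by simp
  moreover have "(norm (f x + g x))\<^sup>2 = (norm (f x))\<^sup>2 + 2 * (f x \<bullet> g x) + (norm (g x))\<^sup>2" for x
    by (simp add: power2_norm_eq_inner inner_simps inner_commute)
  ultimately show ?thesis
    using f g by (auto simp: sq_integrable_def)
qed

lemma sq_integrable_scaleR: "sq_integrable N f \<Longrightarrow> sq_integrable N (\<lambda>x. c *\<^sub>R f x)"
  by (rule sq_integrable_bound[of N f _ "\<bar>c\<bar>"]) (auto dest: sq_integrableD(1))

lemma sq_integrable_diff:
  "sq_integrable N f \<Longrightarrow> sq_integrable N g \<Longrightarrow> sq_integrable N (\<lambda>x. f x - g x)"
  using sq_integrable_add[of N f "\<lambda>x. (- 1) *\<^sub>R g x"] sq_integrable_scaleR[of N g "- 1"] by simp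

lemma L2_Cauchy_Schwarz:
  assumes f: "sq_integrable N f" and g: "sq_integrable N g"
  shows "\<bar>\<integral>x. f x \<bullet> g x \<partial>N\<bar> \<le> sqrt (\<integral>x. (norm (f x))\<^sup>2 \<partial>N) * sqrt (\<integral>x. (norm (g x))\<^sup>2 \<partial>N)"
proof -
  note i = integrable_inner_of_sq_integrable[OF f g]
  have "(\<integral>x. f x \<bullet> g x \<partial>N)\<^sup>2 \<le> (\<integral>x. (norm (f x))\<^sup>2 \<partial>N) * (\<integral>x. (norm (g x))\<^sup>2 \<partial>N)"
  proof (rule nonneg_quadratic_discriminant)
    fix s :: real
    have eq: "(norm (f x + s *\<^sub>R g x))\<^sup>2 = (norm (f x))\<^sup>2 + 2 * s * (f x \<bullet> g x) + s\<^sup>2 * (norm (g x))\<^sup>2" for x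
      unfolding power2_norm_eq_inner
      by (simp add: inner_simps inner_commute power2_eq_square algebra_simps)
    have "0 \<le> (\<integral>x. (norm (f x + s *\<^sub>R g x))\<^sup>2 \<partial>N)" by simp
    also have "\<dots> = (\<integral>x. (norm (f x))\<^sup>2 \<partial>N) + 2 * s * (\<integral>x. f x \<bullet> g x \<partial>N) + s\<^sup>2 * (\<integral>x. (norm (g x))\<^sup>2 \<partial>N)"
      unfolding eq using i sq_integrableD(2)[OF f] sq_integrableD(2)[OF g] by simp
    finally show "0 \<le> \<dots>" .
  qed simp
  then have "sqrt ((\<integral>x. f x \<bullet> g x \<partial>N)\<^sup>2) \<le> sqrt ((\<integral>x. (norm (f x))\<^sup>2 \<partial>N) * (\<integral>x. (norm (g x))\<^sup>2 \<partial>N))"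
    by (rule real_sqrt_le_mono)
  then show ?thesis by (simp add: real_sqrt_mult)
qed

lemma sq_integrable_nn:
  assumes [measurable]: "f \<in> borel_measurable N"
    and "(\<integral>\<^sup>+x. ennreal ((norm (f x))\<^sup>2) \<partial>N) < \<infinity>"
  shows "sq_integrable N f"
  using assms by (auto simp: sq_integrable_def integrable_iff_bounded)

text \<open>The difference of the inner products splits into three terms, each with a factor that tends to zero
  in \<open>L\<^sup>2\<close>. The limits are square integrable since they differ from some member of their sequences by a
  square integrable function.\<close>

lemma L2_inner_tendsto:
  assumes fs: "\<And>n. sq_integrable N (fs n)" and gs: "\<And>n. sq_integrable N (gs n)"
    and [measurable]: "f \<in> borel_measurable N" "g \<in> borel_measurable N"
    and f0: "(\<lambda>n. \<integral>\<^sup>+x. ennreal ((norm (fs n x - f x))\<^sup>2) \<partial>N) \<longlonglongrightarrow> 0"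
    and g0: "(\<lambda>n. \<integral>\<^sup>+x. ennreal ((norm (gs n x - g x))\<^sup>2) \<partial>N) \<longlonglongrightarrow> 0"
  shows "sq_integrable N f" "sq_integrable N g"
    and "(\<lambda>n. \<integral>x. fs n x \<bullet> gs n x \<partial>N) \<longlonglongrightarrow> (\<integral>x. f x \<bullet> g x \<partial>N)"
proof -
  have *: "sq_integrable N f \<and> (\<lambda>n. \<integral>x. (norm (fs n x - f x))\<^sup>2 \<partial>N) \<longlonglongrightarrow> 0"
    if fs: "\<And>n. sq_integrable N (fs n)" and [measurable]: "f \<in> borel_measurable N"
      and f0: "(\<lambda>n. \<integral>\<^sup>+x. ennreal ((norm (fs n x - f x))\<^sup>2) \<partial>N) \<longlonglongrightarrow> 0"
    for fs :: "nat \<Rightarrow> 'a \<Rightarrow> 'b" and f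
  proof -
    have [measurable]: "fs n \<in> borel_measurable N" for n using fs by auto
    have "eventually (\<lambda>n. (\<integral>\<^sup>+x. ennreal ((norm (fs n x - f x))\<^sup>2) \<partial>N) < 1) sequentially"
      using order_tendstoD(2)[OF f0, of 1] by simp
    then obtain n where "(\<integral>\<^sup>+x. ennreal ((norm (fs n x - f x))\<^sup>2) \<partial>N) < 1"
      by (auto simp: eventually_sequentially)
    then have "(\<integral>\<^sup>+x. ennreal ((norm (fs n x - f x))\<^sup>2) \<partial>N) < \<infinity>"
      by (rule order_less_trans) simp
    then have "sq_integrable N (\<lambda>x. fs n x - f x)"
      by (intro sq_integrable_nn) auto
    then have "sq_integrable N (\<lambda>x. fs n x - (fs n x - f x))"
      by (rule sq_integrable_diff[OF fs])
    then have f: "sq_integrable N f" by simp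
    have "(\<integral>\<^sup>+x. ennreal ((norm (fs n x - f x))\<^sup>2) \<partial>N) = ennreal (\<integral>x. (norm (fs n x - f x))\<^sup>2 \<partial>N)" for n
      using sq_integrableD(2)[OF sq_integrable_diff[OF fs f]] by (intro nn_integral_eq_integral) auto
    then have "(\<lambda>n. ennreal (\<integral>x. (norm (fs n x - f x))\<^sup>2 \<partial>N)) \<longlonglongrightarrow> ennreal 0"
      using f0 by simp
    then have "(\<lambda>n. \<integral>x. (norm (fs n x - f x))\<^sup>2 \<partial>N) \<longlonglongrightarrow> 0"
      by (subst (asm) tendsto_ennreal_iff) auto
    with f show ?thesis by simp
  qed
  show f: "sq_integrable N f" and g: "sq_integrable N g"
    using *[OF fs _ f0] *[OF gs _ g0] by auto
  define a b where "a n = (\<integral>x. (norm (fs n x - f x))\<^sup>2 \<partial>N)" and "b n = (\<integral>x. (norm (gs n x - g x))\<^sup>2 \<partial>N)" for n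
  let ?F = "\<integral>x. (norm (f x))\<^sup>2 \<partial>N" and ?G = "\<integral>x. (norm (g x))\<^sup>2 \<partial>N"
  have ab: "a \<longlonglongrightarrow> 0" "b \<longlonglongrightarrow> 0"
    unfolding a_def b_def using *[OF fs _ f0] *[OF gs _ g0] by auto
  note df = sq_integrable_diff[OF fs f] and dg = sq_integrable_diff[OF gs g]
  have le: "norm ((\<integral>x. fs n x \<bullet> gs n x \<partial>N) - (\<integral>x. f x \<bullet> g x \<partial>N))
      \<le> sqrt (a n) * sqrt (b n) + sqrt ?F * sqrt (b n) + sqrt (a n) * sqrt ?G" for n
  proof -
    have "(\<integral>x. fs n x \<bullet> gs n x \<partial>N) - (\<integral>x. f x \<bullet> g x \<partial>N)
        = (\<integral>x. fs n x \<bullet> gs n x - f x \<bullet> g x \<partial>N)"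
      by (simp add: integrable_inner_of_sq_integrable fs gs f g)
    also have "\<dots> = (\<integral>x. (fs n x - f x) \<bullet> (gs n x - g x) + f x \<bullet> (gs n x - g x) + (fs n x - f x) \<bullet> g x \<partial>N)"
      by (simp add: inner_simps algebra_simps)
    also have "\<dots> = (\<integral>x. (fs n x - f x) \<bullet> (gs n x - g x) \<partial>N) + (\<integral>x. f x \<bullet> (gs n x - g x) \<partial>N)
        + (\<integral>x. (fs n x - f x) \<bullet> g x \<partial>N)"
      using integrable_inner_of_sq_integrable[OF df dg, of n n] integrable_inner_of_sq_integrable[OF f dg, of n]
        integrable_inner_of_sq_integrable[OF df g, of n] by simp
    finally show ?thesis
      using L2_Cauchy_Schwarz[OF df[of n] dg[of n]] L2_Cauchy_Schwarz[OF f dg[of n]]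
        L2_Cauchy_Schwarz[OF df[of n] g] unfolding a_def b_def real_norm_def by linarith
  qed
  have "(\<lambda>n. sqrt (a n) * sqrt (b n) + sqrt ?F * sqrt (b n) + sqrt (a n) * sqrt ?G)
      \<longlonglongrightarrow> sqrt 0 * sqrt 0 + sqrt ?F * sqrt 0 + sqrt 0 * sqrt ?G"
    by (intro tendsto_intros ab)
  then have "(\<lambda>n. sqrt (a n) * sqrt (b n) + sqrt ?F * sqrt (b n) + sqrt (a n) * sqrt ?G) \<longlonglongrightarrow> 0" by simp
  then have "(\<lambda>n. (\<integral>x. fs n x \<bullet> gs n x \<partial>N) - (\<integral>x. f x \<bullet> g x \<partial>N)) \<longlonglongrightarrow> 0"
    by (rule Lim_null_comparison[OF always_eventually, rotated]) (rule allI, rule le)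
  then show "(\<lambda>n. \<integral>x. fs n x \<bullet> gs n x \<partial>N) \<longlonglongrightarrow> (\<integral>x. f x \<bullet> g x \<partial>N)"
    using LIM_zero_iff by blast
qed

lemma nn_L2_tendsto_0_mono:
  fixes X :: "nat \<Rightarrow> 'x \<Rightarrow> 'v::real_normed_vector" and Y :: "nat \<Rightarrow> 'x \<Rightarrow> 'w::real_normed_vector"
  assumes lim: "(\<lambda>n. \<integral>\<^sup>+x. ennreal ((norm (X n x))\<^sup>2) \<partial>N) \<longlonglongrightarrow> 0"
    and [measurable]: "\<And>n. X n \<in> borel_measurable N"
    and le: "\<And>n x. norm (Y n x) \<le> C * norm (X n x)"
  shows "(\<lambda>n. \<integral>\<^sup>+x. ennreal ((norm (Y n x))\<^sup>2) \<partial>N) \<longlonglongrightarrow> 0"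
proof (rule tendsto_sandwich[OF _ _ tendsto_const])
  have "(\<integral>\<^sup>+x. ennreal ((norm (Y n x))\<^sup>2) \<partial>N) \<le> ennreal (C\<^sup>2) * (\<integral>\<^sup>+x. ennreal ((norm (X n x))\<^sup>2) \<partial>N)" for n
  proof -
    have "(\<integral>\<^sup>+x. ennreal ((norm (Y n x))\<^sup>2) \<partial>N) \<le> (\<integral>\<^sup>+x. ennreal (C\<^sup>2) * ennreal ((norm (X n x))\<^sup>2) \<partial>N)"
    proof (rule nn_integral_mono)
      fix x
      have "(norm (Y n x))\<^sup>2 \<le> (C * norm (X n x))\<^sup>2" by (rule power_mono[OF le]) simp
      then show "ennreal ((norm (Y n x))\<^sup>2) \<le> ennreal (C\<^sup>2) * ennreal ((norm (X n x))\<^sup>2)"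
        by (simp add: ennreal_mult[symmetric] power_mult_distrib)
    qed
    also have "\<dots> = ennreal (C\<^sup>2) * (\<integral>\<^sup>+x. ennreal ((norm (X n x))\<^sup>2) \<partial>N)"
      by (rule nn_integral_cmult) measurable
    finally show ?thesis .
  qed
  then show "\<forall>\<^sub>F n in sequentially. (\<integral>\<^sup>+x. ennreal ((norm (Y n x))\<^sup>2) \<partial>N)
      \<le> ennreal (C\<^sup>2) * (\<integral>\<^sup>+x. ennreal ((norm (X n x))\<^sup>2) \<partial>N)"
    by simp
  show "(\<lambda>n. ennreal (C\<^sup>2) * (\<integral>\<^sup>+x. ennreal ((norm (X n x))\<^sup>2) \<partial>N)) \<longlonglongrightarrow> 0"
    using ennreal_tendsto_cmult[OF _ lim, of "ennreal (C\<^sup>2)"] by simp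
qed simp

lemma inner_vec_sum: "x \<bullet> y = (\<Sum>i\<in>UNIV. x $ i * y $ i)" for x y :: "real ^ 'm"
  by (simp add: inner_vec_def)

lemma half_open_interval_measure:
  "measure lborel ({a<..b} \<inter> {a'<..b'}) = (if max a a' \<le> min b b' then min b b' - max a a' else 0)"
  for a b a' b' :: real
proof -
  have eq: "{a<..b} \<inter> {a'<..b'} = {max a a'<..min b b'}" by auto
  show ?thesis
  proof (cases "max a a' \<le> min b b'")
    case True
    then show ?thesis unfolding eq by (simp only: measure_lborel_Ioc if_True)
  next
    case False
    then have "{max a a'<..min b b'} = {}"
      by (simp only: greaterThanAtMost_empty_iff not_less not_le less_imp_le)
    then show ?thesis unfolding eq using False by (simp only: measure_empty if_False)
  qed
qed

lemma integrable_of_sq_integrable: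
  assumes N: "finite_measure N" and f: "sq_integrable N f"
  shows "integrable N f"
proof (rule Bochner_Integration.integrable_bound[OF _ sq_integrableD(1)[OF f]])
  interpret finite_measure N by (rule N)
  show "integrable N (\<lambda>x. 1 + (norm (f x))\<^sup>2)" using sq_integrableD(2)[OF f] by simp
  have "norm (f x) \<le> 1 + (norm (f x))\<^sup>2" for x
  proof -
    have "2 * norm (f x) \<le> 1 + (norm (f x))\<^sup>2" using sum_squares_bound[of 1 "norm (f x)"] by simp
    moreover have "0 \<le> norm (f x)" by simp
    ultimately show ?thesis by linarith
  qed
  then show "AE x in N. norm (f x) \<le> norm (1 + (norm (f x))\<^sup>2)" by simp
qed

lemma borel_measurable_component:
  fixes f :: "'x \<Rightarrow> real ^ 'm"
  assumes [measurable]: "f \<in> borel_measurable N"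
  shows "(\<lambda>x. f x $ i) \<in> borel_measurable N"
  unfolding cart_eq_inner_axis by measurable

lemma sq_integrable_bounded:
  assumes N: "finite_measure N" and [measurable]: "f \<in> borel_measurable N"
    and C: "\<And>x. x \<in> space N \<Longrightarrow> norm (f x) \<le> C"
  shows "sq_integrable N f"
proof -
  interpret finite_measure N by (rule N)
  have "integrable N (\<lambda>x. (norm (f x))\<^sup>2)"
    by (rule integrable_const_bound[of _ "C\<^sup>2"]) (use C in \<open>auto intro!: AE_I2 power_mono\<close>)
  then show ?thesis by (simp add: sq_integrable_def)
qed

lemma sq_integrable_sum:
  "finite J \<Longrightarrow> (\<And>j. j \<in> J \<Longrightarrow> sq_integrable N (f j)) \<Longrightarrow> sq_integrable N (\<lambda>x. \<Sum>j\<in>J. f j x)"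
proof (induction J rule: finite_induct)
  case empty
  then show ?case by (simp add: sq_integrable_def)
next
  case (insert j J)
  then show ?case using sq_integrable_add[of N "f j" "\<lambda>x. \<Sum>j\<in>J. f j x"] by simp
qed

lemma integral_double_sum:
  fixes f :: "nat \<Rightarrow> nat \<Rightarrow> 'x \<Rightarrow> real"
  assumes f: "\<And>i j. i < k \<Longrightarrow> j < k' \<Longrightarrow> integrable N (f i j)"
  shows "(\<integral>x. (\<Sum>i<k. \<Sum>j<k'. f i j x) \<partial>N) = (\<Sum>i<k. \<Sum>j<k'. \<integral>x. f i j x \<partial>N)"
proof -
  have "(\<integral>x. (\<Sum>i<k. \<Sum>j<k'. f i j x) \<partial>N) = (\<Sum>i<k. \<integral>x. (\<Sum>j<k'. f i j x) \<partial>N)"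
    by (rule Bochner_Integration.integral_sum, rule Bochner_Integration.integrable_sum, rule f) auto
  also have "\<dots> = (\<Sum>i<k. \<Sum>j<k'. \<integral>x. f i j x \<partial>N)"
    by (rule sum.cong[OF refl], rule Bochner_Integration.integral_sum, rule f) auto
  finally show ?thesis .
qed

lemma sq_integrable_inner:
  assumes "sq_integrable N f"
  shows "sq_integrable N (\<lambda>x. p \<bullet> f x)"
  by (rule sq_integrable_bound[OF assms, of _ "norm p"])
     (use sq_integrableD(1)[OF assms] in \<open>auto simp: Cauchy_Schwarz_ineq2\<close>)

lemma
  fixes f :: "'x \<Rightarrow> real" and g :: "'y \<Rightarrow> real"
  assumes A: "sigma_finite_measure A" and B: "sigma_finite_measure B"
    and f: "integrable A f" and g: "integrable B g"
  shows integrable_pair_product: "integrable (A \<Otimes>\<^sub>M B) (\<lambda>z. f (fst z) * g (snd z))"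
    and integral_pair_product:
      "(\<integral>z. f (fst z) * g (snd z) \<partial>(A \<Otimes>\<^sub>M B)) = (\<integral>x. f x \<partial>A) * (\<integral>y. g y \<partial>B)"
proof -
  interpret A: sigma_finite_measure A by (rule A)
  interpret B: sigma_finite_measure B by (rule B)
  interpret pair_sigma_finite A B ..
  have [measurable]: "f \<in> borel_measurable A" "g \<in> borel_measurable B" using f g by auto
  have "integrable (A \<Otimes>\<^sub>M B) (\<lambda>(x, y). f x * g y)"
  proof (rule Fubini_integrable)
    show "integrable A (\<lambda>x. \<integral>y. norm (case (x, y) of (x, y) \<Rightarrow> f x * g y) \<partial>B)"
      using f g by (simp add: abs_mult)
    show "AE x in A. integrable B (\<lambda>y. case (x, y) of (x, y) \<Rightarrow> f x * g y)"
      using g by simp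
  qed measurable
  then show i: "integrable (A \<Otimes>\<^sub>M B) (\<lambda>z. f (fst z) * g (snd z))"
    by (simp add: case_prod_unfold)
  show "(\<integral>z. f (fst z) * g (snd z) \<partial>(A \<Otimes>\<^sub>M B)) = (\<integral>x. f x \<partial>A) * (\<integral>y. g y \<partial>B)"
    using integral_fst'[OF i] by simp
qed

lemma (in prob_space) expectation_norm_sq_le:
  fixes X :: "'a \<Rightarrow> real ^ 'n"
  assumes X: "sq_integrable M X" and c: "\<And>p. norm p = 1 \<Longrightarrow> (\<integral>\<omega>. (p \<bullet> X \<omega>)\<^sup>2 \<partial>M) \<le> c"
  shows "(\<integral>\<omega>. (norm (X \<omega>))\<^sup>2 \<partial>M) \<le> real CARD('n) * c"
proof -
  have i: "integrable M (\<lambda>\<omega>. (axis i 1 \<bullet> X \<omega>)\<^sup>2)" for i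
    using sq_integrableD(2)[OF sq_integrable_inner[OF X, of "axis i 1"]] by simp
  have "(norm (X \<omega>))\<^sup>2 = (\<Sum>i\<in>UNIV. (axis i 1 \<bullet> X \<omega>)\<^sup>2)" for \<omega>
    unfolding power2_norm_eq_inner inner_vec_sum[of "X \<omega>" "X \<omega>"]
    by (intro sum.cong refl) (simp add: inner_axis' power2_eq_square)
  then have "(\<integral>\<omega>. (norm (X \<omega>))\<^sup>2 \<partial>M) = (\<Sum>i\<in>UNIV. \<integral>\<omega>. (axis i 1 \<bullet> X \<omega>)\<^sup>2 \<partial>M)"
    by (simp only: Bochner_Integration.integral_sum[OF i])
  also have "\<dots> \<le> (\<Sum>i\<in>(UNIV :: 'n set). c)" by (intro sum_mono c) simp
  finally show ?thesis by simp
qed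

lemma (in prob_space) variance_perturbation:
  fixes X Y :: "'a \<Rightarrow> real"
  assumes X: "sq_integrable M X" and Y: "sq_integrable M Y" and mean: "expectation X = 0"
  shows "\<bar>variance (\<lambda>\<omega>. X \<omega> + Y \<omega>) - expectation (\<lambda>\<omega>. (X \<omega>)\<^sup>2)\<bar>
    \<le> 2 * (sqrt (expectation (\<lambda>\<omega>. (X \<omega>)\<^sup>2)) * sqrt (expectation (\<lambda>\<omega>. (Y \<omega>)\<^sup>2))) + 2 * expectation (\<lambda>\<omega>. (Y \<omega>)\<^sup>2)"
proof -
  note XY = sq_integrable_add[OF X Y]
  have i: "integrable M X" "integrable M Y" "integrable M (\<lambda>\<omega>. X \<omega> + Y \<omega>)"
    using integrable_of_sq_integrable[OF finite_measure_axioms] X Y XY by auto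
  have i2: "integrable M (\<lambda>\<omega>. (X \<omega>)\<^sup>2)" "integrable M (\<lambda>\<omega>. (Y \<omega>)\<^sup>2)" "integrable M (\<lambda>\<omega>. (X \<omega> + Y \<omega>)\<^sup>2)"
    using sq_integrableD(2)[OF X] sq_integrableD(2)[OF Y] sq_integrableD(2)[OF XY] by auto
  have ixy: "integrable M (\<lambda>\<omega>. X \<omega> * Y \<omega>)" using integrable_inner_of_sq_integrable[OF X Y] by simp
  let ?c = "expectation (\<lambda>\<omega>. X \<omega> * Y \<omega>)" and ?e = "expectation Y" and ?y = "expectation (\<lambda>\<omega>. (Y \<omega>)\<^sup>2)"
  have m: "expectation (\<lambda>\<omega>. X \<omega> + Y \<omega>) = ?e" using i mean by simp
  have "variance (\<lambda>\<omega>. X \<omega> + Y \<omega>) = expectation (\<lambda>\<omega>. (X \<omega> + Y \<omega>)\<^sup>2) - ?e\<^sup>2"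
    using variance_eq[OF i(3) i2(3)] by (simp only: m)
  also have "expectation (\<lambda>\<omega>. (X \<omega> + Y \<omega>)\<^sup>2) = expectation (\<lambda>\<omega>. (X \<omega>)\<^sup>2 + 2 * (X \<omega> * Y \<omega>) + (Y \<omega>)\<^sup>2)"
    by (simp add: power2_sum mult.assoc add_ac)
  also have "\<dots> = expectation (\<lambda>\<omega>. (X \<omega>)\<^sup>2) + 2 * ?c + ?y" using i2 ixy by simp
  finally have eq: "variance (\<lambda>\<omega>. X \<omega> + Y \<omega>) - expectation (\<lambda>\<omega>. (X \<omega>)\<^sup>2) = 2 * ?c + (?y - ?e\<^sup>2)" by simp
  have "0 \<le> variance Y" by simp
  then have v: "?e\<^sup>2 \<le> ?y" unfolding variance_eq[OF i(2) i2(2)] by simp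
  have c: "\<bar>?c\<bar> \<le> sqrt (expectation (\<lambda>\<omega>. (X \<omega>)\<^sup>2)) * sqrt ?y"
    using L2_Cauchy_Schwarz[OF X Y] by simp
  have "0 \<le> ?y" "0 \<le> ?e\<^sup>2" by simp_all
  then show ?thesis unfolding eq using v c by linarith
qed

section \<open>Moments of Gaussian increments\<close>

lemma
  fixes f :: "'m::finite \<Rightarrow> real \<Rightarrow> real"
  assumes f: "\<And>i. integrable lborel (f i)"
  shows integrable_lborel_vec_prod: "integrable lborel (\<lambda>x :: real ^ 'm. \<Prod>i\<in>UNIV. f i (x $ i))"
    and integral_lborel_vec_prod:
      "(\<integral>x. (\<Prod>i\<in>UNIV. f i ((x :: real ^ 'm) $ i)) \<partial>lborel) = (\<Prod>i\<in>UNIV. \<integral>x. f i x \<partial>lborel)"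
proof -
  interpret product_sigma_finite "\<lambda>_ :: real ^ 'm. lborel :: real measure" ..
  let ?F = "\<lambda>b :: real ^ 'm. f (axis_index b)"
  let ?c = "\<lambda>g. \<Sum>b\<in>(Basis :: (real ^ 'm) set). g b *\<^sub>R b"
  have [measurable]: "f i \<in> borel_measurable borel" for i
    using borel_measurable_integrable[OF f[of i]] by simp
  have Basis: "(Basis :: (real ^ 'm) set) = range (\<lambda>i. axis i 1)"
    by (auto simp: Basis_vec_def)
  have inj: "inj (\<lambda>i. axis i 1 :: real ^ 'm)"
    by (auto simp: inj_on_def axis_eq_axis)
  have eq: "(\<Prod>i\<in>UNIV. f i (x $ i)) = (\<Prod>b\<in>Basis. ?F b (x \<bullet> b))" for x :: "real ^ 'm"
    unfolding Basis by (subst prod.reindex[OF inj]) (simp add: axis_index_axis inner_axis)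
  have eq': "(\<Prod>b\<in>Basis. ?F b (?c g \<bullet> b)) = (\<Prod>b\<in>Basis. ?F b (g b))" for g
    by (intro prod.cong refl) (simp add: inner_sum_left_Basis)
  have [measurable]: "(\<lambda>x :: real ^ 'm. \<Prod>b\<in>Basis. ?F b (x \<bullet> b)) \<in> borel_measurable borel"
    by measurable
  have [measurable]: "?c \<in> (\<Pi>\<^sub>M b\<in>(Basis :: (real ^ 'm) set). lborel) \<rightarrow>\<^sub>M borel"
    by measurable
  have pi: "integrable (\<Pi>\<^sub>M b\<in>(Basis :: (real ^ 'm) set). lborel) (\<lambda>x. \<Prod>b\<in>Basis. ?F b (x b))"
    "(\<integral>x. (\<Prod>b\<in>Basis. ?F b (x b)) \<partial>(\<Pi>\<^sub>M b\<in>(Basis :: (real ^ 'm) set). lborel))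
      = (\<Prod>b\<in>Basis. \<integral>x. ?F b x \<partial>lborel)"
    by (rule product_integrable_prod[of Basis ?F] product_integral_prod[of Basis ?F];
        simp add: f)+
  show "integrable lborel (\<lambda>x :: real ^ 'm. \<Prod>i\<in>UNIV. f i (x $ i))"
    unfolding eq
    by (subst lborel_eq, subst integrable_distr_eq) (simp_all add: eq' pi)
  have "(\<integral>x. (\<Prod>i\<in>UNIV. f i ((x :: real ^ 'm) $ i)) \<partial>lborel) = (\<Prod>b\<in>(Basis :: (real ^ 'm) set). \<integral>x. ?F b x \<partial>lborel)"
    unfolding eq by (subst lborel_eq, subst integral_distr) (simp_all add: eq' pi)
  also have "\<dots> = (\<Prod>i\<in>UNIV. \<integral>x. f i x \<partial>lborel)"
    unfolding Basis by (subst prod.reindex[OF inj]) (simp add: axis_index_axis)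
  finally show "(\<integral>x. (\<Prod>i\<in>UNIV. f i ((x :: real ^ 'm) $ i)) \<partial>lborel) = \<dots>" .
qed

text \<open>Each moment factorises over the coordinates; a factor with an odd power makes it vanish.\<close>

lemma
  fixes v :: real and i k :: "'m::finite"
  assumes v: "0 < v"
  defines "D \<equiv> \<lambda>x :: real ^ 'm. \<Prod>l\<in>UNIV. normal_density 0 v (x $ l)"
  shows gaussian_vec_moment1: "has_bochner_integral lborel (\<lambda>x. D x * x $ i) 0"
    and gaussian_vec_moment2:
      "has_bochner_integral lborel (\<lambda>x. D x * (x $ i * x $ k)) (if i = k then v\<^sup>2 else 0)"
proof -
  let ?n = "normal_density 0 v"
  have n0: "has_bochner_integral lborel ?n 1"
    using v by (simp add: has_bochner_integral_iff integrable_normal_density)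
  have n1: "has_bochner_integral lborel (\<lambda>x. ?n x * x) 0"
    using normal_moment_nz_1[of v 0] v by simp
  have n2: "has_bochner_integral lborel (\<lambda>x. ?n x * x * x) (v\<^sup>2)"
    using normal_moment_even[of v 0 1] v by (simp add: power2_eq_square mult.assoc fact_numeral)
  have *: "has_bochner_integral lborel (\<lambda>x :: real ^ 'm. \<Prod>l\<in>UNIV. f l (x $ l)) (\<Prod>l\<in>UNIV. c l)"
    if "\<And>l. has_bochner_integral lborel (f l) (c l)" for f :: "'m \<Rightarrow> real \<Rightarrow> real" and c
    using that integrable_lborel_vec_prod[of f] integral_lborel_vec_prod[of f]
    by (simp add: has_bochner_integral_iff)
  have "D x * x $ i = (\<Prod>l\<in>UNIV. if l = i then ?n (x $ l) * x $ l else ?n (x $ l))" for x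
    unfolding D_def by (subst (1 2) prod.remove[of _ i]) (auto intro!: prod.cong)
  moreover have "has_bochner_integral lborel
      (\<lambda>x :: real ^ 'm. \<Prod>l\<in>UNIV. if l = i then ?n (x $ l) * x $ l else ?n (x $ l))
      (\<Prod>l\<in>UNIV. if l = i then 0 else 1)"
    by (rule *[where f = "\<lambda>l x. if l = i then ?n x * x else ?n x" and c = "\<lambda>l. if l = i then 0 else 1"])
       (use n0 n1 in auto)
  moreover have "(\<Prod>l\<in>UNIV. if l = i then 0 else 1 :: real) = 0"
    by (subst prod.remove[of _ i]) auto
  ultimately show "has_bochner_integral lborel (\<lambda>x. D x * x $ i) 0" by simp
  show "has_bochner_integral lborel (\<lambda>x. D x * (x $ i * x $ k)) (if i = k then v\<^sup>2 else 0)"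
  proof (cases "i = k")
    case True
    have "D x * (x $ i * x $ i) = (\<Prod>l\<in>UNIV. if l = i then ?n (x $ l) * x $ l * x $ l else ?n (x $ l))" for x
      unfolding D_def by (subst (1 2) prod.remove[of _ i]) (auto intro!: prod.cong)
    moreover have "has_bochner_integral lborel
        (\<lambda>x :: real ^ 'm. \<Prod>l\<in>UNIV. if l = i then ?n (x $ l) * x $ l * x $ l else ?n (x $ l))
        (\<Prod>l\<in>UNIV. if l = i then v\<^sup>2 else 1)"
      by (rule *[where f = "\<lambda>l x. if l = i then ?n x * x * x else ?n x" and c = "\<lambda>l. if l = i then v\<^sup>2 else 1"])
         (use n0 n2 in auto)
    moreover have "(\<Prod>l\<in>UNIV. if l = i then v\<^sup>2 else 1) = v\<^sup>2"
      by (subst prod.remove[of _ i]) auto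
    ultimately show ?thesis using True by simp
  next
    case False
    have "D x * (x $ i * x $ k) =
        (\<Prod>l\<in>UNIV. if l = i \<or> l = k then ?n (x $ l) * x $ l else ?n (x $ l))" for x
    proof -
      have "(\<Prod>l\<in>UNIV. if l = i \<or> l = k then x $ l else 1) = x $ i * x $ k"
        using False by (subst prod.remove[of _ i], simp, simp, subst prod.remove[of _ k]) auto
      moreover have "(\<Prod>l\<in>UNIV. if l = i \<or> l = k then ?n (x $ l) * x $ l else ?n (x $ l))
          = D x * (\<Prod>l\<in>UNIV. if l = i \<or> l = k then x $ l else 1)"
        unfolding D_def prod.distrib[symmetric] by (intro prod.cong) auto
      ultimately show ?thesis by simp
    qed
    moreover have "has_bochner_integral lborel
        (\<lambda>x :: real ^ 'm. \<Prod>l\<in>UNIV. if l = i \<or> l = k then ?n (x $ l) * x $ l else ?n (x $ l))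
        (\<Prod>l\<in>UNIV. if l = i \<or> l = k then 0 else 1)"
      by (rule *[where f = "\<lambda>l x. if l = i \<or> l = k then ?n x * x else ?n x"
            and c = "\<lambda>l. if l = i \<or> l = k then 0 else 1"])
         (use n0 n1 in auto)
    moreover have "(\<Prod>l\<in>UNIV. if l = i \<or> l = k then 0 else 1 :: real) = 0"
      by (subst prod.remove[of _ i]) auto
    ultimately show ?thesis using False by simp
  qed
qed

section \<open>The Ito isometry\<close>

locale wiener =
  fixes M :: "'a measure" and T :: real and W :: "real \<Rightarrow> 'a \<Rightarrow> real ^ 'm"
  assumes wiener_process: "wiener_process M T W"

sublocale wiener \<subseteq> prob_space M
  using wiener_process by (simp add: wiener_process_def)

context wiener
begin

abbreviation past :: "real \<Rightarrow> 'a measure" where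
  "past \<equiv> augmented_filtration M W"

abbreviation incr :: "real \<Rightarrow> real \<Rightarrow> 'a \<Rightarrow> real ^ 'm" where
  "incr a b \<omega> \<equiv> W b \<omega> - W a \<omega>"

lemma W_measurable: "s \<in> {0..T} \<Longrightarrow> W s \<in> borel_measurable M"
  using wiener_process by (simp add: wiener_process_def)

lemma space_past [simp]: "space (past s) = space M"
  unfolding augmented_filtration_def by (rule space_measure_of_conv)

lemma space_natural [simp]: "space (natural_filtration M W s) = space M"
  unfolding natural_filtration_def by (rule space_measure_of_conv)

lemma sets_natural:
  "sets (natural_filtration M W s) =
     sigma_sets (space M) {W r -` B \<inter> space M | r B. r \<in> {0..s} \<and> B \<in> sets borel}"
  unfolding natural_filtration_def by (rule sets_measure_of) auto

lemma sets_past: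
  "sets (past s) = sigma_sets (space M) (sets (natural_filtration M W s) \<union> null_sets M)"
  unfolding augmented_filtration_def
proof (rule sets_measure_of)
  show "sets (natural_filtration M W s) \<union> null_sets M \<subseteq> Pow (space M)"
    using sets.space_closed[of "natural_filtration M W s"] sets.sets_into_space[of _ M] by auto
qed

lemma sets_natural_subset: "s \<le> T \<Longrightarrow> sets (natural_filtration M W s) \<subseteq> sets M"
  unfolding sets_natural
  by (rule sets.sigma_sets_subset) (auto intro!: measurable_sets[OF W_measurable])

lemma sets_past_subset: "s \<le> T \<Longrightarrow> sets (past s) \<subseteq> sets M"
  unfolding sets_past using sets_natural_subset by (intro sets.sigma_sets_subset) auto

lemma sets_past_mono: "a \<le> b \<Longrightarrow> sets (past a) \<subseteq> sets (past b)"
  unfolding sets_past sets_natural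
  by (intro sigma_sets_mono' Un_mono subset_refl) fastforce

lemma measurable_past_mono:
  assumes "f \<in> measurable (past a) N" "a \<le> b"
  shows "f \<in> measurable (past b) N"
  using assms sets_past_mono[OF assms(2)] unfolding measurable_def by auto

lemma measurable_of_past:
  assumes "f \<in> measurable (past a) N" "a \<le> T"
  shows "f \<in> measurable M N"
  using assms sets_past_subset[OF assms(2)] unfolding measurable_def by auto

lemma W_adapted:
  assumes "r \<in> {0..s}"
  shows "W r \<in> borel_measurable (past s)"
proof (rule measurableI)
  fix B :: "(real ^ 'm) set" assume "B \<in> sets borel"
  then have "W r -` B \<inter> space M \<in> sets (natural_filtration M W s)"
    unfolding sets_natural using assms by (intro sigma_sets.Basic) auto
  then show "W r -` B \<inter> space (past s) \<in> sets (past s)"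
    unfolding sets_past space_past by (intro sigma_sets.Basic) auto
qed auto

text \<open>The natural filtration together with the null sets is closed under intersection, so
  independence passes from this generator to the augmented filtration.\<close>

lemma indep_past_increment:
  assumes s: "0 \<le> s" "s < r" "r \<le> T"
  shows "indep_set (sets (past s)) (sets (vimage_algebra (space M) (incr s r) borel))"
proof -
  let ?N = "sets (natural_filtration M W s)"
  let ?V = "sets (vimage_algebra (space M) (incr s r) borel)"
  have ind: "indep_set ?N ?V"
    using wiener_process s unfolding wiener_process_def by blast
  have V: "?V \<subseteq> events" by (rule indep_setD_ev2[OF ind])
  have "indep_set (?N \<union> null_sets M) ?V"
    unfolding indep_sets2_eq
  proof (intro conjI ballI)
    show "?N \<union> null_sets M \<subseteq> events" using indep_setD_ev1[OF ind] by auto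
    fix a b assume a: "a \<in> ?N \<union> null_sets M" and b: "b \<in> ?V"
    show "prob (a \<inter> b) = prob a * prob b"
    proof (cases "a \<in> ?N")
      case True
      then show ?thesis using indep_setD[OF ind] b by blast
    next
      case False
      then have "a \<in> null_sets M" using a by auto
      moreover have "a \<inter> b \<in> null_sets M"
        using \<open>a \<in> null_sets M\<close> b V by (intro null_set_Int2[OF \<open>a \<in> null_sets M\<close>]) auto
      ultimately show ?thesis by (auto simp: null_sets_def measure_def)
    qed
  qed (rule V)
  moreover have "Int_stable (?N \<union> null_sets M)"
  proof (rule Int_stableI)
    fix a b assume a: "a \<in> ?N \<union> null_sets M" and b: "b \<in> ?N \<union> null_sets M"
    have ev: "a \<in> events" "b \<in> events" using a b indep_setD_ev1[OF ind] by auto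
    show "a \<inter> b \<in> ?N \<union> null_sets M"
      using a b null_set_Int2[of a M b] null_set_Int2[of b M a] ev by (auto simp: Int_commute)
  qed
  moreover have "Int_stable ?V" by (rule sets.Int_stable)
  ultimately have "indep_set (sigma_sets (space M) (?N \<union> null_sets M)) (sigma_sets (space M) ?V)"
    by (rule indep_set_sigma_sets)
  moreover have "sigma_sets (space M) ?V = ?V"
    using sets.sigma_sets_eq[of "vimage_algebra (space M) (incr s r) borel"] by simp
  ultimately show ?thesis unfolding sets_past by simp
qed

lemma
  fixes Y :: "'a \<Rightarrow> real" and g :: "real ^ 'm \<Rightarrow> real"
  assumes s: "0 \<le> s" "s < r" "r \<le> T"
    and Y: "Y \<in> borel_measurable (past s)" "integrable M Y"
    and g: "g \<in> borel_measurable borel" "integrable M (\<lambda>\<omega>. g (incr s r \<omega>))"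
  shows expectation_past_times_increment:
    "(\<integral>\<omega>. Y \<omega> * g (incr s r \<omega>) \<partial>M) = (\<integral>\<omega>. Y \<omega> \<partial>M) * (\<integral>\<omega>. g (incr s r \<omega>) \<partial>M)"
    and integrable_past_times_increment: "integrable M (\<lambda>\<omega>. Y \<omega> * g (incr s r \<omega>))"
proof -
  have [measurable]: "W s \<in> borel_measurable M" "W r \<in> borel_measurable M"
    using s by (auto intro!: W_measurable)
  have YM: "Y \<in> borel_measurable M" using measurable_of_past[OF Y(1)] s by simp
  have gM: "(\<lambda>\<omega>. g (incr s r \<omega>)) \<in> borel_measurable M" using g(1) by measurable
  let ?V = "vimage_algebra (space M) (incr s r) borel"
  have gV: "(\<lambda>\<omega>. g (incr s r \<omega>)) \<in> borel_measurable ?V"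
    by (rule measurable_compose[OF measurable_vimage_algebra1 g(1)]) auto
  have "indep_var borel Y borel (\<lambda>\<omega>. g (incr s r \<omega>))"
    unfolding indep_var_eq
  proof (intro conjI YM gM)
    have "sigma_sets (space M) {Y -` A \<inter> space M |A. A \<in> sets borel} \<subseteq> sets (past s)"
      using sets.sigma_sets_subset[of "{Y -` A \<inter> space M |A. A \<in> sets borel}" "past s"]
        measurable_sets[OF Y(1)] by auto
    moreover have "sigma_sets (space M) {(\<lambda>\<omega>. g (incr s r \<omega>)) -` A \<inter> space M |A. A \<in> sets borel} \<subseteq> sets ?V"
      using sets.sigma_sets_subset[of "{(\<lambda>\<omega>. g (incr s r \<omega>)) -` A \<inter> space M |A. A \<in> sets borel}" ?V]
        measurable_sets[OF gV] by auto
    ultimately show "indep_set (sigma_sets (space M) {Y -` A \<inter> space M |A. A \<in> sets borel})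
        (sigma_sets (space M) {(\<lambda>\<omega>. g (incr s r \<omega>)) -` A \<inter> space M |A. A \<in> sets borel})"
      using indep_past_increment[OF s] unfolding indep_sets2_eq by blast
  qed
  then show "(\<integral>\<omega>. Y \<omega> * g (incr s r \<omega>) \<partial>M) = (\<integral>\<omega>. Y \<omega> \<partial>M) * (\<integral>\<omega>. g (incr s r \<omega>) \<partial>M)"
    and "integrable M (\<lambda>\<omega>. Y \<omega> * g (incr s r \<omega>))"
    using Y(2) g(2) by (auto intro: indep_var_lebesgue_integral indep_var_integrable)
qed

lemma
  assumes s: "0 \<le> s" "s < r" "r \<le> T"
  shows incr_moment1: "has_bochner_integral M (\<lambda>\<omega>. incr s r \<omega> $ i) 0"
    and incr_moment2:
      "has_bochner_integral M (\<lambda>\<omega>. incr s r \<omega> $ i * incr s r \<omega> $ k) (if i = k then r - s else 0)"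
proof -
  let ?D = "\<lambda>x :: real ^ 'm. \<Prod>l\<in>UNIV. normal_density 0 (sqrt (r - s)) (x $ l)"
  have D: "distributed M lborel (incr s r) (\<lambda>x. ennreal (?D x))"
    using wiener_process s unfolding wiener_process_def by blast
  have D0: "0 \<le> ?D x" for x by (intro prod_nonneg) simp
  have *: "has_bochner_integral M (\<lambda>\<omega>. g (incr s r \<omega>)) c"
    if "has_bochner_integral lborel (\<lambda>x. ?D x * g x) c" "g \<in> borel_measurable lborel" for g c
    using that distributed_integral[OF D that(2) D0] distributed_integrable[OF D that(2) D0]
    by (simp add: has_bochner_integral_iff)
  show "has_bochner_integral M (\<lambda>\<omega>. incr s r \<omega> $ i) 0"
    by (rule *[OF gaussian_vec_moment1[of "sqrt (r - s)" i]]) (use s in auto)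
  have "has_bochner_integral M (\<lambda>\<omega>. incr s r \<omega> $ i * incr s r \<omega> $ k) (if i = k then (sqrt (r - s))\<^sup>2 else 0)"
    by (rule *[OF gaussian_vec_moment2[of "sqrt (r - s)" i k]]) (use s in auto)
  then show "has_bochner_integral M (\<lambda>\<omega>. incr s r \<omega> $ i * incr s r \<omega> $ k) (if i = k then r - s else 0)"
    using s by (subst (asm) real_sqrt_pow2) auto
qed

text \<open>What is known of a linear combination of the rows of a coefficient of an elementary process, on an
  interval that starts at \<open>a\<close>.\<close>

definition bounded_at :: "real \<Rightarrow> ('a \<Rightarrow> real ^ 'm) \<Rightarrow> bool" where
  "bounded_at a \<alpha> \<longleftrightarrow> \<alpha> \<in> borel_measurable (past a) \<and> (\<exists>C. \<forall>\<omega>\<in>space M. norm (\<alpha> \<omega>) \<le> C)"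

lemma bounded_at_mono: "bounded_at a \<alpha> \<Longrightarrow> a \<le> b \<Longrightarrow> bounded_at b \<alpha>"
  unfolding bounded_at_def using measurable_past_mono by blast

lemma bounded_at_measurable: "bounded_at a \<alpha> \<Longrightarrow> a \<le> T \<Longrightarrow> \<alpha> \<in> borel_measurable M"
  unfolding bounded_at_def using measurable_of_past by blast

lemma sq_integrable_bounded_at:
  assumes "bounded_at a \<alpha>" "a \<le> T"
  shows "sq_integrable M \<alpha>"
proof -
  obtain C where C: "\<And>\<omega>. \<omega> \<in> space M \<Longrightarrow> norm (\<alpha> \<omega>) \<le> C"
    using assms(1) unfolding bounded_at_def by blast
  have [measurable]: "\<alpha> \<in> borel_measurable M" using assms by (rule bounded_at_measurable)
  have "integrable M (\<lambda>\<omega>. (norm (\<alpha> \<omega>))\<^sup>2)"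
    by (rule integrable_const_bound[of _ "C\<^sup>2"]) (use C in \<open>auto intro!: AE_I2 power_mono\<close>)
  then show ?thesis by (simp add: sq_integrable_def)
qed

lemma sq_integrable_incr:
  assumes "0 \<le> a" "a \<le> b" "b \<le> T"
  shows "sq_integrable M (incr a b)"
proof (cases "a = b")
  case True
  then show ?thesis by (simp add: sq_integrable_def)
next
  case False
  then have "a < b" using assms by simp
  then have "integrable M (\<lambda>\<omega>. \<Sum>i\<in>UNIV. incr a b \<omega> $ i * incr a b \<omega> $ i)"
    using incr_moment2[OF assms(1) _ assms(3)]
    by (intro Bochner_Integration.integrable_sum) (auto simp: has_bochner_integral_iff)
  moreover have "(norm (incr a b \<omega>))\<^sup>2 = (\<Sum>i\<in>UNIV. incr a b \<omega> $ i * incr a b \<omega> $ i)" for \<omega>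
    by (simp add: power2_norm_eq_inner inner_vec_sum)
  ultimately show ?thesis
    using assms by (auto simp: sq_integrable_def intro!: borel_measurable_diff W_measurable)
qed

lemma integrable_incr:
  assumes "0 \<le> a" "a < b" "b \<le> T"
  shows "integrable M (\<lambda>\<omega>. incr a b \<omega> $ i)"
  using incr_moment1[OF assms] by (simp add: has_bochner_integral_iff)

lemma sq_integrable_bounded_at_incr:
  assumes \<alpha>: "bounded_at a \<alpha>" and ab: "0 \<le> a" "a \<le> b" "b \<le> T"
  shows "sq_integrable M (\<lambda>\<omega>. \<alpha> \<omega> \<bullet> incr a b \<omega>)"
proof -
  obtain C where C: "\<And>\<omega>. \<omega> \<in> space M \<Longrightarrow> norm (\<alpha> \<omega>) \<le> C"
    using \<alpha> unfolding bounded_at_def by blast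
  have [measurable]: "\<alpha> \<in> borel_measurable M" "W a \<in> borel_measurable M" "W b \<in> borel_measurable M"
    using bounded_at_measurable[OF \<alpha>] ab by (auto intro: W_measurable)
  have "norm (\<alpha> \<omega> \<bullet> incr a b \<omega>) \<le> C * norm (incr a b \<omega>)" if "\<omega> \<in> space M" for \<omega>
    unfolding real_norm_def
    by (rule order_trans[OF Cauchy_Schwarz_ineq2 mult_right_mono[OF C[OF that]]]) simp
  then show ?thesis
    by (intro sq_integrable_bound[OF sq_integrable_incr[OF ab], of _ C] AE_I2) auto
qed

text \<open>Conditioning on the past at time \<open>a\<close> is replaced by the product rule for independent
  variables, applied to each component.\<close>

lemma expectation_past_increment_eq_0:
  assumes Y: "Y \<in> borel_measurable (past a)" "integrable M Y"
    and \<alpha>: "bounded_at a \<alpha>" and ab: "0 \<le> a" "a \<le> b" "b \<le> T"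
  shows "(\<integral>\<omega>. Y \<omega> * (\<alpha> \<omega> \<bullet> incr a b \<omega>) \<partial>M) = 0"
proof (cases "a = b")
  case False
  then have ab': "a < b" using ab by simp
  obtain C where C: "\<And>\<omega>. \<omega> \<in> space M \<Longrightarrow> norm (\<alpha> \<omega>) \<le> C"
    using \<alpha> unfolding bounded_at_def by blast
  have a: "a \<le> T" using ab by simp
  have Ya: "(\<lambda>\<omega>. Y \<omega> * \<alpha> \<omega> $ i) \<in> borel_measurable (past a)" for i
    using Y(1) \<alpha> unfolding bounded_at_def
    by (auto intro!: borel_measurable_times borel_measurable_component)
  have Yi: "integrable M (\<lambda>\<omega>. Y \<omega> * \<alpha> \<omega> $ i)" for i
  proof (rule Bochner_Integration.integrable_bound)
    show "integrable M (\<lambda>\<omega>. C * Y \<omega>)" using Y by simp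
    show "(\<lambda>\<omega>. Y \<omega> * \<alpha> \<omega> $ i) \<in> borel_measurable M" by (rule measurable_of_past[OF Ya a])
    show "AE \<omega> in M. norm (Y \<omega> * \<alpha> \<omega> $ i) \<le> norm (C * Y \<omega>)"
    proof (rule AE_I2)
      fix \<omega> assume "\<omega> \<in> space M"
      then have "\<bar>\<alpha> \<omega> $ i\<bar> \<le> \<bar>C\<bar>"
        using C[of \<omega>] component_le_norm_cart[of "\<alpha> \<omega>" i] by linarith
      then show "norm (Y \<omega> * \<alpha> \<omega> $ i) \<le> norm (C * Y \<omega>)"
        by (simp add: abs_mult mult.commute[of "\<bar>C\<bar>"] mult_left_mono)
    qed
  qed
  have "(\<integral>\<omega>. Y \<omega> * (\<alpha> \<omega> \<bullet> incr a b \<omega>) \<partial>M)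
      = (\<integral>\<omega>. (\<Sum>i\<in>UNIV. (Y \<omega> * \<alpha> \<omega> $ i) * incr a b \<omega> $ i) \<partial>M)"
    by (simp add: inner_vec_sum sum_distrib_left mult.assoc)
  also have "\<dots> = (\<Sum>i\<in>UNIV. \<integral>\<omega>. (Y \<omega> * \<alpha> \<omega> $ i) * incr a b \<omega> $ i \<partial>M)"
    using integrable_past_times_increment[OF ab(1) ab' ab(3) Ya Yi, of "\<lambda>x. x $ i" i for i]
      integrable_incr[OF ab(1) ab' ab(3)]
    by (intro Bochner_Integration.integral_sum) auto
  also have "\<dots> = (\<Sum>i\<in>UNIV. (\<integral>\<omega>. Y \<omega> * \<alpha> \<omega> $ i \<partial>M) * (\<integral>\<omega>. incr a b \<omega> $ i \<partial>M))"
    using expectation_past_times_increment[OF ab(1) ab' ab(3) Ya Yi, of "\<lambda>x. x $ i" i for i]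
      integrable_incr[OF ab(1) ab' ab(3)]
    by (intro sum.cong) auto
  also have "\<dots> = 0"
    using incr_moment1[OF ab(1) ab' ab(3)] by (simp add: has_bochner_integral_iff)
  finally show ?thesis .
qed simp

lemma expectation_increment_eq_0:
  assumes "bounded_at a \<alpha>" "0 \<le> a" "a \<le> b" "b \<le> T"
  shows "(\<integral>\<omega>. \<alpha> \<omega> \<bullet> incr a b \<omega> \<partial>M) = 0"
proof -
  have "(\<integral>\<omega>. 1 * (\<alpha> \<omega> \<bullet> incr a b \<omega>) \<partial>M) = 0"
    by (rule expectation_past_increment_eq_0[OF _ _ assms]) (rule borel_measurable_const, rule integrable_const)
  then show ?thesis by (simp only: mult_1)
qed

text \<open>The earlier increment is itself known at the start of the later one.\<close>

lemma isometry_disjoint: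
  assumes \<alpha>: "bounded_at a \<alpha>" "0 \<le> a" "a \<le> b" and \<alpha>': "bounded_at a' \<alpha>'" "a' \<le> b'" "b' \<le> T"
    and ba: "b \<le> a'"
  shows "(\<integral>\<omega>. (\<alpha> \<omega> \<bullet> incr a b \<omega>) * (\<alpha>' \<omega> \<bullet> incr a' b' \<omega>) \<partial>M) = 0"
proof (rule expectation_past_increment_eq_0)
  have "bounded_at a' \<alpha>" using bounded_at_mono[OF \<alpha>(1)] \<alpha> ba by simp
  then show "(\<lambda>\<omega>. \<alpha> \<omega> \<bullet> incr a b \<omega>) \<in> borel_measurable (past a')"
    using \<alpha> ba unfolding bounded_at_def
    by (intro borel_measurable_inner borel_measurable_diff W_adapted) auto
  have "sq_integrable M (\<lambda>\<omega>. \<alpha> \<omega> \<bullet> incr a b \<omega>)"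
    using assms by (intro sq_integrable_bounded_at_incr) auto
  then show "integrable M (\<lambda>\<omega>. \<alpha> \<omega> \<bullet> incr a b \<omega>)"
    by (rule integrable_of_sq_integrable[OF finite_measure_axioms])
qed (use assms in auto)

lemma isometry_same_interval:
  assumes \<alpha>: "bounded_at a \<alpha>" and \<alpha>': "bounded_at a \<alpha>'" and ab: "0 \<le> a" "a \<le> b" "b \<le> T"
  shows "(\<integral>\<omega>. (\<alpha> \<omega> \<bullet> incr a b \<omega>) * (\<alpha>' \<omega> \<bullet> incr a b \<omega>) \<partial>M) = (b - a) * (\<integral>\<omega>. \<alpha> \<omega> \<bullet> \<alpha>' \<omega> \<partial>M)"
proof (cases "a = b")
  case False
  then have ab': "a < b" using ab by simp
  have a: "a \<le> T" using ab by simp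
  note past = expectation_past_times_increment[OF ab(1) ab' ab(3)]
    integrable_past_times_increment[OF ab(1) ab' ab(3)]
  let ?Y = "\<lambda>i k \<omega>. \<alpha> \<omega> $ i * \<alpha>' \<omega> $ k" and ?g = "\<lambda>i k (x :: real ^ 'm). x $ i * x $ k"
  have Y: "?Y i k \<in> borel_measurable (past a)" for i k
    using \<alpha> \<alpha>' unfolding bounded_at_def
    by (auto intro!: borel_measurable_times borel_measurable_component)
  have Yi: "integrable M (?Y i k)" for i k
  proof -
    have comp: "sq_integrable M (\<lambda>\<omega>. \<beta> \<omega> $ i)" if "bounded_at a \<beta>" for \<beta> i
      by (rule sq_integrable_bound[OF sq_integrable_bounded_at[OF that a], of _ 1])
         (use bounded_at_measurable[OF that a] in
           \<open>auto simp: component_le_norm_cart borel_measurable_component\<close>)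
    show ?thesis
      using integrable_inner_of_sq_integrable[OF comp[OF \<alpha>] comp[OF \<alpha>'], of i k] by simp
  qed
  have g: "integrable M (\<lambda>\<omega>. ?g i k (incr a b \<omega>))"
    and g': "(\<integral>\<omega>. ?g i k (incr a b \<omega>) \<partial>M) = (if i = k then b - a else 0)" for i k
    using incr_moment2[OF ab(1) ab' ab(3), of i k] by (auto simp: has_bochner_integral_iff)
  have gm: "?g i k \<in> borel_measurable borel" for i k by measurable
  have "(\<integral>\<omega>. (\<alpha> \<omega> \<bullet> incr a b \<omega>) * (\<alpha>' \<omega> \<bullet> incr a b \<omega>) \<partial>M)
      = (\<integral>\<omega>. (\<Sum>i\<in>UNIV. \<Sum>k\<in>UNIV. ?Y i k \<omega> * ?g i k (incr a b \<omega>)) \<partial>M)"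
    by (simp add: inner_vec_sum sum_product algebra_simps)
  also have "\<dots> = (\<Sum>i\<in>UNIV. \<Sum>k\<in>UNIV. \<integral>\<omega>. ?Y i k \<omega> * ?g i k (incr a b \<omega>) \<partial>M)"
    using past(2)[OF Y Yi gm g]
    by (simp only: Bochner_Integration.integral_sum Bochner_Integration.integrable_sum)
  also have "\<dots> = (\<Sum>i\<in>UNIV. \<Sum>k\<in>UNIV. (\<integral>\<omega>. ?Y i k \<omega> \<partial>M) * (if i = k then b - a else 0))"
    by (intro sum.cong refl) (use past(1)[OF Y Yi gm g] g' in simp)
  also have "\<dots> = (b - a) * (\<Sum>i\<in>UNIV. \<integral>\<omega>. ?Y i i \<omega> \<partial>M)"
    unfolding sum_distrib_left by (intro sum.cong refl) (simp add: if_distrib cong: if_cong)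
  also have "(\<Sum>i\<in>UNIV. \<integral>\<omega>. ?Y i i \<omega> \<partial>M) = (\<integral>\<omega>. \<alpha> \<omega> \<bullet> \<alpha>' \<omega> \<partial>M)"
    unfolding inner_vec_sum using Yi by (intro Bochner_Integration.integral_sum[symmetric]) auto
  finally show ?thesis .
qed simp

text \<open>Intervals in general position are split until they are disjoint or equal.\<close>

lemma increment_isometry:
  assumes \<alpha>: "bounded_at a \<alpha>" "0 \<le> a" "a \<le> b" "b \<le> T"
    and \<alpha>': "bounded_at a' \<alpha>'" "0 \<le> a'" "a' \<le> b'" "b' \<le> T"
  shows "(\<integral>\<omega>. (\<alpha> \<omega> \<bullet> incr a b \<omega>) * (\<alpha>' \<omega> \<bullet> incr a' b' \<omega>) \<partial>M)
    = measure lborel ({a<..b} \<inter> {a'<..b'}) * (\<integral>\<omega>. \<alpha> \<omega> \<bullet> \<alpha>' \<omega> \<partial>M)"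
proof -
  have split: "(\<integral>\<omega>. (\<alpha> \<omega> \<bullet> incr a b \<omega>) * X \<omega> \<partial>M)
      = (\<integral>\<omega>. (\<alpha> \<omega> \<bullet> incr a c \<omega>) * X \<omega> \<partial>M) + (\<integral>\<omega>. (\<alpha> \<omega> \<bullet> incr c b \<omega>) * X \<omega> \<partial>M)"
    if \<alpha>: "bounded_at a \<alpha>" and ord: "0 \<le> a" "a \<le> c" "c \<le> b" "b \<le> T" and X: "sq_integrable M X"
    for \<alpha> X a b c
  proof -
    have "(\<alpha> \<omega> \<bullet> incr a b \<omega>) * X \<omega> = (\<alpha> \<omega> \<bullet> incr a c \<omega>) * X \<omega> + (\<alpha> \<omega> \<bullet> incr c b \<omega>) * X \<omega>" for \<omega>
      by (simp add: inner_diff_right algebra_simps)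
    moreover have "integrable M (\<lambda>\<omega>. (\<alpha> \<omega> \<bullet> incr a c \<omega>) * X \<omega>)"
      using integrable_inner_of_sq_integrable[OF sq_integrable_bounded_at_incr[OF \<alpha>, of c] X] ord by simp
    moreover have "integrable M (\<lambda>\<omega>. (\<alpha> \<omega> \<bullet> incr c b \<omega>) * X \<omega>)"
      using integrable_inner_of_sq_integrable[OF sq_integrable_bounded_at_incr[OF bounded_at_mono[OF \<alpha> ord(2)], of b] X] ord
      by simp
    ultimately show ?thesis by simp
  qed
  have start: "(\<integral>\<omega>. (\<alpha> \<omega> \<bullet> incr a b \<omega>) * (\<alpha>' \<omega> \<bullet> incr a b' \<omega>) \<partial>M) = (min b b' - a) * (\<integral>\<omega>. \<alpha> \<omega> \<bullet> \<alpha>' \<omega> \<partial>M)"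
    if \<alpha>: "bounded_at a \<alpha>" and \<alpha>': "bounded_at a \<alpha>'"
      and ord: "0 \<le> a" "a \<le> b" "b \<le> T" "a \<le> b'" "b' \<le> T" for \<alpha> \<alpha>' a b b'
  proof -
    have le: "(\<integral>\<omega>. (\<alpha> \<omega> \<bullet> incr a b \<omega>) * (\<alpha>' \<omega> \<bullet> incr a b' \<omega>) \<partial>M) = (b' - a) * (\<integral>\<omega>. \<alpha> \<omega> \<bullet> \<alpha>' \<omega> \<partial>M)"
      if \<alpha>: "bounded_at a \<alpha>" and \<alpha>': "bounded_at a \<alpha>'" and ord: "a \<le> b'" "b' \<le> b" "b \<le> T"
      for \<alpha> \<alpha>' b b'
    proof -
      have "(\<integral>\<omega>. (\<alpha> \<omega> \<bullet> incr b' b \<omega>) * (\<alpha>' \<omega> \<bullet> incr a b' \<omega>) \<partial>M) = 0"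
        using isometry_disjoint[OF \<alpha>' \<open>0 \<le> a\<close> ord(1) bounded_at_mono[OF \<alpha> ord(1)] ord(2,3)]
        by (simp add: mult.commute)
      moreover have "sq_integrable M (\<lambda>\<omega>. \<alpha>' \<omega> \<bullet> incr a b' \<omega>)"
        by (rule sq_integrable_bounded_at_incr[OF \<alpha>' \<open>0 \<le> a\<close>]) (use ord in auto)
      ultimately show ?thesis
        using split[OF \<alpha> \<open>0 \<le> a\<close> ord, of "\<lambda>\<omega>. \<alpha>' \<omega> \<bullet> incr a b' \<omega>"]
          isometry_same_interval[OF \<alpha> \<alpha>' \<open>0 \<le> a\<close> ord(1)] ord by simp
    qed
    show ?thesis
    proof (cases "b' \<le> b")
      case True
      then show ?thesis using le[OF \<alpha> \<alpha>', of b' b] ord by simp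
    next
      case False
      then show ?thesis
        using le[OF \<alpha>' \<alpha>, of b b'] ord by (simp add: mult.commute inner_commute)
    qed
  qed
  have wlog: "(\<integral>\<omega>. (\<alpha> \<omega> \<bullet> incr a b \<omega>) * (\<alpha>' \<omega> \<bullet> incr a' b' \<omega>) \<partial>M)
    = measure lborel ({a<..b} \<inter> {a'<..b'}) * (\<integral>\<omega>. \<alpha> \<omega> \<bullet> \<alpha>' \<omega> \<partial>M)"
    if \<alpha>: "bounded_at a \<alpha>" "0 \<le> a" "a \<le> b" "b \<le> T"
      and \<alpha>': "bounded_at a' \<alpha>'" "0 \<le> a'" "a' \<le> b'" "b' \<le> T" and "a \<le> a'" for a b a' b' \<alpha> \<alpha>'
  proof (cases "b \<le> a'")
    case True
    then show ?thesis
      using isometry_disjoint[OF \<alpha>(1-3) \<alpha>'(1,3,4) True] by (simp add: half_open_interval_measure)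
  next
    case False
    have sq: "sq_integrable M (\<lambda>\<omega>. \<alpha>' \<omega> \<bullet> incr a' b' \<omega>)"
      by (rule sq_integrable_bounded_at_incr[OF \<alpha>'])
    have "(\<integral>\<omega>. (\<alpha> \<omega> \<bullet> incr a b \<omega>) * (\<alpha>' \<omega> \<bullet> incr a' b' \<omega>) \<partial>M)
        = (\<integral>\<omega>. (\<alpha> \<omega> \<bullet> incr a a' \<omega>) * (\<alpha>' \<omega> \<bullet> incr a' b' \<omega>) \<partial>M)
          + (\<integral>\<omega>. (\<alpha> \<omega> \<bullet> incr a' b \<omega>) * (\<alpha>' \<omega> \<bullet> incr a' b' \<omega>) \<partial>M)"
      by (rule split[OF \<alpha>(1,2) \<open>a \<le> a'\<close> _ \<alpha>(4) sq]) (use False in simp)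
    also have "(\<integral>\<omega>. (\<alpha> \<omega> \<bullet> incr a a' \<omega>) * (\<alpha>' \<omega> \<bullet> incr a' b' \<omega>) \<partial>M) = 0"
      by (rule isometry_disjoint[OF \<alpha>(1,2) \<open>a \<le> a'\<close> \<alpha>'(1,3,4)]) simp
    also have "(\<integral>\<omega>. (\<alpha> \<omega> \<bullet> incr a' b \<omega>) * (\<alpha>' \<omega> \<bullet> incr a' b' \<omega>) \<partial>M)
        = (min b b' - a') * (\<integral>\<omega>. \<alpha> \<omega> \<bullet> \<alpha>' \<omega> \<partial>M)"
      by (rule start[OF bounded_at_mono[OF \<alpha>(1) \<open>a \<le> a'\<close>] \<alpha>'(1,2) _ \<alpha>(4) \<alpha>'(3,4)]) (use False in simp)
    finally show ?thesis
      using False \<open>a \<le> a'\<close> \<alpha>' by (simp add: half_open_interval_measure)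
  qed
  show ?thesis
  proof (cases "a \<le> a'")
    case True
    then show ?thesis using wlog[OF \<alpha> \<alpha>'] by simp
  next
    case False
    then show ?thesis using wlog[OF \<alpha>' \<alpha>] by (simp add: mult.commute inner_commute Int_commute)
  qed
qed

lemma finite_measure_lborel_upto_pair: "finite_measure (lborel_upto u \<Otimes>\<^sub>M M)"
  by (intro finite_measure_pair_measure finite_measure_lborel_upto finite_measure_axioms)

lemma elementary_process_times:
  assumes e: "elementary_process M past t k \<tau> e" and j: "j < k"
  shows "0 \<le> \<tau> j" "\<tau> j \<le> \<tau> (Suc j)" "\<tau> (Suc j) \<le> t"
proof -
  have 0: "\<tau> 0 = 0" and t: "\<tau> k = t" and step: "\<And>j. j < k \<Longrightarrow> \<tau> j \<le> \<tau> (Suc j)"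
    using e unfolding elementary_process_def by auto
  show "\<tau> j \<le> \<tau> (Suc j)" using step j .
  have "i \<le> k \<Longrightarrow> 0 \<le> \<tau> i" for i
  proof (induction i)
    case (Suc i)
    then show ?case using step[of i] by linarith
  qed (simp add: 0)
  then show "0 \<le> \<tau> j" using j by simp
  have "Suc j \<le> k" using j by simp
  then have "\<tau> (Suc j) \<le> \<tau> k"
    by (induction rule: inc_induct) (use step in \<open>auto intro: order_trans\<close>)
  then show "\<tau> (Suc j) \<le> t" using t by simp
qed

lemma elementary_process_coefficient:
  fixes e :: "nat \<Rightarrow> 'a \<Rightarrow> real ^ 'm ^ 'n"
  assumes e: "elementary_process M past t k \<tau> e" and j: "j < k" and t: "t \<le> T"
  obtains C where "e j \<in> borel_measurable M" "\<And>\<omega>. \<omega> \<in> space M \<Longrightarrow> norm (e j \<omega>) \<le> C" "0 \<le> C"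
    "\<And>p. bounded_at (\<tau> j) (\<lambda>\<omega>. p v* e j \<omega>)"
proof -
  have m: "e j \<in> borel_measurable (past (\<tau> j))" using e j unfolding elementary_process_def by auto
  obtain C where C: "\<And>\<omega>. \<omega> \<in> space M \<Longrightarrow> norm (e j \<omega>) \<le> C"
    using e j unfolding elementary_process_def by blast
  have "\<tau> j \<le> T" using elementary_process_times[OF e j] t by linarith
  then have M: "e j \<in> borel_measurable M" using measurable_of_past[OF m] by simp
  have C0: "0 \<le> C" using C not_empty by (meson all_not_in_conv norm_ge_zero order_trans)
  have "bounded_at (\<tau> j) (\<lambda>\<omega>. p v* e j \<omega>)" for p
    unfolding bounded_at_def
  proof (intro conjI exI ballI)
    show "(\<lambda>\<omega>. p v* e j \<omega>) \<in> borel_measurable (past (\<tau> j))"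
      by (rule borel_measurable_vector_matrix_mult[OF m])
    fix \<omega> assume "\<omega> \<in> space M"
    then show "norm (p v* e j \<omega>) \<le> norm p * C"
      by (intro order_trans[OF norm_vector_matrix_mult_le] mult_left_mono C) auto
  qed
  then show ?thesis using that M C C0 by blast
qed

lemma sq_integrable_elementary_integral:
  fixes e :: "nat \<Rightarrow> 'a \<Rightarrow> real ^ 'm ^ 'n"
  assumes e: "elementary_process M past t k \<tau> e" and t: "t \<le> T"
  shows "sq_integrable M (elementary_integral W k \<tau> e)"
  unfolding elementary_integral_def
proof (rule sq_integrable_sum)
  fix j assume "j \<in> {..<k}"
  then have j: "j < k" by simp
  obtain C where C: "e j \<in> borel_measurable M" "\<And>\<omega>. \<omega> \<in> space M \<Longrightarrow> norm (e j \<omega>) \<le> C"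
    using elementary_process_coefficient[OF e j t] by metis
  note tj = elementary_process_times[OF e j]
  have i: "sq_integrable M (incr (\<tau> j) (\<tau> (Suc j)))"
    by (rule sq_integrable_incr) (use tj t in auto)
  show "sq_integrable M (\<lambda>\<omega>. e j \<omega> *v incr (\<tau> j) (\<tau> (Suc j)) \<omega>)"
  proof (rule sq_integrable_bound[OF i, of _ C])
    show "(\<lambda>\<omega>. e j \<omega> *v incr (\<tau> j) (\<tau> (Suc j)) \<omega>) \<in> borel_measurable M"
      by (rule borel_measurable_continuous_Pair[OF C(1) sq_integrableD(1)[OF i]],
          rule bounded_bilinear.continuous_on[OF bounded_bilinear_matrix_vector_mult])
         (intro continuous_intros)+
    show "AE \<omega> in M. norm (e j \<omega> *v incr (\<tau> j) (\<tau> (Suc j)) \<omega>) \<le> C * norm (incr (\<tau> j) (\<tau> (Suc j)) \<omega>)"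
      by (intro AE_I2 order_trans[OF norm_matrix_vector_mult_le] mult_right_mono C) auto
  qed
qed simp

lemma sq_integrable_elementary_value:
  fixes e :: "nat \<Rightarrow> 'a \<Rightarrow> real ^ 'm ^ 'n"
  assumes e: "elementary_process M past t k \<tau> e" and t: "t \<le> T"
  shows "sq_integrable (lborel_upto u \<Otimes>\<^sub>M M) (\<lambda>z. elementary_value k \<tau> e (fst z) (snd z))"
  unfolding elementary_value_def
proof (rule sq_integrable_sum)
  note measurable_lborel_upto_id[measurable]
  fix j assume "j \<in> {..<k}"
  then have j: "j < k" by simp
  obtain C where C[measurable]: "e j \<in> borel_measurable M"
    and C': "\<And>\<omega>. \<omega> \<in> space M \<Longrightarrow> norm (e j \<omega>) \<le> C" "0 \<le> C"
    using elementary_process_coefficient[OF e j t] by metis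
  have [measurable]: "(\<lambda>z. indicator {\<tau> j<..\<tau> (Suc j)} (fst z) :: real) \<in> borel_measurable (lborel_upto u \<Otimes>\<^sub>M M)"
    by (rule measurable_compose[OF measurable_compose[OF measurable_fst measurable_lborel_upto_id]]) simp
  show "sq_integrable (lborel_upto u \<Otimes>\<^sub>M M) (\<lambda>z. indicator {\<tau> j<..\<tau> (Suc j)} (fst z) *\<^sub>R e j (snd z))"
  proof (rule sq_integrable_bounded[OF finite_measure_lborel_upto_pair, of _ _ C])
    fix z assume "z \<in> space (lborel_upto u \<Otimes>\<^sub>M M)"
    then have "snd z \<in> space M" by (auto simp: space_pair_measure)
    then show "norm (indicator {\<tau> j<..\<tau> (Suc j)} (fst z) *\<^sub>R e j (snd z)) \<le> C"
      using C' by (auto simp: indicator_def)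
  qed measurable
qed simp

lemma elementary_isometry:
  fixes e e' :: "nat \<Rightarrow> 'a \<Rightarrow> real ^ 'm ^ 'n"
  assumes e: "elementary_process M past s k \<tau> e" and s: "s \<le> T"
    and e': "elementary_process M past r k' \<tau>' e'" and r: "r \<le> T"
  shows "(\<integral>\<omega>. (p \<bullet> elementary_integral W k \<tau> e \<omega>) * (q \<bullet> elementary_integral W k' \<tau>' e' \<omega>) \<partial>M)
    = (\<integral>z. (p v* elementary_value k \<tau> e (fst z) (snd z)) \<bullet> (q v* elementary_value k' \<tau>' e' (fst z) (snd z))
        \<partial>(lborel_upto (min s r) \<Otimes>\<^sub>M M))"
proof -
  let ?u = "min s r"
  let ?A = "\<lambda>j \<omega>. p v* e j \<omega>" and ?B = "\<lambda>j \<omega>. q v* e' j \<omega>"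
  let ?I = "\<lambda>j. {\<tau> j<..\<tau> (Suc j)}" and ?J = "\<lambda>j. {\<tau>' j<..\<tau>' (Suc j)}"
  let ?X = "\<lambda>j \<omega>. ?A j \<omega> \<bullet> incr (\<tau> j) (\<tau> (Suc j)) \<omega>"
  let ?Y = "\<lambda>j \<omega>. ?B j \<omega> \<bullet> incr (\<tau>' j) (\<tau>' (Suc j)) \<omega>"
  have A: "bounded_at (\<tau> j) (?A j)" if "j < k" for j
    using elementary_process_coefficient[OF e that s] by metis
  have B: "bounded_at (\<tau>' j) (?B j)" if "j < k'" for j
    using elementary_process_coefficient[OF e' that r] by metis
  have tA: "0 \<le> \<tau> j" "\<tau> j \<le> \<tau> (Suc j)" "\<tau> (Suc j) \<le> T" "\<tau> (Suc j) \<le> s" if "j < k" for j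
    using elementary_process_times[OF e that] s by auto
  have tB: "0 \<le> \<tau>' j" "\<tau>' j \<le> \<tau>' (Suc j)" "\<tau>' (Suc j) \<le> T" "\<tau>' (Suc j) \<le> r" if "j < k'" for j
    using elementary_process_times[OF e' that] r by auto
  have XY: "integrable M (\<lambda>\<omega>. ?X i \<omega> * ?Y j \<omega>)" if "i < k" "j < k'" for i j
    using integrable_inner_of_sq_integrable[OF
        sq_integrable_bounded_at_incr[OF A[OF that(1)] tA(1-3)[OF that(1)]]
        sq_integrable_bounded_at_incr[OF B[OF that(2)] tB(1-3)[OF that(2)]]] by simp
  have AB: "integrable M (\<lambda>\<omega>. ?A i \<omega> \<bullet> ?B j \<omega>)" if "i < k" "j < k'" for i j
    using sq_integrable_bounded_at[OF A[OF that(1)]] sq_integrable_bounded_at[OF B[OF that(2)]]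
      tA(2,3)[OF that(1)] tB(2,3)[OF that(2)]
    by (intro integrable_inner_of_sq_integrable) auto
  have ind: "integrable (lborel_upto ?u) (\<lambda>x. indicator (?I i \<inter> ?J j) x :: real)"
    and ind_val: "(\<integral>x. indicator (?I i \<inter> ?J j) x \<partial>lborel_upto ?u) = measure lborel (?I i \<inter> ?J j)"
    if "i < k" "j < k'" for i j
  proof -
    show "integrable (lborel_upto ?u) (\<lambda>x. indicator (?I i \<inter> ?J j) x :: real)"
      by (rule integrable_bounded_lborel_upto[of _ _ 1])
         (auto intro: measurable_compose[OF measurable_lborel_upto_id] simp: indicator_def)
    have "?I i \<inter> ?J j \<subseteq> {0..?u}"
      using tA[OF that(1)] tB[OF that(2)] by auto
    then have "indicator {0..?u} x *\<^sub>R indicator (?I i \<inter> ?J j) x = (indicator (?I i \<inter> ?J j) x :: real)" for x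
      by (auto simp: indicator_def)
    then show "(\<integral>x. indicator (?I i \<inter> ?J j) x \<partial>lborel_upto ?u) = measure lborel (?I i \<inter> ?J j)"
      unfolding integral_lborel_upto set_lebesgue_integral_def
      by (simp only: Bochner_Integration.integral_indicator space_lborel space_borel Int_UNIV_right)
  qed
  have "(\<integral>\<omega>. (p \<bullet> elementary_integral W k \<tau> e \<omega>) * (q \<bullet> elementary_integral W k' \<tau>' e' \<omega>) \<partial>M)
      = (\<integral>\<omega>. (\<Sum>i<k. \<Sum>j<k'. ?X i \<omega> * ?Y j \<omega>) \<partial>M)"
    unfolding elementary_integral_def
    by (simp only: inner_sum_right inner_matrix_vector_mult sum_product)
  also have "\<dots> = (\<Sum>i<k. \<Sum>j<k'. \<integral>\<omega>. ?X i \<omega> * ?Y j \<omega> \<partial>M)"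
    by (rule integral_double_sum) (rule XY)
  also have "\<dots> = (\<Sum>i<k. \<Sum>j<k'. measure lborel (?I i \<inter> ?J j) * (\<integral>\<omega>. ?A i \<omega> \<bullet> ?B j \<omega> \<partial>M))"
    by (intro sum.cong refl increment_isometry A B tA tB) auto
  also have "\<dots> = (\<Sum>i<k. \<Sum>j<k'.
      \<integral>z. indicator (?I i \<inter> ?J j) (fst z) * (?A i (snd z) \<bullet> ?B j (snd z)) \<partial>(lborel_upto ?u \<Otimes>\<^sub>M M))"
  proof (intro sum.cong refl)
    fix i j assume ij: "i \<in> {..<k}" "j \<in> {..<k'}"
    then have ij: "i < k" "j < k'" by auto
    show "measure lborel (?I i \<inter> ?J j) * (\<integral>\<omega>. ?A i \<omega> \<bullet> ?B j \<omega> \<partial>M)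
        = (\<integral>z. indicator (?I i \<inter> ?J j) (fst z) * (?A i (snd z) \<bullet> ?B j (snd z)) \<partial>(lborel_upto ?u \<Otimes>\<^sub>M M))"
      unfolding ind_val[OF ij, symmetric]
      by (rule integral_pair_product[OF sigma_finite_lborel_upto sigma_finite_measure_axioms ind[OF ij] AB[OF ij], symmetric])
  qed
  also have "\<dots> = (\<integral>z. (\<Sum>i<k. \<Sum>j<k'. indicator (?I i \<inter> ?J j) (fst z) * (?A i (snd z) \<bullet> ?B j (snd z)))
      \<partial>(lborel_upto ?u \<Otimes>\<^sub>M M))"
    by (rule integral_double_sum[symmetric])
       (rule integrable_pair_product[OF sigma_finite_lborel_upto sigma_finite_measure_axioms ind AB])
  also have "(\<lambda>z. \<Sum>i<k. \<Sum>j<k'. indicator (?I i \<inter> ?J j) (fst z) * (?A i (snd z) \<bullet> ?B j (snd z)))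
      = (\<lambda>z. (p v* elementary_value k \<tau> e (fst z) (snd z)) \<bullet> (q v* elementary_value k' \<tau>' e' (fst z) (snd z)))"
    unfolding elementary_value_def vector_matrix_mult_sum vector_matrix_mult_scaleR
      inner_sum_left
    unfolding inner_sum_right inner_scaleR_left inner_scaleR_right
    by (intro ext sum.cong refl) (simp only: indicator_inter_arith mult_ac)
  finally show ?thesis .
qed

lemma elementary_integral_mean:
  fixes e :: "nat \<Rightarrow> 'a \<Rightarrow> real ^ 'm ^ 'n"
  assumes e: "elementary_process M past s k \<tau> e" and s: "s \<le> T"
  shows "(\<integral>\<omega>. p \<bullet> elementary_integral W k \<tau> e \<omega> \<partial>M) = 0"
proof -
  have A: "bounded_at (\<tau> j) (\<lambda>\<omega>. p v* e j \<omega>)" if "j < k" for j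
    using elementary_process_coefficient[OF e that s] by metis
  have tA: "0 \<le> \<tau> j" "\<tau> j \<le> \<tau> (Suc j)" "\<tau> (Suc j) \<le> T" if "j < k" for j
    using elementary_process_times[OF e that] s by auto
  have "(\<integral>\<omega>. p \<bullet> elementary_integral W k \<tau> e \<omega> \<partial>M)
      = (\<integral>\<omega>. (\<Sum>j<k. (p v* e j \<omega>) \<bullet> incr (\<tau> j) (\<tau> (Suc j)) \<omega>) \<partial>M)"
    unfolding elementary_integral_def by (simp only: inner_sum_right inner_matrix_vector_mult)
  also have "\<dots> = (\<Sum>j<k. \<integral>\<omega>. (p v* e j \<omega>) \<bullet> incr (\<tau> j) (\<tau> (Suc j)) \<omega> \<partial>M)"
    by (intro Bochner_Integration.integral_sum integrable_of_sq_integrable finite_measure_axioms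
        sq_integrable_bounded_at_incr A tA) auto
  also have "\<dots> = 0"
    by (intro sum.neutral ballI expectation_increment_eq_0 A tA) auto
  finally show ?thesis .
qed

text \<open>Both sides are \<open>L\<^sup>2\<close> limits of their counterparts for elementary processes. The polarised form with
  two integrands, two directions and two end points is what allows noise terms of different strength
  and at different times to be compared.\<close>

lemma
  fixes H H' :: "real \<Rightarrow> 'a \<Rightarrow> real ^ 'm ^ 'n"
  assumes H: "has_ito_integral M past W s H I" and s: "s \<le> T"
    and H': "has_ito_integral M past W r H' I'" and r: "r \<le> T"
  shows ito_sq_integrable: "sq_integrable M I"
    and ito_mean: "(\<integral>\<omega>. p \<bullet> I \<omega> \<partial>M) = 0"
    and ito_isometry: "(\<integral>\<omega>. (p \<bullet> I \<omega>) * (q \<bullet> I' \<omega>) \<partial>M)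
      = (\<integral>z. (p v* H (fst z) (snd z)) \<bullet> (q v* H' (fst z) (snd z)) \<partial>(lborel_upto (min s r) \<Otimes>\<^sub>M M))"
proof -
  let ?u = "min s r"
  have approx: "\<exists>k \<tau> e. (\<forall>i. elementary_process M past s (k i) (\<tau> i) (e i)) \<and>
        (\<lambda>i :: nat. \<integral>\<^sup>+z. ennreal ((norm (elementary_value (k i) (\<tau> i) (e i) (fst z) (snd z) - H (fst z) (snd z)))\<^sup>2)
          \<partial>(lborel_upto u \<Otimes>\<^sub>M M)) \<longlonglongrightarrow> 0 \<and>
        (\<lambda>i. \<integral>\<^sup>+\<omega>. ennreal ((norm (elementary_integral W (k i) (\<tau> i) (e i) \<omega> - I \<omega>))\<^sup>2) \<partial>M) \<longlonglongrightarrow> 0 \<and>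
        (\<lambda>z. H (fst z) (snd z)) \<in> borel_measurable (lborel_upto u \<Otimes>\<^sub>M M) \<and> I \<in> borel_measurable M"
    if H: "has_ito_integral M past W s H I" and s: "s \<le> T" and u: "u \<le> s"
    for H :: "real \<Rightarrow> 'a \<Rightarrow> real ^ 'm ^ 'n" and I s u
  proof -
    have Hm0: "(\<lambda>(s, \<omega>). H s \<omega>) \<in> borel_measurable (restrict_space borel {0..s} \<Otimes>\<^sub>M M)"
      and Im: "I \<in> borel_measurable M" using H unfolding has_ito_integral_def by blast+
    have Hm[measurable]: "(\<lambda>z. H (fst z) (snd z)) \<in> borel_measurable (lborel_upto u \<Otimes>\<^sub>M M)"
      using measurable_lborel_upto_pair_mono[OF Hm0 u] by (simp add: case_prod_unfold)
    obtain k \<tau> e where ep: "\<And>i. elementary_process M past s (k i) (\<tau> i) (e i)"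
      and l1: "(\<lambda>i :: nat. \<integral>\<^sup>+\<omega>. (\<integral>\<^sup>+s\<in>{0..s}.
            ennreal ((norm (elementary_value (k i) (\<tau> i) (e i) s \<omega> - H s \<omega>))\<^sup>2) \<partial>lborel) \<partial>M)
          \<longlonglongrightarrow> 0"
      and l2: "(\<lambda>i. \<integral>\<^sup>+\<omega>. ennreal ((norm (elementary_integral W (k i) (\<tau> i) (e i) \<omega> - I \<omega>))\<^sup>2) \<partial>M)
          \<longlonglongrightarrow> 0"
      using H unfolding has_ito_integral_def by blast
    have ev[measurable]: "(\<lambda>z. elementary_value (k i) (\<tau> i) (e i) (fst z) (snd z)) \<in> borel_measurable (lborel_upto u \<Otimes>\<^sub>M M)" for i
      by (rule sq_integrableD(1)[OF sq_integrable_elementary_value[OF ep s]])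
    have le: "(\<integral>\<^sup>+z. ennreal ((norm (elementary_value (k i) (\<tau> i) (e i) (fst z) (snd z) - H (fst z) (snd z)))\<^sup>2)
          \<partial>(lborel_upto u \<Otimes>\<^sub>M M))
        \<le> (\<integral>\<^sup>+\<omega>. (\<integral>\<^sup>+s\<in>{0..s}. ennreal ((norm (elementary_value (k i) (\<tau> i) (e i) s \<omega> - H s \<omega>))\<^sup>2) \<partial>lborel) \<partial>M)" for i
      using u
      by (subst nn_integral_lborel_upto_pair[OF sigma_finite_measure_axioms])
         (auto intro!: nn_integral_mono simp: indicator_def)
    have "(\<lambda>i. \<integral>\<^sup>+z. ennreal ((norm (elementary_value (k i) (\<tau> i) (e i) (fst z) (snd z) - H (fst z) (snd z)))\<^sup>2)
          \<partial>(lborel_upto u \<Otimes>\<^sub>M M)) \<longlonglongrightarrow> 0"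
      by (rule tendsto_sandwich[OF _ _ tendsto_const l1]) (use le in auto)
    then show ?thesis using ep l2 Hm Im by blast
  qed
  obtain k \<tau> e where ep: "\<And>i :: nat. elementary_process M past s (k i) (\<tau> i) (e i)"
    and l1: "(\<lambda>i. \<integral>\<^sup>+z. ennreal ((norm (elementary_value (k i) (\<tau> i) (e i) (fst z) (snd z) - H (fst z) (snd z)))\<^sup>2)
          \<partial>(lborel_upto ?u \<Otimes>\<^sub>M M)) \<longlonglongrightarrow> 0"
    and l2: "(\<lambda>i. \<integral>\<^sup>+\<omega>. ennreal ((norm (elementary_integral W (k i) (\<tau> i) (e i) \<omega> - I \<omega>))\<^sup>2) \<partial>M) \<longlonglongrightarrow> 0"
    and Hm: "(\<lambda>z. H (fst z) (snd z)) \<in> borel_measurable (lborel_upto ?u \<Otimes>\<^sub>M M)" and Im: "I \<in> borel_measurable M"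
    using approx[OF H s, of ?u] by auto
  obtain k' \<tau>' e' where ep': "\<And>i :: nat. elementary_process M past r (k' i) (\<tau>' i) (e' i)"
    and l1': "(\<lambda>i. \<integral>\<^sup>+z. ennreal ((norm (elementary_value (k' i) (\<tau>' i) (e' i) (fst z) (snd z) - H' (fst z) (snd z)))\<^sup>2)
          \<partial>(lborel_upto ?u \<Otimes>\<^sub>M M)) \<longlonglongrightarrow> 0"
    and l2': "(\<lambda>i. \<integral>\<^sup>+\<omega>. ennreal ((norm (elementary_integral W (k' i) (\<tau>' i) (e' i) \<omega> - I' \<omega>))\<^sup>2) \<partial>M) \<longlonglongrightarrow> 0"
    and Hm': "(\<lambda>z. H' (fst z) (snd z)) \<in> borel_measurable (lborel_upto ?u \<Otimes>\<^sub>M M)" and Im': "I' \<in> borel_measurable M"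
    using approx[OF H' r, of ?u] by auto
  let ?E = "\<lambda>i. elementary_integral W (k i) (\<tau> i) (e i)" and ?E' = "\<lambda>i. elementary_integral W (k' i) (\<tau>' i) (e' i)"
  let ?V = "\<lambda>i z. elementary_value (k i) (\<tau> i) (e i) (fst z) (snd z)"
  let ?V' = "\<lambda>i z. elementary_value (k' i) (\<tau>' i) (e' i) (fst z) (snd z)"
  have sE: "sq_integrable M (?E i)" and sE': "sq_integrable M (?E' i)" for i
    using sq_integrable_elementary_integral[OF ep s] sq_integrable_elementary_integral[OF ep' r] by auto
  have sV: "sq_integrable (lborel_upto ?u \<Otimes>\<^sub>M M) (?V i)" and sV': "sq_integrable (lborel_upto ?u \<Otimes>\<^sub>M M) (?V' i)" for i
    using sq_integrable_elementary_value[OF ep s] sq_integrable_elementary_value[OF ep' r] by auto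
  show I: "sq_integrable M I"
    by (rule L2_inner_tendsto(1)[OF sE sE Im Im l2 l2])
  have pE: "(\<lambda>i. \<integral>\<^sup>+\<omega>. ennreal ((norm (p \<bullet> EE i \<omega> - p \<bullet> I \<omega>))\<^sup>2) \<partial>M) \<longlonglongrightarrow> 0"
    if "(\<lambda>i. \<integral>\<^sup>+\<omega>. ennreal ((norm (EE i \<omega> - I \<omega>))\<^sup>2) \<partial>M) \<longlonglongrightarrow> 0"
      "\<And>i. sq_integrable M (EE i)" "I \<in> borel_measurable M" for p I EE
    by (rule nn_L2_tendsto_0_mono[OF that(1), of _ "norm p"])
       (use that(3) sq_integrableD(1)[OF that(2)] in
         \<open>auto simp: inner_diff_right[symmetric] Cauchy_Schwarz_ineq2 simp del: inner_diff_right\<close>)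
  have pV: "(\<lambda>i. \<integral>\<^sup>+z. ennreal ((norm (p v* VV i z - p v* H z))\<^sup>2) \<partial>N) \<longlonglongrightarrow> 0"
    if "(\<lambda>i. \<integral>\<^sup>+z. ennreal ((norm (VV i z - H z))\<^sup>2) \<partial>N) \<longlonglongrightarrow> 0"
      "\<And>i. sq_integrable N (VV i)" "H \<in> borel_measurable N" for p N and H :: "real \<times> 'a \<Rightarrow> real ^ 'm ^ 'n" and VV
    by (rule nn_L2_tendsto_0_mono[OF that(1), of _ "norm p"])
       (use that(3) sq_integrableD(1)[OF that(2)] in
         \<open>auto simp: vector_matrix_mult_diff[symmetric] norm_vector_matrix_mult_le\<close>)
  have one: "sq_integrable M (\<lambda>_. 1 :: real)" by (simp add: sq_integrable_def)
  have "(\<lambda>i. \<integral>\<omega>. (p \<bullet> ?E i \<omega>) \<bullet> 1 \<partial>M) \<longlonglongrightarrow> (\<integral>\<omega>. (p \<bullet> I \<omega>) \<bullet> 1 \<partial>M)"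
    by (rule L2_inner_tendsto(3)[OF sq_integrable_inner[OF sE] one _ _ pE[OF l2 sE Im]]) (use Im in auto)
  then have "(\<lambda>i. 0) \<longlonglongrightarrow> (\<integral>\<omega>. p \<bullet> I \<omega> \<partial>M)"
    by (simp add: elementary_integral_mean[OF ep s])
  then show "(\<integral>\<omega>. p \<bullet> I \<omega> \<partial>M) = 0"
    by (simp add: LIMSEQ_const_iff)
  have L: "(\<lambda>i. \<integral>\<omega>. (p \<bullet> ?E i \<omega>) \<bullet> (q \<bullet> ?E' i \<omega>) \<partial>M) \<longlonglongrightarrow> (\<integral>\<omega>. (p \<bullet> I \<omega>) \<bullet> (q \<bullet> I' \<omega>) \<partial>M)"
    by (rule L2_inner_tendsto(3)[OF sq_integrable_inner[OF sE] sq_integrable_inner[OF sE'] _ _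
          pE[OF l2 sE Im] pE[OF l2' sE' Im']]) (use Im Im' in auto)
  have sqV: "sq_integrable N (\<lambda>z. p v* V z)" if "sq_integrable N V"
    for p N and V :: "real \<times> 'a \<Rightarrow> real ^ 'm ^ 'n"
    by (rule sq_integrable_bound[OF that, of _ "norm p"])
       (use sq_integrableD(1)[OF that] in \<open>auto intro: borel_measurable_vector_matrix_mult simp: norm_vector_matrix_mult_le\<close>)
  have R: "(\<lambda>i. \<integral>z. (p v* ?V i z) \<bullet> (q v* ?V' i z) \<partial>(lborel_upto ?u \<Otimes>\<^sub>M M))
      \<longlonglongrightarrow> (\<integral>z. (p v* H (fst z) (snd z)) \<bullet> (q v* H' (fst z) (snd z)) \<partial>(lborel_upto ?u \<Otimes>\<^sub>M M))"
    by (rule L2_inner_tendsto(3)[OF sqV[OF sV] sqV[OF sV'] _ _ pV[OF l1 sV Hm] pV[OF l1' sV' Hm']])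
       (use Hm Hm' in \<open>auto intro: borel_measurable_vector_matrix_mult\<close>)
  have "(\<integral>\<omega>. (p \<bullet> ?E i \<omega>) \<bullet> (q \<bullet> ?E' i \<omega>) \<partial>M)
      = (\<integral>z. (p v* ?V i z) \<bullet> (q v* ?V' i z) \<partial>(lborel_upto ?u \<Otimes>\<^sub>M M))" for i
    using elementary_isometry[OF ep s ep' r, of p i q i] by simp
  then show "(\<integral>\<omega>. (p \<bullet> I \<omega>) * (q \<bullet> I' \<omega>) \<partial>M)
      = (\<integral>z. (p v* H (fst z) (snd z)) \<bullet> (q v* H' (fst z) (snd z)) \<partial>(lborel_upto ?u \<Otimes>\<^sub>M M))"
    using LIMSEQ_unique[OF L] R by simp
qed

end

section \<open>The linearised flow\<close>

text \<open>The hypotheses on \<open>u\<close> in the form in which they are used: \<open>K\<close> bounds the derivative and \<open>C\<close> is the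
  constant of the quadratic Taylor estimate.\<close>

locale linearised_flow =
  fixes T K C K_L :: real
    and u :: "real ^ 'n \<Rightarrow> real \<Rightarrow> real ^ 'n"
    and F :: "real \<Rightarrow> real ^ 'n \<Rightarrow> real ^ 'n" and x0 :: "real ^ 'n"
  assumes flow: "flow_map u T F"
    and F_differentiable: "\<And>s. s \<in> {0..T} \<Longrightarrow> F s differentiable (at x0)"
    and F_invertible: "\<And>s. s \<in> {0..T} \<Longrightarrow> invertible (jacobian (F s) (at x0))"
    and u_differentiable: "\<And>s z. s \<in> {0..T} \<Longrightarrow> (\<lambda>z. u z s) differentiable (at z)"
    and K: "0 \<le> K"
    and u_lipschitz: "\<And>s z w. s \<in> {0..T} \<Longrightarrow> norm (u z s - u w s) \<le> K * norm (z - w)"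
    and u_jacobian: "\<And>s z h. s \<in> {0..T} \<Longrightarrow> norm (jacobian (\<lambda>z. u z s) (at z) *v h) \<le> K * norm h"
    and C: "0 \<le> C"
    and u_taylor: "\<And>s z w. s \<in> {0..T} \<Longrightarrow>
      norm (u z s - u w s - jacobian (\<lambda>z. u z s) (at w) *v (z - w)) \<le> C * (norm (z - w))\<^sup>2"
    and u_measurable: "\<And>z. (\<lambda>s. u z s) \<in> borel_measurable (restrict_space borel {0..T})"
    and u_growth: "\<And>s z. s \<in> {0..T} \<Longrightarrow> norm (u z s) \<le> K_L * (1 + norm z)"
begin

text \<open>The reference path, the derivative of \<open>u\<close> along it, the derivative of the flow at \<open>x0\<close> and its
  inverse.\<close>

abbreviation x :: "real \<Rightarrow> real ^ 'n" where "x s \<equiv> F s x0"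
abbreviation A :: "real \<Rightarrow> real ^ 'n ^ 'n" where "A s \<equiv> jacobian (\<lambda>z. u z s) (at (x s))"
abbreviation \<Phi> :: "real \<Rightarrow> real ^ 'n ^ 'n" where "\<Phi> s \<equiv> jacobian (F s) (at x0)"
abbreviation \<Psi> :: "real \<Rightarrow> real ^ 'n ^ 'n" where "\<Psi> s \<equiv> matrix_inv (\<Phi> s)"

lemma u_continuous: "s \<in> {0..T} \<Longrightarrow> continuous_on UNIV (\<lambda>z. u z s)"
  using u_differentiable by (meson continuous_at_imp_continuous_on differentiable_imp_continuous_within)

lemma u_jointly_measurable: "(\<lambda>z. u (fst z) (snd z)) \<in> borel_measurable (borel \<Otimes>\<^sub>M restrict_space borel {0..T})"
  by (rule caratheodory_measurable[OF u_measurable]) (use u_continuous in auto)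

lemma u_along_measurable:
  assumes g: "g \<in> borel_measurable N" and s: "s \<in> N \<rightarrow>\<^sub>M restrict_space borel {0..T}"
  shows "(\<lambda>a. u (g a) (s a)) \<in> borel_measurable N"
  using measurable_compose[OF measurable_Pair[OF g s] u_jointly_measurable] by simp

lemma lborel_upto_id_restrict: "t \<le> T \<Longrightarrow> (\<lambda>s. s) \<in> lborel_upto t \<rightarrow>\<^sub>M restrict_space borel {0..T}"
  by (rule measurable_restrict_space2[OF _ measurable_lborel_upto_id]) auto

lemma flow_eq:
  assumes "s \<in> {0..T}"
  shows "integrable (lborel_upto s) (\<lambda>r. u (F r z) r)" "F s z = z + (\<integral>r. u (F r z) r \<partial>lborel_upto s)"
  using flow assms unfolding flow_map_def integrable_lborel_upto integral_lborel_upto by auto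

lemma flow_continuous:
  shows "continuous_on {0..T} (\<lambda>s. F s z)"
proof (cases "0 \<le> T")
  case True
  let ?f = "\<lambda>r. u (F r z) r"
  have "set_integrable lborel {0..T} ?f"
    using flow_eq(1)[of T z] True by (simp add: integrable_lborel_upto)
  then have "?f integrable_on {0..T}" by (rule set_borel_integral_eq_integral(1))
  then have "continuous_on {0..T} (\<lambda>s. z + integral {0..s} ?f)"
    by (intro continuous_intros indefinite_integral_continuous_1)
  moreover have "z + integral {0..s} ?f = F s z" if "s \<in> {0..T}" for s
    using flow_eq[OF that, of z] set_borel_integral_eq_integral(2)[of "{0..s}" ?f]
    by (simp add: integrable_lborel_upto integral_lborel_upto)
  ultimately show ?thesis by (rule continuous_on_eq) auto
qed auto

text \<open>The Lipschitz constant of the flow that Gronwall's inequality yields.\<close>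

definition flow_lip :: real where "flow_lip = 1 + K * exp (K * T) * T"

lemma flow_lip_pos: "s \<in> {0..T} \<Longrightarrow> 0 < flow_lip"
  unfolding flow_lip_def using K by (intro add_pos_nonneg) auto

lemma flow_lipschitz:
  assumes s: "s \<in> {0..T}"
  shows "norm (F s z - F s w) \<le> flow_lip * norm (z - w)"
proof -
  let ?f = "\<lambda>r. norm (F r z - F r w)"
  have f: "continuous_on {0..T} ?f" by (intro continuous_intros flow_continuous)
  have "?f s \<le> norm (z - w) + K * exp (K * T) * (\<integral>r. norm (z - w) \<partial>lborel_upto T)"
  proof (rule gronwall[OF f continuous_on_const _ K _ s])
    fix r assume r: "r \<in> {0..T}"
    have fr: "continuous_on {0..r} ?f" using r by (intro continuous_on_subset[OF f]) auto
    have "F r z - F r w = (z - w) + (\<integral>v. u (F v z) v - u (F v w) v \<partial>lborel_upto r)"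
      using flow_eq[OF r, of z] flow_eq[OF r, of w] by simp
    then have "?f r \<le> norm (z - w) + norm (\<integral>v. u (F v z) v - u (F v w) v \<partial>lborel_upto r)"
      by (simp only: norm_triangle_ineq)
    also have "norm (\<integral>v. u (F v z) v - u (F v w) v \<partial>lborel_upto r) \<le> (\<integral>v. K * ?f v \<partial>lborel_upto r)"
      using flow_eq(1)[OF r, of z] flow_eq(1)[OF r, of w] integrable_lborel_upto_continuous[OF fr] r
      by (intro Bochner_Integration.integral_norm_bound_integral u_lipschitz) auto
    also have "\<dots> = K * (\<integral>v. ?f v \<partial>lborel_upto r)" by simp
    finally show "?f r \<le> norm (z - w) + K * (\<integral>v. ?f v \<partial>lborel_upto r)" by simp
  qed simp
  moreover have T: "measure (lborel_upto T) {0..T} = T"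
    using s measure_lborel_upto[of T] by simp
  ultimately show ?thesis by (simp add: T flow_lip_def algebra_simps)
qed

lemma quotient_tendsto:
  assumes s: "s \<in> {0..T}"
  shows "(\<lambda>n. real (Suc n) *\<^sub>R (F s (x0 + h /\<^sub>R real (Suc n)) - F s x0)) \<longlonglongrightarrow> \<Phi> s *v h"
    and "(\<lambda>n. real (Suc n) *\<^sub>R (u (F s (x0 + h /\<^sub>R real (Suc n))) s - u (x s) s)) \<longlonglongrightarrow> A s *v (\<Phi> s *v h)"
proof -
  have F: "(F s has_derivative (*v) (\<Phi> s)) (at x0)"
    using F_differentiable[OF s] jacobian_works by blast
  then show "(\<lambda>n. real (Suc n) *\<^sub>R (F s (x0 + h /\<^sub>R real (Suc n)) - F s x0)) \<longlonglongrightarrow> \<Phi> s *v h"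
    by (rule directional_difference_quotient)
  have u: "((\<lambda>z. u z s) has_derivative (*v) (A s)) (at (F s x0))"
    using u_differentiable[OF s] jacobian_works by blast
  have "((\<lambda>z. u (F s z) s) has_derivative (\<lambda>h. A s *v (\<Phi> s *v h))) (at x0)"
    using has_derivative_compose[OF F u] .
  then show "(\<lambda>n. real (Suc n) *\<^sub>R (u (F s (x0 + h /\<^sub>R real (Suc n))) s - u (x s) s)) \<longlonglongrightarrow> A s *v (\<Phi> s *v h)"
    by (rule directional_difference_quotient)
qed

lemma norm_\<Phi>_le:
  assumes s: "s \<in> {0..T}"
  shows "norm (\<Phi> s *v h) \<le> flow_lip * norm h"
proof (rule Lim_norm_ubound[OF _ quotient_tendsto(1)[OF s]])
  show "\<forall>\<^sub>F n in sequentially. norm (real (Suc n) *\<^sub>R (F s (x0 + h /\<^sub>R real (Suc n)) - F s x0)) \<le> flow_lip * norm h"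
  proof (intro always_eventually allI)
    fix n
    have "norm (F s (x0 + h /\<^sub>R real (Suc n)) - F s x0) \<le> flow_lip * (norm h / real (Suc n))"
      using flow_lipschitz[OF s, of "x0 + h /\<^sub>R real (Suc n)" x0] by (simp add: divide_inverse_commute)
    then have "real (Suc n) * norm (F s (x0 + h /\<^sub>R real (Suc n)) - F s x0) \<le> real (Suc n) * (flow_lip * (norm h / real (Suc n)))"
      by (rule mult_left_mono) simp
    then show "norm (real (Suc n) *\<^sub>R (F s (x0 + h /\<^sub>R real (Suc n)) - F s x0)) \<le> flow_lip * norm h" by simp
  qed
qed simp

lemma flow_path_measurable: "t \<le> T \<Longrightarrow> (\<lambda>s. F s z) \<in> borel_measurable (lborel_upto t)"
  unfolding measurable_lborel_upto_cong
  by (rule borel_measurable_continuous_on_restrict, rule continuous_on_subset[OF flow_continuous]) auto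

lemma u_path_measurable: "t \<le> T \<Longrightarrow> (\<lambda>s. u (F s z) s) \<in> borel_measurable (lborel_upto t)"
  by (intro u_along_measurable flow_path_measurable lborel_upto_id_restrict)

lemma A_\<Phi>_measurable:
  assumes "t \<le> T"
  shows "(\<lambda>s. A s *v (\<Phi> s *v h)) \<in> borel_measurable (lborel_upto t)"
proof (rule borel_measurable_LIMSEQ_metric)
  show "(\<lambda>s. real (Suc n) *\<^sub>R (u (F s (x0 + h /\<^sub>R real (Suc n))) s - u (x s) s)) \<in> borel_measurable (lborel_upto t)" for n
    using u_path_measurable[OF assms] by auto
  show "(\<lambda>n. real (Suc n) *\<^sub>R (u (F s (x0 + h /\<^sub>R real (Suc n))) s - u (x s) s)) \<longlonglongrightarrow> A s *v (\<Phi> s *v h)"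
    if "s \<in> space (lborel_upto t)" for s
    using that assms by (intro quotient_tendsto) auto
qed

lemma A_measurable:
  assumes "t \<le> T"
  shows "A \<in> borel_measurable (lborel_upto t)"
proof (rule borel_measurable_matrixI)
  fix i j
  have "(\<lambda>s. A s *v axis j 1) \<in> borel_measurable (lborel_upto t)"
  proof (rule borel_measurable_LIMSEQ_metric)
    show "(\<lambda>s. real (Suc n) *\<^sub>R (u (x s + axis j 1 /\<^sub>R real (Suc n)) s - u (x s) s)) \<in> borel_measurable (lborel_upto t)" for n
      by (intro borel_measurable_scaleR borel_measurable_diff borel_measurable_const u_along_measurable
          borel_measurable_add flow_path_measurable lborel_upto_id_restrict assms)
    show "(\<lambda>n. real (Suc n) *\<^sub>R (u (x s + axis j 1 /\<^sub>R real (Suc n)) s - u (x s) s)) \<longlonglongrightarrow> A s *v axis j 1"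
      if "s \<in> space (lborel_upto t)" for s
    proof -
      have "s \<in> {0..T}" using that assms by auto
      then have "((\<lambda>z. u z s) has_derivative (*v) (A s)) (at (x s))"
        using u_differentiable jacobian_works by blast
      then show ?thesis by (rule directional_difference_quotient)
    qed
  qed
  then have "(\<lambda>s. (A s *v axis j 1) $ i) \<in> borel_measurable (lborel_upto t)"
    by (rule borel_measurable_component)
  then show "(\<lambda>s. A s $ i $ j) \<in> borel_measurable (lborel_upto t)"
    by (simp add: matrix_vector_mul_component inner_axis)
qed

text \<open>The variational equation. The difference quotients of \<open>F\<close> satisfy the differenced integral
  equation and converge boundedly, by the Lipschitz bounds on \<open>u\<close> and on the flow.\<close>

lemma variational_equation:
  assumes s: "s \<in> {0..T}"
  shows "integrable (lborel_upto s) (\<lambda>r. A r *v (\<Phi> r *v h))"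
    and "\<Phi> s *v h = h + (\<integral>r. A r *v (\<Phi> r *v h) \<partial>lborel_upto s)"
proof -
  let ?q = "\<lambda>n r. real (Suc n) *\<^sub>R (u (F r (x0 + h /\<^sub>R real (Suc n))) r - u (x r) r)"
  let ?b = "\<lambda>r :: real. K * (flow_lip * norm h)"
  have sT: "s \<le> T" using s by simp
  have q: "?q n \<in> borel_measurable (lborel_upto s)" for n
    using u_path_measurable[OF sT] by auto
  have b: "integrable (lborel_upto s) ?b"
    by (rule finite_measure.integrable_const[OF finite_measure_lborel_upto])
  have lim: "AE r in lborel_upto s. (\<lambda>n. ?q n r) \<longlonglongrightarrow> A r *v (\<Phi> r *v h)"
    by (rule AE_I2) (use quotient_tendsto(2) s in auto)
  have bound: "AE r in lborel_upto s. norm (?q n r) \<le> ?b r" for n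
  proof (rule AE_I2)
    fix r assume "r \<in> space (lborel_upto s)"
    then have r: "r \<in> {0..T}" using s by auto
    have "norm (u (F r (x0 + h /\<^sub>R real (Suc n))) r - u (x r) r) \<le> K * (flow_lip * (norm h / real (Suc n)))"
      using flow_lipschitz[OF r, of "x0 + h /\<^sub>R real (Suc n)" x0]
      by (intro order_trans[OF u_lipschitz[OF r]] mult_left_mono K) (simp add: divide_inverse_commute)
    then have "real (Suc n) * norm (u (F r (x0 + h /\<^sub>R real (Suc n))) r - u (x r) r)
        \<le> real (Suc n) * (K * (flow_lip * (norm h / real (Suc n))))"
      by (rule mult_left_mono) simp
    also have "\<dots> = ?b r" by (simp del: of_nat_Suc)
    finally show "norm (?q n r) \<le> ?b r" by simp
  qed
  show "integrable (lborel_upto s) (\<lambda>r. A r *v (\<Phi> r *v h))"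
    by (rule integrable_dominated_convergence[OF A_\<Phi>_measurable[OF sT] q b lim bound])
  have lim2: "(\<lambda>n. \<integral>r. ?q n r \<partial>lborel_upto s) \<longlonglongrightarrow> (\<integral>r. A r *v (\<Phi> r *v h) \<partial>lborel_upto s)"
    by (rule integral_dominated_convergence[OF A_\<Phi>_measurable[OF sT] q b lim bound])
  have eq: "real (Suc n) *\<^sub>R (F s (x0 + h /\<^sub>R real (Suc n)) - F s x0) = h + (\<integral>r. ?q n r \<partial>lborel_upto s)" for n
  proof -
    let ?z = "x0 + h /\<^sub>R real (Suc n)"
    have "F s ?z - F s x0 = h /\<^sub>R real (Suc n) + (\<integral>r. u (F r ?z) r - u (x r) r \<partial>lborel_upto s)"
      using flow_eq[OF s, of ?z] flow_eq[OF s, of x0] by simp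
    then show ?thesis
      using flow_eq(1)[OF s, of ?z] flow_eq(1)[OF s, of x0] by (simp add: scaleR_right_distrib del: of_nat_Suc)
  qed
  have "(\<lambda>n. h + (\<integral>r. ?q n r \<partial>lborel_upto s)) \<longlonglongrightarrow> h + (\<integral>r. A r *v (\<Phi> r *v h) \<partial>lborel_upto s)"
    by (intro tendsto_intros lim2)
  moreover have "(\<lambda>n. h + (\<integral>r. ?q n r \<partial>lborel_upto s)) \<longlonglongrightarrow> \<Phi> s *v h"
    using quotient_tendsto(1)[OF s, of h] unfolding eq .
  ultimately show "\<Phi> s *v h = h + (\<integral>r. A r *v (\<Phi> r *v h) \<partial>lborel_upto s)"
    by (rule LIMSEQ_unique[rotated])
qed

lemma flow_lip_nonneg: "s \<in> {0..T} \<Longrightarrow> 0 \<le> flow_lip"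
  using flow_lip_pos by (rule less_imp_le)

lemma norm_A_\<Phi>_le: "s \<in> {0..T} \<Longrightarrow> norm (A s *v (\<Phi> s *v h)) \<le> K * flow_lip * norm h"
  using mult_left_mono[OF norm_\<Phi>_le[of s h] K] u_jacobian[of s "x s" "\<Phi> s *v h"]
  by (simp add: mult.assoc)

lemma \<Phi>_increment:
  assumes ab: "0 \<le> a" "a \<le> b" "b \<le> T"
  shows "\<Phi> b *v h - \<Phi> a *v h = (\<integral>r. A r *v (\<Phi> r *v h) \<partial>lborel_upto b) - (\<integral>r. A r *v (\<Phi> r *v h) \<partial>lborel_upto a)"
  using variational_equation(2)[of a h] variational_equation(2)[of b h] ab by simp

lemma \<Phi>_increment_le:
  assumes ab: "0 \<le> a" "a \<le> b" "b \<le> T"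
  shows "norm (\<Phi> b *v h - \<Phi> a *v h) \<le> K * flow_lip * norm h * (b - a)"
  unfolding \<Phi>_increment[OF ab]
proof (rule norm_integral_segment_le[OF A_\<Phi>_measurable[OF ab(3)]])
  show "norm (A r *v (\<Phi> r *v h)) \<le> K * flow_lip * norm h" if "r \<in> {a..b}" for r
    using that ab by (intro norm_A_\<Phi>_le) auto
  show "integrable (lborel_upto b) (\<lambda>r. A r *v (\<Phi> r *v h))"
    using ab by (intro variational_equation) auto
qed (use ab in auto)

lemma \<Phi>_continuous: "continuous_on {0..T} \<Phi>"
proof -
  let ?c = "real CARD('n) * real CARD('n)"
  show ?thesis
  proof (rule continuous_on_of_lipschitz)
    fix a b assume "a \<in> {0..T}" "b \<in> {0..T}" "a \<le> b"
    then have ab: "0 \<le> a" "a \<le> b" "b \<le> T" by auto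
    have "spectral_norm (\<Phi> b - \<Phi> a) \<le> K * flow_lip * (b - a)"
      unfolding spectral_norm_def
    proof (rule onorm_le)
      fix h
      show "norm ((\<Phi> b - \<Phi> a) *v h) \<le> K * flow_lip * (b - a) * norm h"
        using \<Phi>_increment_le[OF ab, of h] by (simp add: matrix_vector_mult_diff_rdistrib mult_ac)
    qed
    then have "norm (\<Phi> b - \<Phi> a) \<le> ?c * (K * flow_lip * (b - a))"
      by (intro order_trans[OF norm_le_spectral_norm] mult_left_mono) auto
    also have "\<dots> = ?c * K * flow_lip * (b - a)" by simp
    also have "\<dots> \<le> ?c * K * \<bar>flow_lip\<bar> * (b - a)"
      using ab K by (intro mult_right_mono mult_left_mono) auto
    finally show "norm (\<Phi> b - \<Phi> a) \<le> ?c * K * \<bar>flow_lip\<bar> * (b - a)" .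
  qed (use K in auto)
qed

lemma \<Phi>_\<Psi>:
  assumes "s \<in> {0..T}"
  shows "\<Phi> s ** \<Psi> s = mat 1" "\<Psi> s ** \<Phi> s = mat 1"
proof -
  have "\<exists>inverse_bound. \<Phi> s ** inverse_bound = mat 1 \<and> inverse_bound ** \<Phi> s = mat 1"
    using F_invertible[OF assms] unfolding invertible_def .
  then show "\<Phi> s ** \<Psi> s = mat 1" "\<Psi> s ** \<Phi> s = mat 1"
    unfolding matrix_inv_def by (rule someI2_ex; simp)+
qed

text \<open>The inverses are bounded uniformly in time because \<open>\<bar>\<Phi> s h\<bar>\<close> is continuous and positive on the
  compact set \<open>[0, T] \<times> sphere\<close>.\<close>

lemma \<Psi>_bounded: "\<exists>b>0. \<forall>s\<in>{0..T}. \<forall>v. norm (\<Psi> s *v v) \<le> b * norm v"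
proof (cases "0 \<le> T")
  case T: True
  let ?S = "{0..T} \<times> sphere (0 :: real ^ 'n) 1"
  let ?f = "\<lambda>z. norm (\<Phi> (fst z) *v snd z)"
  have "continuous_on ?S ?f"
    by (intro continuous_on_norm bounded_bilinear.continuous_on[OF bounded_bilinear_matrix_vector_mult]
        continuous_on_compose2[OF \<Phi>_continuous] continuous_intros) auto
  moreover have "compact ?S" by (intro compact_Times) auto
  moreover have "?S \<noteq> {}" using T by auto
  ultimately obtain z where z: "z \<in> ?S" "\<And>w. w \<in> ?S \<Longrightarrow> ?f z \<le> ?f w"
    using continuous_attains_inf[of ?S ?f] by blast
  define m where "m = ?f z"
  have fz: "fst z \<in> {0..T}" "norm (snd z) = 1" using z(1) by auto
  have "m > 0"
  proof (rule ccontr)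
    assume "\<not> 0 < m"
    then have "\<Phi> (fst z) *v snd z = 0" by (simp add: m_def)
    then have "(\<Psi> (fst z) ** \<Phi> (fst z)) *v snd z = 0"
      by (simp add: matrix_vector_mul_assoc[symmetric])
    then have "snd z = 0" using \<Phi>_\<Psi>(2)[OF fz(1)] by simp
    then show False using fz(2) by simp
  qed
  have lower: "m * norm h \<le> norm (\<Phi> s *v h)" if s: "s \<in> {0..T}" for s h
  proof (cases "h = 0")
    case False
    have "m \<le> norm (\<Phi> s *v (h /\<^sub>R norm h))"
      using z(2)[of "(s, h /\<^sub>R norm h)"] s False by (simp add: m_def)
    also have "\<dots> = norm (\<Phi> s *v h) / norm h"
      by (simp add: matrix_vector_mult_scaleR divide_inverse_commute)
    finally show ?thesis using False by (simp add: le_divide_eq)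
  qed simp
  have "norm (\<Psi> s *v v) \<le> (1 / m) * norm v" if s: "s \<in> {0..T}" for s v
  proof -
    have "\<Phi> s *v (\<Psi> s *v v) = v"
      using \<Phi>_\<Psi>(1)[OF s] by (simp add: matrix_vector_mul_assoc)
    then show ?thesis using lower[OF s, of "\<Psi> s *v v"] \<open>m > 0\<close> by (simp add: le_divide_eq mult.commute)
  qed
  then show ?thesis using \<open>m > 0\<close> by (intro exI[of _ "1 / m"]) auto
qed (auto intro: exI[of _ 1])

definition inverse_bound :: real where "inverse_bound = (SOME b. b > 0 \<and> (\<forall>s\<in>{0..T}. \<forall>v. norm (\<Psi> s *v v) \<le> b * norm v))"

lemma inverse_bound: "0 < inverse_bound" "s \<in> {0..T} \<Longrightarrow> norm (\<Psi> s *v v) \<le> inverse_bound * norm v"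
  using someI_ex[OF \<Psi>_bounded] unfolding inverse_bound_def[symmetric] by auto

text \<open>The costate measures the displacement in direction \<open>p\<close> at time \<open>t\<close> that an infinitesimal
  displacement of the flow at time \<open>s\<close> produces.\<close>

definition costate :: "real \<Rightarrow> real ^ 'n \<Rightarrow> real \<Rightarrow> real ^ 'n" where
  "costate t p s = (p v* \<Phi> t) v* \<Psi> s"

lemma inner_costate: "costate t p s \<bullet> h = p \<bullet> (\<Phi> t *v (\<Psi> s *v h))"
  by (simp add: costate_def dot_lmul_matrix)

lemma norm_le_of_inner_le:
  fixes a :: "real ^ 'n"
  assumes "\<And>h. a \<bullet> h \<le> c * norm h" and "0 \<le> c"
  shows "norm a \<le> c"
proof (cases "a = 0")
  case False
  have "norm a * norm a \<le> c * norm a" using assms(1)[of a] by (simp add: norm_eq_sqrt_inner)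
  then show ?thesis using False by (simp add: mult_le_cancel_right)
qed (simp add: assms)

definition costate_bound :: real where "costate_bound = flow_lip * inverse_bound"

lemma costate_bound_nonneg: "t \<in> {0..T} \<Longrightarrow> 0 \<le> costate_bound"
  using flow_lip_nonneg inverse_bound(1) unfolding costate_bound_def by (intro mult_nonneg_nonneg) auto

lemma norm_costate_le:
  assumes t: "t \<in> {0..T}" and s: "s \<in> {0..T}"
  shows "norm (costate t p s) \<le> costate_bound * norm p"
proof (rule norm_le_of_inner_le)
  fix h
  have "costate t p s \<bullet> h \<le> norm p * norm (\<Phi> t *v (\<Psi> s *v h))"
    unfolding inner_costate by (rule norm_cauchy_schwarz)
  also have "\<dots> \<le> norm p * (flow_lip * (inverse_bound * norm h))"
    using inverse_bound(2)[OF s, of h] flow_lip_nonneg[OF t]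
    by (intro mult_left_mono order_trans[OF norm_\<Phi>_le[OF t]]) auto
  finally show "costate t p s \<bullet> h \<le> costate_bound * norm p * norm h" by (simp add: costate_bound_def mult_ac)
qed (use costate_bound_nonneg[OF t] in simp)

lemma costate_final:
  assumes t: "t \<in> {0..T}"
  shows "costate t p t = p"
proof -
  have "costate t p t \<bullet> h = p \<bullet> h" for h
    by (simp add: inner_costate matrix_vector_mul_assoc \<Phi>_\<Psi>[OF t])
  then show ?thesis using vector_eq_rdot[of "costate t p t" p] by simp
qed

lemma costate_increment:
  assumes t: "t \<in> {0..T}" and ab: "0 \<le> a" "a \<le> b" "b \<le> T"
  shows "(costate t p b - costate t p a) \<bullet> h = - (costate t p b \<bullet> (\<Phi> b *v (\<Psi> a *v h) - \<Phi> a *v (\<Psi> a *v h)))"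
proof -
  have "\<Phi> a *v (\<Psi> a *v h) = h" and "\<Psi> b *v (\<Phi> b *v (\<Psi> a *v h)) = \<Psi> a *v h"
    using \<Phi>_\<Psi>(1)[of a] \<Phi>_\<Psi>(2)[of b] ab by (auto simp: matrix_vector_mul_assoc matrix_mul_assoc)
  then show ?thesis
    by (simp add: inner_costate inner_diff_left inner_diff_right)
qed

lemma costate_lipschitz:
  assumes t: "t \<in> {0..T}" and ab: "0 \<le> a" "a \<le> b" "b \<le> T"
  shows "norm (costate t p b - costate t p a) \<le> costate_bound * norm p * (K * flow_lip * inverse_bound) * (b - a)"
proof (rule norm_le_of_inner_le)
  have a: "a \<in> {0..T}" and b: "b \<in> {0..T}" using ab by auto
  note nn = costate_bound_nonneg[OF t] flow_lip_nonneg[OF t] inverse_bound(1) K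
  fix h
  have "(costate t p b - costate t p a) \<bullet> h
      \<le> norm (costate t p b) * norm (\<Phi> b *v (\<Psi> a *v h) - \<Phi> a *v (\<Psi> a *v h))"
    unfolding costate_increment[OF t ab]     using Cauchy_Schwarz_ineq2[of "costate t p b" "\<Phi> b *v (\<Psi> a *v h) - \<Phi> a *v (\<Psi> a *v h)"]
    by linarith
  also have "\<dots> \<le> (costate_bound * norm p) * (K * flow_lip * (inverse_bound * norm h) * (b - a))"
  proof (intro mult_mono norm_costate_le t b)
    have "norm (\<Phi> b *v (\<Psi> a *v h) - \<Phi> a *v (\<Psi> a *v h)) \<le> K * flow_lip * norm (\<Psi> a *v h) * (b - a)"
      by (rule \<Phi>_increment_le[OF ab])
    also have "\<dots> \<le> K * flow_lip * (inverse_bound * norm h) * (b - a)"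
      using nn ab by (intro mult_right_mono mult_left_mono inverse_bound(2)[OF a]) auto
    finally show "norm (\<Phi> b *v (\<Psi> a *v h) - \<Phi> a *v (\<Psi> a *v h)) \<le> K * flow_lip * (inverse_bound * norm h) * (b - a)" .
  qed (use nn in auto)
  finally show "(costate t p b - costate t p a) \<bullet> h \<le> costate_bound * norm p * (K * flow_lip * inverse_bound) * (b - a) * norm h"
    by (simp add: mult_ac)
qed (use costate_bound_nonneg[OF t] flow_lip_nonneg[OF t] inverse_bound(1) K ab in auto)

lemma costate_continuous:
  assumes t: "t \<in> {0..T}"
  shows "continuous_on {0..T} (costate t p)"
  by (rule continuous_on_of_lipschitz[where L = "costate_bound * norm p * (K * flow_lip * inverse_bound)"])
     (use costate_lipschitz[OF t] costate_bound_nonneg[OF t] flow_lip_nonneg[OF t] inverse_bound(1) K in auto)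

lemma costate_measurable: "t \<in> {0..T} \<Longrightarrow> costate t p \<in> borel_measurable (lborel_upto t)"
  unfolding measurable_lborel_upto_cong
  by (rule borel_measurable_continuous_on_restrict, rule continuous_on_subset[OF costate_continuous]) auto

lemma costate_A_measurable:
  assumes t: "t \<in> {0..T}"
  shows "(\<lambda>r. costate t p r v* A r) \<in> borel_measurable (lborel_upto t)"
proof (rule borel_measurable_continuous_Pair[OF costate_measurable[OF t] A_measurable])
  show "continuous_on UNIV (\<lambda>x :: (real ^ 'n) \<times> (real ^ 'n ^ 'n). fst x v* snd x)"
    by (rule bounded_bilinear.continuous_on[OF bounded_bilinear_vector_matrix_mult]) (intro continuous_intros)+
qed (use t in auto)

lemma norm_costate_A_le:
  assumes t: "t \<in> {0..T}" and r: "r \<in> {0..T}"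
  shows "norm (costate t p r v* A r) \<le> K * costate_bound * norm p"
proof (rule norm_le_of_inner_le)
  fix h
  have "(costate t p r v* A r) \<bullet> h \<le> norm (costate t p r) * norm (A r *v h)"
    unfolding dot_lmul_matrix by (rule norm_cauchy_schwarz)
  also have "\<dots> \<le> (costate_bound * norm p) * (K * norm h)"
    using costate_bound_nonneg[OF t] by (intro mult_mono norm_costate_le u_jacobian t r) auto
  finally show "(costate t p r v* A r) \<bullet> h \<le> K * costate_bound * norm p * norm h" by (simp add: mult_ac)
qed (use costate_bound_nonneg[OF t] K in simp)

lemma costate_A_integrable:
  "t \<in> {0..T} \<Longrightarrow> s \<in> {0..t} \<Longrightarrow> integrable (lborel_upto t) (\<lambda>r. costate t p r v* A r)"
  by (rule integrable_bounded_lborel_upto[OF costate_A_measurable norm_costate_A_le]) auto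

text \<open>The adjoint of the variational equation. Over a short interval the change of the costate and that of
  \<open>\<integral>\<^sub>0\<^sup>s A\<^sup>T \<pi>\<close> cancel up to an error quadratic in the length, so the sum of the two is constant.\<close>

lemma costate_equation:
  assumes t: "t \<in> {0..T}" and s: "s \<in> {0..t}"
  shows "costate t p s = p + (\<integral>r. indicator {s..t} r *\<^sub>R (costate t p r v* A r) \<partial>lborel_upto t)"
proof -
  let ?a = "\<lambda>r. costate t p r v* A r"
  note nn = costate_bound_nonneg[OF t] flow_lip_nonneg[OF t] inverse_bound(1) K
  have ia: "integrable (lborel_upto b) ?a" if "b \<le> t" for b
  proof -
    have "set_integrable lborel {0..t} ?a"
      using costate_A_integrable[OF t, of t p] t by (simp add: integrable_lborel_upto)
    then show ?thesis
      unfolding integrable_lborel_upto by (rule set_integrable_subset) (use that in auto)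
  qed
  let ?I = "\<lambda>b. \<integral>r. ?a r \<partial>lborel_upto b"
  have const: "(costate t p s + ?I s) \<bullet> h = (costate t p t + ?I t) \<bullet> h" for h
  proof (rule constant_of_quadratic_increment[where t = t and a = s and b = t and
        g = "\<lambda>s. (costate t p s + (\<integral>r. costate t p r v* A r \<partial>lborel_upto s)) \<bullet> h" and
        C = "2 * (costate_bound * norm p * (K * flow_lip * inverse_bound)) * (K * norm h)"])
    fix a b assume "a \<in> {0..t}" "b \<in> {0..t}" "a \<le> b"
    then have ab: "0 \<le> a" "a \<le> b" "b \<le> T" "b \<le> t" "a \<le> t" and a: "a \<in> {0..T}" using t by auto
    let ?h = "\<Psi> a *v h"
    let ?f = "\<lambda>r. ?a r \<bullet> h - costate t p b \<bullet> (A r *v (\<Phi> r *v ?h))"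
    have v: "integrable (lborel_upto c) (\<lambda>r. A r *v (\<Phi> r *v ?h))" if "c \<in> {0..T}" for c
      by (rule variational_equation(1)[OF that])
    have fi: "integrable (lborel_upto c) ?f" "(\<integral>r. ?f r \<partial>lborel_upto c)
        = ?I c \<bullet> h - costate t p b \<bullet> (\<integral>r. A r *v (\<Phi> r *v ?h) \<partial>lborel_upto c)" if "c \<in> {a, b}" for c
    proof -
      have c: "c \<in> {0..T}" "c \<le> t" using that ab by auto
      show "integrable (lborel_upto c) ?f"
        by (intro Bochner_Integration.integrable_diff integrable_inner_left integrable_inner_right ia v c)
      show "(\<integral>r. ?f r \<partial>lborel_upto c)
        = ?I c \<bullet> h - costate t p b \<bullet> (\<integral>r. A r *v (\<Phi> r *v ?h) \<partial>lborel_upto c)"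
        using ia[OF c(2)] v[OF c(1)]
        by (subst Bochner_Integration.integral_diff)
           (auto intro: integrable_inner_left integrable_inner_right)
    qed
    have "(costate t p b + ?I b) \<bullet> h - (costate t p a + ?I a) \<bullet> h
        = (costate t p b - costate t p a) \<bullet> h + (?I b - ?I a) \<bullet> h"
      by (simp add: inner_add_left inner_diff_left)
    also have "\<dots> = (\<integral>r. ?f r \<partial>lborel_upto b) - (\<integral>r. ?f r \<partial>lborel_upto a)"
      unfolding costate_increment[OF t ab(1-3)] \<Phi>_increment[OF ab(1-3)] using fi(2)
      by (simp add: inner_diff_left inner_diff_right)
    finally have eq: "(costate t p b + ?I b) \<bullet> h - (costate t p a + ?I a) \<bullet> h
        = (\<integral>r. ?f r \<partial>lborel_upto b) - (\<integral>r. ?f r \<partial>lborel_upto a)" .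
    have "norm ((\<integral>r. ?f r \<partial>lborel_upto b) - (\<integral>r. ?f r \<partial>lborel_upto a))
        \<le> (2 * (costate_bound * norm p * (K * flow_lip * inverse_bound)) * (K * norm h) * (b - a)) * (b - a)"
    proof (rule norm_integral_segment_le[OF _ _ fi(1)])
      show "?f \<in> borel_measurable (lborel_upto b)"
        by (rule borel_measurable_integrable[OF fi(1)]) simp
      fix r assume "r \<in> {a..b}"
      then have r: "0 \<le> r" "a \<le> r" "r \<le> b" "r \<le> T" "r \<in> {0..T}" "b \<in> {0..T}" using ab by auto
      have "?f r = - ((costate t p b - costate t p r) \<bullet> (A r *v h))
          - costate t p b \<bullet> (A r *v (\<Phi> r *v ?h - \<Phi> a *v ?h))"
        using \<Phi>_\<Psi>(1)[OF a]
        by (simp add: dot_lmul_matrix inner_diff_left inner_diff_right matrix_vector_mul_assoc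
            matrix_vector_mult_diff_distrib)
      then have "norm (?f r) \<le> \<bar>(costate t p b - costate t p r) \<bullet> (A r *v h)\<bar>
          + \<bar>costate t p b \<bullet> (A r *v (\<Phi> r *v ?h - \<Phi> a *v ?h))\<bar>"
        by (simp only: real_norm_def)
      also have "\<dots> \<le> norm (costate t p b - costate t p r) * norm (A r *v h)
          + norm (costate t p b) * norm (A r *v (\<Phi> r *v ?h - \<Phi> a *v ?h))"
        by (intro add_mono Cauchy_Schwarz_ineq2)
      also have "\<dots> \<le> (costate_bound * norm p * (K * flow_lip * inverse_bound) * (b - a)) * (K * norm h)
          + (costate_bound * norm p) * (K * (K * flow_lip * (inverse_bound * norm h) * (b - a)))"
      proof (intro add_mono mult_mono norm_costate_le t r u_jacobian)
        show "norm (costate t p b - costate t p r) \<le> costate_bound * norm p * (K * flow_lip * inverse_bound) * (b - a)"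
          using r nn by (intro order_trans[OF costate_lipschitz[OF t r(1,3) ab(3)]] mult_left_mono) auto
        have "norm (\<Phi> r *v ?h - \<Phi> a *v ?h) \<le> K * flow_lip * norm ?h * (r - a)"
          by (rule \<Phi>_increment_le[OF ab(1) r(2,4)])
        also have "\<dots> \<le> K * flow_lip * (inverse_bound * norm h) * (b - a)"
          using nn r ab by (intro mult_mono inverse_bound(2)[OF a] mult_left_mono) auto
        finally show "norm (A r *v (\<Phi> r *v ?h - \<Phi> a *v ?h)) \<le> K * (K * flow_lip * (inverse_bound * norm h) * (b - a))"
          by (intro order_trans[OF u_jacobian[OF r(5)]] mult_left_mono K)
      qed (use nn ab in auto)
      also have "\<dots> = 2 * (costate_bound * norm p * (K * flow_lip * inverse_bound)) * (K * norm h) * (b - a)"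
        by (simp add: algebra_simps)
      finally show "norm (?f r) \<le> 2 * (costate_bound * norm p * (K * flow_lip * inverse_bound)) * (K * norm h) * (b - a)" .
    qed (use ab in auto)
    then show "\<bar>(costate t p b + ?I b) \<bullet> h - (costate t p a + ?I a) \<bullet> h\<bar>
        \<le> 2 * (costate_bound * norm p * (K * flow_lip * inverse_bound)) * (K * norm h) * (b - a)\<^sup>2"
      unfolding eq by (simp add: power2_eq_square mult.assoc)
  qed (use s t in auto)
  have "costate t p s + ?I s = costate t p t + ?I t"
    by (rule vector_eq_rdot[THEN iffD1]) (use const in blast)
  then have "costate t p s = p + (?I t - ?I s)"
    by (simp add: costate_final[OF t] algebra_simps)
  then show ?thesis
    using integral_final_segment[OF ia, of t s] s by simp
qed

end

section \<open>The deviation from the flow\<close>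

text \<open>The constants \<open>S\<close> and \<open>L\<close> bound \<open>\<sigma>\<close> and its Lipschitz quotients in the Frobenius norm, which is
  equivalent to the spectral norm; \<open>t\<close> is the time at which the variance is taken.\<close>

locale small_noise =
  wiener M T W + linearised_flow T K C K_L u F x0
  for M :: "'a measure" and T :: real and W :: "real \<Rightarrow> 'a \<Rightarrow> real ^ 'm"
    and K C K_L :: real and u :: "real ^ 'n \<Rightarrow> real \<Rightarrow> real ^ 'n"
    and F :: "real \<Rightarrow> real ^ 'n \<Rightarrow> real ^ 'n" and x0 :: "real ^ 'n" +
  fixes \<sigma> :: "real ^ 'n \<Rightarrow> real \<Rightarrow> real ^ 'm ^ 'n" and S L :: real
    and y :: "real \<Rightarrow> real \<Rightarrow> 'a \<Rightarrow> real ^ 'n" and t :: real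
  assumes \<sigma>_measurable: "\<And>z i j. (\<lambda>s. \<sigma> z s $ i $ j) \<in> borel_measurable (restrict_space borel {0..T})"
    and \<sigma>_bound: "\<And>s z. s \<in> {0..T} \<Longrightarrow> norm (\<sigma> z s) \<le> S"
    and L: "0 \<le> L"
    and \<sigma>_lipschitz: "\<And>s z w. s \<in> {0..T} \<Longrightarrow> norm (\<sigma> z s - \<sigma> w s) \<le> L * norm (z - w)"
    and solution: "\<And>\<epsilon>. 0 < \<epsilon> \<Longrightarrow> strong_solution M W T u (\<lambda>z s. \<epsilon> *\<^sub>R \<sigma> z s) x0 (y \<epsilon>)"
    and t: "t \<in> {0..T}"
begin

abbreviation P :: "(real \<times> 'a) measure" where "P \<equiv> lborel_upto t \<Otimes>\<^sub>M M"

lemma t0: "0 \<le> t" and tT: "t \<le> T" using t by auto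

lemma S_nonneg: "0 \<le> S"
  by (rule order_trans[OF norm_ge_zero \<sigma>_bound[OF t]])

lemma finite_P: "finite_measure P"
  by (rule finite_measure_lborel_upto_pair)

lemma pair_sigma_finite_P: "pair_sigma_finite (lborel_upto t) M"
  by (intro pair_sigma_finite.intro sigma_finite_lborel_upto sigma_finite_measure_axioms)

lemma space_P: "space P = {0..t} \<times> space M"
  by (simp add: space_pair_measure)

lemma fst_measurable_restrict: "fst \<in> P \<rightarrow>\<^sub>M restrict_space borel {0..T}"
  by (rule measurable_compose[OF measurable_fst lborel_upto_id_restrict[OF tT]])

lemma \<sigma>_along_measurable:
  assumes g: "g \<in> borel_measurable N" and s: "s \<in> N \<rightarrow>\<^sub>M restrict_space borel {0..T}"
  shows "(\<lambda>a. \<sigma> (g a) (s a)) \<in> borel_measurable N"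
proof -
  have "(\<lambda>z. \<sigma> (fst z) (snd z)) \<in> borel_measurable (borel \<Otimes>\<^sub>M restrict_space borel {0..T})"
  proof (rule caratheodory_measurable)
    show "(\<lambda>s. \<sigma> z s) \<in> borel_measurable (restrict_space borel {0..T})" for z
      by (rule borel_measurable_matrixI) (rule \<sigma>_measurable)
    fix s assume "s \<in> space (restrict_space borel {0..T})"
    then have "s \<in> {0..T}" by simp
    then have "L-lipschitz_on UNIV (\<lambda>z. \<sigma> z s)"
      using \<sigma>_lipschitz L by (auto intro!: lipschitz_onI simp: dist_norm)
    then show "continuous_on UNIV (\<lambda>z. \<sigma> z s)" by (rule lipschitz_on_continuous_on)
  qed
  from measurable_compose[OF measurable_Pair[OF g s] this] show ?thesis by simp
qed

subsection \<open>Paths\<close>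

text \<open>\<open>V\<close> is the scaled deviation. \<open>J\<close> is the scaled noise \<open>\<integral> \<sigma>(y) dW\<close>, written through the stochastic
  differential equation: in this form it has continuous paths for every sample point, whereas the Ito
  integral is determined only up to null sets at each time.\<close>

definition V :: "real \<Rightarrow> real \<Rightarrow> 'a \<Rightarrow> real ^ 'n" where
  "V \<epsilon> s \<omega> = (1 / \<epsilon>) *\<^sub>R (y \<epsilon> s \<omega> - x s)"

definition J :: "real \<Rightarrow> real \<Rightarrow> 'a \<Rightarrow> real ^ 'n" where
  "J \<epsilon> s \<omega> = (1 / \<epsilon>) *\<^sub>R (y \<epsilon> s \<omega> - x0 - (\<integral>r. u (y \<epsilon> r \<omega>) r \<partial>lborel_upto s))"

definition H :: "real \<Rightarrow> real \<times> 'a \<Rightarrow> real ^ 'm ^ 'n" where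
  "H \<epsilon> z = \<sigma> (y \<epsilon> (fst z) (snd z)) (fst z)"

definition gronwall_const :: real where "gronwall_const = K * exp (K * t)"

lemma gronwall_const_nonneg: "0 \<le> gronwall_const" unfolding gronwall_const_def using K by simp

context
  fixes \<epsilon> :: real
  assumes \<epsilon>: "0 < \<epsilon>"
begin

lemma y_measurable: "s \<in> {0..T} \<Longrightarrow> y \<epsilon> s \<in> borel_measurable M"
  using solution[OF \<epsilon>] unfolding strong_solution_def by (auto intro: measurable_of_past)

lemma y_continuous: "\<omega> \<in> space M \<Longrightarrow> continuous_on {0..T} (\<lambda>s. y \<epsilon> s \<omega>)"
  using solution[OF \<epsilon>] unfolding strong_solution_def by auto

lemma y_jointly_measurable: "(\<lambda>z. y \<epsilon> (fst z) (snd z)) \<in> borel_measurable P"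
  by (rule measurable_continuous_path[OF t0])
     (use tT in \<open>auto intro: y_measurable continuous_on_subset[OF y_continuous]\<close>)

lemma y_path_measurable: "\<omega> \<in> space M \<Longrightarrow> s \<le> T \<Longrightarrow> (\<lambda>r. y \<epsilon> r \<omega>) \<in> borel_measurable (lborel_upto s)"
  unfolding measurable_lborel_upto_cong
  by (rule borel_measurable_continuous_on_restrict, rule continuous_on_subset[OF y_continuous]) auto

lemma u_y_path_measurable:
  "\<omega> \<in> space M \<Longrightarrow> s \<le> T \<Longrightarrow> (\<lambda>r. u (y \<epsilon> r \<omega>) r) \<in> borel_measurable (lborel_upto s)"
  by (intro u_along_measurable y_path_measurable lborel_upto_id_restrict)

lemma u_y_path_bounded:
  assumes \<omega>: "\<omega> \<in> space M"
  shows "\<exists>c. \<forall>r\<in>{0..T}. norm (u (y \<epsilon> r \<omega>) r) \<le> c"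
proof -
  have "compact ((\<lambda>s. y \<epsilon> s \<omega>) ` {0..T})"
    by (rule compact_continuous_image[OF y_continuous[OF \<omega>] compact_Icc])
  then obtain c where c: "\<And>r. r \<in> {0..T} \<Longrightarrow> norm (y \<epsilon> r \<omega>) \<le> c"
    by (meson bounded_iff compact_imp_bounded imageI)
  have "norm (u (y \<epsilon> r \<omega>) r) \<le> \<bar>K_L\<bar> * (1 + c)" if r: "r \<in> {0..T}" for r
  proof -
    have "norm (u (y \<epsilon> r \<omega>) r) \<le> K_L * (1 + norm (y \<epsilon> r \<omega>))" by (rule u_growth[OF r])
    also have "\<dots> \<le> \<bar>K_L\<bar> * (1 + c)" using c[OF r] by (intro mult_mono) auto
    finally show ?thesis .
  qed
  then show ?thesis by blast
qed

lemma u_y_path_integrable: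
  assumes \<omega>: "\<omega> \<in> space M" and s: "s \<le> T"
  shows "integrable (lborel_upto s) (\<lambda>r. u (y \<epsilon> r \<omega>) r)"
proof -
  obtain c where c: "\<forall>r\<in>{0..T}. norm (u (y \<epsilon> r \<omega>) r) \<le> c"
    using u_y_path_bounded[OF \<omega>] by (rule exE)
  show ?thesis
    by (rule integrable_bounded_lborel_upto[OF u_y_path_measurable[OF \<omega> s], of c]) (use c s in auto)
qed

lemma J_measurable:
  assumes s: "s \<in> {0..T}"
  shows "J \<epsilon> s \<in> borel_measurable M"
proof -
  have "(\<lambda>z. y \<epsilon> (fst z) (snd z)) \<in> borel_measurable (lborel_upto s \<Otimes>\<^sub>M M)"
    by (rule measurable_continuous_path)
       (use s in \<open>auto intro: y_measurable continuous_on_subset[OF y_continuous]\<close>)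
  then have "(\<lambda>z. u (y \<epsilon> (fst z) (snd z)) (fst z)) \<in> borel_measurable (lborel_upto s \<Otimes>\<^sub>M M)"
    by (rule u_along_measurable)
       (use s in \<open>auto intro: measurable_compose[OF measurable_fst lborel_upto_id_restrict]\<close>)
  from measurable_compose[OF measurable_pair_swap' this]
  have "(\<lambda>(\<omega>, r). u (y \<epsilon> r \<omega>) r) \<in> borel_measurable (M \<Otimes>\<^sub>M lborel_upto s)"
    by (simp add: case_prod_unfold)
  then have "(\<lambda>\<omega>. \<integral>r. u (y \<epsilon> r \<omega>) r \<partial>lborel_upto s) \<in> borel_measurable M"
    by (rule sigma_finite_measure.borel_measurable_lebesgue_integral[OF sigma_finite_lborel_upto])
  then show ?thesis
    unfolding J_def using y_measurable[OF s] by auto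
qed

lemma integral_u_y_continuous:
  assumes \<omega>: "\<omega> \<in> space M"
  shows "continuous_on {0..T} (\<lambda>s. \<integral>r. u (y \<epsilon> r \<omega>) r \<partial>lborel_upto s)"
proof -
  note m = u_y_path_measurable[OF \<omega>] and i = u_y_path_integrable[OF \<omega>]
  obtain c where "\<forall>r\<in>{0..T}. norm (u (y \<epsilon> r \<omega>) r) \<le> c"
    using u_y_path_bounded[OF \<omega>] by (rule exE)
  then have c: "norm (u (y \<epsilon> r \<omega>) r) \<le> c" if "r \<in> {0..T}" for r
    using that by simp
  show ?thesis
  proof (rule continuous_on_of_lipschitz[where L = c])
    fix a b assume "a \<in> {0..T}" "b \<in> {0..T}" "a \<le> b"
    then show "norm ((\<integral>r. u (y \<epsilon> r \<omega>) r \<partial>lborel_upto b) - (\<integral>r. u (y \<epsilon> r \<omega>) r \<partial>lborel_upto a)) \<le> c * (b - a)"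
      by (intro norm_integral_segment_le m i c) auto
  next
    show "0 \<le> c" by (rule order_trans[OF norm_ge_zero c[OF t]])
  qed
qed

lemma J_continuous: "\<omega> \<in> space M \<Longrightarrow> continuous_on {0..T} (\<lambda>s. J \<epsilon> s \<omega>)"
  unfolding J_def by (intro continuous_intros y_continuous integral_u_y_continuous)

lemma V_continuous: "\<omega> \<in> space M \<Longrightarrow> continuous_on {0..T} (\<lambda>s. V \<epsilon> s \<omega>)"
  unfolding V_def by (intro continuous_intros y_continuous flow_continuous)

lemma V_measurable: "s \<in> {0..T} \<Longrightarrow> V \<epsilon> s \<in> borel_measurable M"
  unfolding V_def using y_measurable by auto

lemma J_jointly_measurable: "(\<lambda>z. J \<epsilon> (fst z) (snd z)) \<in> borel_measurable P"
  by (rule measurable_continuous_path[OF t0])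
     (use tT in \<open>auto intro: J_measurable continuous_on_subset[OF J_continuous]\<close>)

lemma V_jointly_measurable: "(\<lambda>z. V \<epsilon> (fst z) (snd z)) \<in> borel_measurable P"
  by (rule measurable_continuous_path[OF t0])
     (use tT in \<open>auto intro: V_measurable continuous_on_subset[OF V_continuous]\<close>)

lemma H_measurable: "H \<epsilon> \<in> borel_measurable P"
  unfolding H_def by (rule \<sigma>_along_measurable[OF y_jointly_measurable fst_measurable_restrict])

lemma norm_H_le: "z \<in> space P \<Longrightarrow> norm (H \<epsilon> z) \<le> S"
  unfolding H_def space_P using tT by (intro \<sigma>_bound) auto

text \<open>The scaled increment of the drift, so that \<open>V - J\<close> is the time integral of \<open>G\<close>.\<close>

definition G :: "'a \<Rightarrow> real \<Rightarrow> real ^ 'n" where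
  "G \<omega> r = (1 / \<epsilon>) *\<^sub>R (u (y \<epsilon> r \<omega>) r - u (x r) r)"

lemma norm_G_le: "r \<in> {0..T} \<Longrightarrow> norm (G \<omega> r) \<le> K * norm (V \<epsilon> r \<omega>)"
  using mult_left_mono[OF u_lipschitz[of r "y \<epsilon> r \<omega>" "x r"], of "1 / \<epsilon>"] \<epsilon>
  by (simp add: G_def V_def)

lemma G_path:
  assumes \<omega>: "\<omega> \<in> space M" and s: "s \<in> {0..T}"
  shows "G \<omega> \<in> borel_measurable (lborel_upto s)" "integrable (lborel_upto s) (G \<omega>)"
    "V \<epsilon> s \<omega> = J \<epsilon> s \<omega> + (\<integral>r. G \<omega> r \<partial>lborel_upto s)"
proof -
  have i: "integrable (lborel_upto s) (\<lambda>r. u (y \<epsilon> r \<omega>) r)"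
    by (rule u_y_path_integrable[OF \<omega>]) (use s in simp)
  show iG: "integrable (lborel_upto s) (G \<omega>)"
    unfolding G_def using i flow_eq(1)[OF s, of x0] by simp
  then show "G \<omega> \<in> borel_measurable (lborel_upto s)" by auto
  show "V \<epsilon> s \<omega> = J \<epsilon> s \<omega> + (\<integral>r. G \<omega> r \<partial>lborel_upto s)"
    unfolding V_def J_def G_def using i flow_eq[OF s, of x0]
    by (simp add: algebra_simps)
qed

lemma norm_V_le:
  assumes \<omega>: "\<omega> \<in> space M" and s: "s \<in> {0..t}"
  shows "norm (V \<epsilon> s \<omega>) \<le> norm (J \<epsilon> s \<omega>) + gronwall_const * (\<integral>r. norm (J \<epsilon> r \<omega>) \<partial>lborel_upto t)"
  unfolding gronwall_const_def
proof (rule gronwall[where f = "\<lambda>s. norm (V \<epsilon> s \<omega>)" and g = "\<lambda>s. norm (J \<epsilon> s \<omega>)", OF _ _ _ K _ s])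
  have sub: "{0..t} \<subseteq> {0..T}" using tT by auto
  show V: "continuous_on {0..t} (\<lambda>s. norm (V \<epsilon> s \<omega>))"
    by (intro continuous_on_norm continuous_on_subset[OF V_continuous[OF \<omega>] sub])
  show "continuous_on {0..t} (\<lambda>s. norm (J \<epsilon> s \<omega>))"
    by (intro continuous_on_norm continuous_on_subset[OF J_continuous[OF \<omega>] sub])
  fix s assume s: "s \<in> {0..t}"
  then have sT: "s \<in> {0..T}" using sub by auto
  have Vi: "integrable (lborel_upto s) (\<lambda>s. norm (V \<epsilon> s \<omega>))"
    by (rule integrable_lborel_upto_continuous, rule continuous_on_subset[OF V]) (use s in auto)
  have "norm (\<integral>r. G \<omega> r \<partial>lborel_upto s) \<le> (\<integral>r. K * norm (V \<epsilon> r \<omega>) \<partial>lborel_upto s)"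
    using G_path(2)[OF \<omega> sT] Vi sT
    by (intro Bochner_Integration.integral_norm_bound_integral norm_G_le) auto
  then show "norm (V \<epsilon> s \<omega>) \<le> norm (J \<epsilon> s \<omega>) + K * (\<integral>r. norm (V \<epsilon> r \<omega>) \<partial>lborel_upto s)"
    unfolding G_path(3)[OF \<omega> sT] by (intro order_trans[OF norm_triangle_ineq]) simp
qed simp

lemma J_ito:
  assumes s: "s \<in> {0..T}"
  obtains I where "has_ito_integral M past W s (\<lambda>r \<omega>. \<epsilon> *\<^sub>R \<sigma> (y \<epsilon> r \<omega>) r) I"
    and "AE \<omega> in M. J \<epsilon> s \<omega> = (1 / \<epsilon>) *\<^sub>R I \<omega>"
proof -
  obtain I where I: "has_ito_integral M past W s (\<lambda>r \<omega>. \<epsilon> *\<^sub>R \<sigma> (y \<epsilon> r \<omega>) r) I"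
    and eq: "AE \<omega> in M. y \<epsilon> s \<omega> = x0 + (LINT r:{0..s}|lborel. u (y \<epsilon> r \<omega>) r) + I \<omega>"
    using solution[OF \<epsilon>] s unfolding strong_solution_def by blast
  from eq have "AE \<omega> in M. J \<epsilon> s \<omega> = (1 / \<epsilon>) *\<^sub>R I \<omega>"
    by eventually_elim (simp add: J_def integral_lborel_upto)
  with I that show ?thesis by blast
qed

lemma J_sq_integrable:
  assumes s: "s \<in> {0..T}"
  shows "sq_integrable M (J \<epsilon> s)"
proof -
  obtain I where I: "has_ito_integral M past W s (\<lambda>r \<omega>. \<epsilon> *\<^sub>R \<sigma> (y \<epsilon> r \<omega>) r) I"
    and eq: "AE \<omega> in M. J \<epsilon> s \<omega> = (1 / \<epsilon>) *\<^sub>R I \<omega>"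
    using J_ito[OF s] by blast
  have "sq_integrable M I" using ito_sq_integrable[OF I _ I] s by simp
  moreover have "AE \<omega> in M. norm (J \<epsilon> s \<omega>) \<le> 1 / \<epsilon> * norm (I \<omega>)"
    using eq by eventually_elim (use \<epsilon> in simp)
  ultimately show ?thesis
    by (rule sq_integrable_bound[OF _ J_measurable[OF s]])
qed

lemma J_mean:
  assumes s: "s \<in> {0..T}"
  shows "(\<integral>\<omega>. p \<bullet> J \<epsilon> s \<omega> \<partial>M) = 0"
proof -
  obtain I where I: "has_ito_integral M past W s (\<lambda>r \<omega>. \<epsilon> *\<^sub>R \<sigma> (y \<epsilon> r \<omega>) r) I"
    and eq: "AE \<omega> in M. J \<epsilon> s \<omega> = (1 / \<epsilon>) *\<^sub>R I \<omega>"
    using J_ito[OF s] by blast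
  have Im: "I \<in> borel_measurable M" using ito_sq_integrable[OF I _ I] s by auto
  have "(\<integral>\<omega>. p \<bullet> J \<epsilon> s \<omega> \<partial>M) = (\<integral>\<omega>. (1 / \<epsilon>) * (p \<bullet> I \<omega>) \<partial>M)"
    by (rule integral_cong_AE) (use eq J_measurable[OF s] Im in auto)
  also have "\<dots> = 0" using ito_mean[OF I _ I] s by simp
  finally show ?thesis .
qed

end

text \<open>The constants \<open>\<epsilon>\<close> and \<open>\<delta>\<close> of the two diffusion coefficients cancel against the scaling of \<open>J\<close>.\<close>

lemma J_covariance:
  assumes \<epsilon>: "0 < \<epsilon>" and \<delta>: "0 < \<delta>" and s: "s \<in> {0..t}" and r: "r \<in> {0..t}"
  shows "(\<integral>\<omega>. (p \<bullet> J \<epsilon> s \<omega>) * (q \<bullet> J \<delta> r \<omega>) \<partial>M)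
    = (\<integral>z. indicator {0..min s r} (fst z) * ((p v* H \<epsilon> z) \<bullet> (q v* H \<delta> z)) \<partial>P)"
proof -
  have sT: "s \<in> {0..T}" and rT: "r \<in> {0..T}" using s r tT by auto
  obtain I where I: "has_ito_integral M past W s (\<lambda>r \<omega>. \<epsilon> *\<^sub>R \<sigma> (y \<epsilon> r \<omega>) r) I"
    and eqI: "AE \<omega> in M. J \<epsilon> s \<omega> = (1 / \<epsilon>) *\<^sub>R I \<omega>"
    using J_ito[OF \<epsilon> sT] by blast
  obtain I' where I': "has_ito_integral M past W r (\<lambda>r \<omega>. \<delta> *\<^sub>R \<sigma> (y \<delta> r \<omega>) r) I'"
    and eqI': "AE \<omega> in M. J \<delta> r \<omega> = (1 / \<delta>) *\<^sub>R I' \<omega>"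
    using J_ito[OF \<delta> rT] by blast
  have m: "I \<in> borel_measurable M" "I' \<in> borel_measurable M"
    using ito_sq_integrable[OF I _ I] ito_sq_integrable[OF I' _ I'] sT rT by auto
  let ?f = "\<lambda>z. (p v* H \<epsilon> z) \<bullet> (q v* H \<delta> z)"
  have int: "integrable (lborel_upto c \<Otimes>\<^sub>M M) ?f" if c: "c \<in> {0..t}" for c
  proof -
    have Hm: "H e \<in> borel_measurable (lborel_upto c \<Otimes>\<^sub>M M)" if "0 < e" for e
      unfolding H_def
      by (intro \<sigma>_along_measurable measurable_continuous_path measurable_compose[OF measurable_fst lborel_upto_id_restrict])
         (use c tT that in \<open>auto intro: y_measurable continuous_on_subset[OF y_continuous]\<close>)
    have Hsq: "sq_integrable (lborel_upto c \<Otimes>\<^sub>M M) (\<lambda>z. p v* H e z)" if "0 < e" for e p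
    proof (rule sq_integrable_bounded[OF finite_measure_lborel_upto_pair
            borel_measurable_vector_matrix_mult[OF Hm[OF that]], of _ "norm p * S"])
      fix z assume "z \<in> space (lborel_upto c \<Otimes>\<^sub>M M)"
      then have "z \<in> space P" using c by (auto simp: space_pair_measure)
      then show "norm (p v* H e z) \<le> norm p * S"
        by (intro order_trans[OF norm_vector_matrix_mult_le] mult_left_mono norm_H_le that) auto
    qed
    show ?thesis by (intro integrable_inner_of_sq_integrable Hsq \<epsilon> \<delta>)
  qed
  have "(\<integral>\<omega>. (p \<bullet> J \<epsilon> s \<omega>) * (q \<bullet> J \<delta> r \<omega>) \<partial>M)
      = (\<integral>\<omega>. (1 / (\<epsilon> * \<delta>)) * ((p \<bullet> I \<omega>) * (q \<bullet> I' \<omega>)) \<partial>M)"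
  proof (rule integral_cong_AE)
    show "AE \<omega> in M. (p \<bullet> J \<epsilon> s \<omega>) * (q \<bullet> J \<delta> r \<omega>) = (1 / (\<epsilon> * \<delta>)) * ((p \<bullet> I \<omega>) * (q \<bullet> I' \<omega>))"
      using eqI eqI' by eventually_elim simp
  qed (use m J_measurable[OF \<epsilon> sT] J_measurable[OF \<delta> rT] in auto)
  also have "\<dots> = (1 / (\<epsilon> * \<delta>)) * (\<integral>z. (p v* (\<epsilon> *\<^sub>R H \<epsilon> z)) \<bullet> (q v* (\<delta> *\<^sub>R H \<delta> z))
      \<partial>(lborel_upto (min s r) \<Otimes>\<^sub>M M))"
    using ito_isometry[OF I _ I', of p q] sT rT by (simp add: H_def)
  also have "\<dots> = (\<integral>z. ?f z \<partial>(lborel_upto (min s r) \<Otimes>\<^sub>M M))"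
    using \<epsilon> \<delta> by (simp add: vector_matrix_mult_scaleR)
  also have "\<dots> = (\<integral>z. indicator {0..min s r} (fst z) * ?f z \<partial>P)"
    by (rule integral_indicator_pair[OF sigma_finite_measure_axioms int int]) (use s r in auto)
  finally show ?thesis .
qed

subsection \<open>Mean square estimates\<close>

lemma measure_P: "measure P (space P) = t"
proof -
  interpret LM: pair_sigma_finite "lborel_upto t" M by (rule pair_sigma_finite_P)
  have "emeasure P (space P) = emeasure (lborel_upto t) {0..t} * emeasure M (space M)"
    unfolding space_P using emeasure_pair_measure_Times[of "{0..t}" "lborel_upto t" "space M"]
      sets.top[of "lborel_upto t"] by simp
  also have "emeasure (lborel_upto t) {0..t} = ennreal t"
    unfolding finite_measure.emeasure_eq_measure[OF finite_measure_lborel_upto] measure_lborel_upto[OF t0] ..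
  also have "emeasure M (space M) = 1" by (rule emeasure_space_1)
  finally have "emeasure P (space P) = ennreal t" by (simp only: mult_1_right)
  then show ?thesis unfolding measure_def by (simp only: enn2real_ennreal[OF t0])
qed

lemma integral_P_le:
  fixes f :: "real \<times> 'a \<Rightarrow> real"
  assumes f: "integrable P f" and c: "\<And>z. z \<in> space P \<Longrightarrow> f z \<le> c"
  shows "(\<integral>z. f z \<partial>P) \<le> c * t"
proof -
  have "(\<integral>z. f z \<partial>P) \<le> (\<integral>z. c \<partial>P)"
    by (rule integral_mono[OF f finite_measure.integrable_const[OF finite_P] c])
  then show ?thesis by (simp add: measure_P mult.commute)
qed

lemma sq_integrable_P:
  fixes f :: "real \<times> 'a \<Rightarrow> 'v::euclidean_space"
  assumes f: "f \<in> borel_measurable P"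
    and i: "\<And>s. s \<in> {0..t} \<Longrightarrow> sq_integrable M (\<lambda>\<omega>. f (s, \<omega>))"
    and c: "\<And>s. s \<in> {0..t} \<Longrightarrow> (\<integral>\<omega>. (norm (f (s, \<omega>)))\<^sup>2 \<partial>M) \<le> c"
  shows "sq_integrable P f" "(\<integral>z. (norm (f z))\<^sup>2 \<partial>P) \<le> c * t"
proof -
  interpret LM: pair_sigma_finite "lborel_upto t" M by (rule pair_sigma_finite_P)
  have c0: "0 \<le> c" by (rule order_trans[OF _ c[of t]]) (use t0 in auto)
  have "(\<lambda>z. ennreal ((norm (f z))\<^sup>2)) \<in> borel_measurable P" using f by measurable
  then have "(\<integral>\<^sup>+z. ennreal ((norm (f z))\<^sup>2) \<partial>P) = (\<integral>\<^sup>+s. \<integral>\<^sup>+\<omega>. ennreal ((norm (f (s, \<omega>)))\<^sup>2) \<partial>M \<partial>lborel_upto t)"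
    using nn_integral_fst[of "\<lambda>z. ennreal ((norm (f z))\<^sup>2)" "lborel_upto t"] by simp
  also have "\<dots> \<le> (\<integral>\<^sup>+s. ennreal c \<partial>lborel_upto t)"
  proof (rule nn_integral_mono)
    fix s assume "s \<in> space (lborel_upto t)"
    then have s: "s \<in> {0..t}" by simp
    have "(\<integral>\<^sup>+\<omega>. ennreal ((norm (f (s, \<omega>)))\<^sup>2) \<partial>M) = ennreal (\<integral>\<omega>. (norm (f (s, \<omega>)))\<^sup>2 \<partial>M)"
      by (rule nn_integral_eq_integral[OF sq_integrableD(2)[OF i[OF s]]]) simp
    also have "\<dots> \<le> ennreal c" using c[OF s] by (rule ennreal_leI)
    finally show "(\<integral>\<^sup>+\<omega>. ennreal ((norm (f (s, \<omega>)))\<^sup>2) \<partial>M) \<le> ennreal c" .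
  qed
  also have "\<dots> = ennreal (c * t)"
    using c0 t0 finite_measure.emeasure_eq_measure[OF finite_measure_lborel_upto, of t "{0..t}"]
    by (simp add: measure_lborel_upto[OF t0] ennreal_mult)
  finally have le: "(\<integral>\<^sup>+z. ennreal ((norm (f z))\<^sup>2) \<partial>P) \<le> ennreal (c * t)" .
  show sq: "sq_integrable P f"
    by (rule sq_integrable_nn[OF f]) (use le in \<open>auto intro: order.strict_trans1\<close>)
  have "(\<integral>\<^sup>+z. ennreal ((norm (f z))\<^sup>2) \<partial>P) = ennreal (\<integral>z. (norm (f z))\<^sup>2 \<partial>P)"
    by (rule nn_integral_eq_integral[OF sq_integrableD(2)[OF sq]]) simp
  with le show "(\<integral>z. (norm (f z))\<^sup>2 \<partial>P) \<le> c * t"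
    using c0 t0 by (simp add: ennreal_le_iff)
qed

text \<open>The Cauchy--Schwarz inequality in the time variable.\<close>

lemma time_integral:
  fixes f :: "real \<times> 'a \<Rightarrow> real"
  assumes f: "sq_integrable P f"
  defines "N \<equiv> \<lambda>\<omega>. \<integral>r. f (r, \<omega>) \<partial>lborel_upto t"
  shows "sq_integrable M N" "(\<integral>\<omega>. (N \<omega>)\<^sup>2 \<partial>M) \<le> t * (\<integral>z. (f z)\<^sup>2 \<partial>P)"
proof -
  interpret LM: pair_sigma_finite "lborel_upto t" M by (rule pair_sigma_finite_P)
  have fm: "f \<in> borel_measurable P" and f2: "integrable P (\<lambda>z. (f z)\<^sup>2)"
    using sq_integrableD[OF f] by auto
  have fs: "(\<lambda>z. f (snd z, fst z)) \<in> borel_measurable (M \<Otimes>\<^sub>M lborel_upto t)"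
    using measurable_compose[OF measurable_pair_swap' fm] by (simp add: case_prod_unfold)
  have Nm: "N \<in> borel_measurable M"
    unfolding N_def
    by (rule sigma_finite_measure.borel_measurable_lebesgue_integral[OF sigma_finite_lborel_upto])
       (use fs in \<open>simp add: case_prod_unfold\<close>)
  let ?I = "\<lambda>\<omega>. \<integral>r. (f (r, \<omega>))\<^sup>2 \<partial>lborel_upto t"
  have f2': "integrable P (case_prod (\<lambda>r \<omega>. (f (r, \<omega>))\<^sup>2))" using f2 by (simp add: case_prod_unfold)
  have I: "integrable M ?I" and I_eq: "(\<integral>\<omega>. ?I \<omega> \<partial>M) = (\<integral>z. (f z)\<^sup>2 \<partial>P)"
    using LM.integrable_snd[OF f2'] LM.integral_snd[OF f2'] by (simp_all add: case_prod_unfold)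
  have "AE \<omega> in M. integrable (lborel_upto t) (\<lambda>r. (f (r, \<omega>))\<^sup>2)"
    by (rule LM.AE_integrable_snd[OF f2'])
  then have le: "AE \<omega> in M. (N \<omega>)\<^sup>2 \<le> t * ?I \<omega>"
  proof (rule AE_mp, intro AE_I2 impI)
    fix \<omega> assume \<omega>: "\<omega> \<in> space M" and i: "integrable (lborel_upto t) (\<lambda>r. (f (r, \<omega>))\<^sup>2)"
    have "(\<lambda>r. f (r, \<omega>)) \<in> borel_measurable (lborel_upto t)"
      by (rule measurable_Pair2'[OF \<omega>, THEN measurable_compose, OF fm])
    then have sq: "sq_integrable (lborel_upto t) (\<lambda>r. f (r, \<omega>))"
      using i by (simp add: sq_integrable_def)
    have one: "sq_integrable (lborel_upto t) (\<lambda>_. 1 :: real)"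
      by (rule sq_integrable_bounded[OF finite_measure_lborel_upto, of _ _ 1]) auto
    have "\<bar>N \<omega>\<bar> \<le> sqrt (?I \<omega>) * sqrt t"
      using L2_Cauchy_Schwarz[OF sq one] measure_lborel_upto[OF t0] by (simp add: N_def)
    then have "\<bar>N \<omega>\<bar>\<^sup>2 \<le> (sqrt (?I \<omega>) * sqrt t)\<^sup>2" by (rule power_mono) simp
    then show "(N \<omega>)\<^sup>2 \<le> t * ?I \<omega>" using t0 by (simp add: power_mult_distrib mult.commute)
  qed
  have "integrable M (\<lambda>\<omega>. (N \<omega>)\<^sup>2)"
  proof (rule Bochner_Integration.integrable_bound[of M "\<lambda>\<omega>. t * ?I \<omega>"])
    show "integrable M (\<lambda>\<omega>. t * ?I \<omega>)" using I by simp
    show "(\<lambda>\<omega>. (N \<omega>)\<^sup>2) \<in> borel_measurable M" using Nm by measurable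
    show "AE \<omega> in M. norm ((N \<omega>)\<^sup>2) \<le> norm (t * ?I \<omega>)"
      using le by eventually_elim simp
  qed
  then show sq: "sq_integrable M N" using Nm by (simp add: sq_integrable_def)
  have "(\<integral>\<omega>. (N \<omega>)\<^sup>2 \<partial>M) \<le> (\<integral>\<omega>. t * ?I \<omega> \<partial>M)"
    by (rule integral_mono_AE[OF _ _ le]) (use sq_integrableD(2)[OF sq] I in auto)
  then show "(\<integral>\<omega>. (N \<omega>)\<^sup>2 \<partial>M) \<le> t * (\<integral>z. (f z)\<^sup>2 \<partial>P)"
    using I_eq by simp
qed

lemma snd_sq_integrable:
  fixes N :: "'a \<Rightarrow> real"
  assumes N: "sq_integrable M N"
  shows "sq_integrable P (\<lambda>z. N (snd z))" "(\<integral>z. (N (snd z))\<^sup>2 \<partial>P) = t * (\<integral>\<omega>. (N \<omega>)\<^sup>2 \<partial>M)"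
proof -
  have m: "N \<in> borel_measurable M" and i: "integrable M (\<lambda>\<omega>. (N \<omega>)\<^sup>2)" using sq_integrableD[OF N] by auto
  have one: "integrable (lborel_upto t) (\<lambda>_. 1 :: real)"
    by (rule finite_measure.integrable_const[OF finite_measure_lborel_upto])
  note pp = integrable_pair_product[OF sigma_finite_lborel_upto sigma_finite_measure_axioms one i]
    integral_pair_product[OF sigma_finite_lborel_upto sigma_finite_measure_axioms one i]
  show "sq_integrable P (\<lambda>z. N (snd z))"
    using pp(1) measurable_compose[OF measurable_snd m] by (simp add: sq_integrable_def)
  show "(\<integral>z. (N (snd z))\<^sup>2 \<partial>P) = t * (\<integral>\<omega>. (N \<omega>)\<^sup>2 \<partial>M)"
    using pp(2) measure_lborel_upto[OF t0] by simp
qed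

text \<open>The right-hand side of Gronwall's bound, as an operation on processes.\<close>

definition gronwall_majorant :: "(real \<times> 'a \<Rightarrow> real ^ 'n) \<Rightarrow> real \<times> 'a \<Rightarrow> real" where
  "gronwall_majorant D z = norm (D z) + gronwall_const * (\<integral>r. norm (D (r, snd z)) \<partial>lborel_upto t)"

lemma gronwall_majorant_nonneg: "0 \<le> gronwall_majorant D z"
  unfolding gronwall_majorant_def using gronwall_const_nonneg by (intro add_nonneg_nonneg mult_nonneg_nonneg) auto

definition majorant_const :: real where "majorant_const = 2 + 2 * gronwall_const\<^sup>2 * (t * t)"

lemma gronwall_majorant_L2:
  assumes D: "sq_integrable P D"
  shows "sq_integrable P (gronwall_majorant D)"
    "(\<integral>z. (gronwall_majorant D z)\<^sup>2 \<partial>P) \<le> majorant_const * (\<integral>z. (norm (D z))\<^sup>2 \<partial>P)"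
proof -
  let ?N = "\<lambda>\<omega>. \<integral>r. norm (D (r, \<omega>)) \<partial>lborel_upto t"
  have n: "sq_integrable P (\<lambda>z. norm (D z))"
    using D by (auto simp: sq_integrable_def)
  note N = time_integral[OF n] and NP = snd_sq_integrable[OF time_integral(1)[OF n]]
  show sq: "sq_integrable P (gronwall_majorant D)"
    unfolding gronwall_majorant_def
    using sq_integrable_add[OF n sq_integrable_scaleR[OF NP(1), of gronwall_const]] by simp
  have i1: "integrable P (\<lambda>z. (norm (D z))\<^sup>2)" and i2: "integrable P (\<lambda>z. (?N (snd z))\<^sup>2)"
    and i3: "integrable P (\<lambda>z. (gronwall_majorant D z)\<^sup>2)"
    using sq_integrableD(2)[OF D] sq_integrableD(2)[OF NP(1)] sq_integrableD(2)[OF sq] by auto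
  have "(\<integral>z. (gronwall_majorant D z)\<^sup>2 \<partial>P) \<le> (\<integral>z. 2 * (norm (D z))\<^sup>2 + 2 * gronwall_const\<^sup>2 * (?N (snd z))\<^sup>2 \<partial>P)"
  proof (rule integral_mono[OF i3])
    show "integrable P (\<lambda>z. 2 * (norm (D z))\<^sup>2 + 2 * gronwall_const\<^sup>2 * (?N (snd z))\<^sup>2)" using i1 i2 by simp
    show "(gronwall_majorant D z)\<^sup>2 \<le> 2 * (norm (D z))\<^sup>2 + 2 * gronwall_const\<^sup>2 * (?N (snd z))\<^sup>2" for z
      unfolding gronwall_majorant_def
      using sum_squares_2[of "norm (D z)" "gronwall_const * ?N (snd z)"] by (simp add: power_mult_distrib)
  qed
  also have "\<dots> = 2 * (\<integral>z. (norm (D z))\<^sup>2 \<partial>P) + 2 * gronwall_const\<^sup>2 * (t * (\<integral>\<omega>. (?N \<omega>)\<^sup>2 \<partial>M))"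
    using i1 i2 NP(2) by simp
  also have "\<dots> \<le> 2 * (\<integral>z. (norm (D z))\<^sup>2 \<partial>P) + 2 * gronwall_const\<^sup>2 * (t * (t * (\<integral>z. (norm (D z))\<^sup>2 \<partial>P)))"
    using N(2) t0 by (intro add_left_mono mult_left_mono) auto
  also have "\<dots> = majorant_const * (\<integral>z. (norm (D z))\<^sup>2 \<partial>P)" by (simp add: majorant_const_def algebra_simps)
  finally show "(\<integral>z. (gronwall_majorant D z)\<^sup>2 \<partial>P) \<le> majorant_const * (\<integral>z. (norm (D z))\<^sup>2 \<partial>P)" .
qed

text \<open>The processes as functions on the product of time and probability space.\<close>

definition JP :: "real \<Rightarrow> real \<times> 'a \<Rightarrow> real ^ 'n" where "JP \<epsilon> z = J \<epsilon> (fst z) (snd z)"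
definition VP :: "real \<Rightarrow> real \<times> 'a \<Rightarrow> real ^ 'n" where "VP \<epsilon> z = V \<epsilon> (fst z) (snd z)"

lemma norm_VP_le:
  assumes "0 < \<epsilon>" "z \<in> space P"
  shows "norm (VP \<epsilon> z) \<le> gronwall_majorant (JP \<epsilon>) z"
  using norm_V_le[OF assms(1), of "snd z" "fst z"] assms(2)
  by (auto simp: space_P VP_def JP_def gronwall_majorant_def)

lemma H_sq_integrable: "0 < \<epsilon> \<Longrightarrow> sq_integrable P (H \<epsilon>)"
  by (rule sq_integrable_bounded[OF finite_P H_measurable norm_H_le])

lemma vH_sq_integrable: "0 < \<epsilon> \<Longrightarrow> sq_integrable P (\<lambda>z. p v* H \<epsilon> z)"
  by (rule sq_integrable_bound[OF H_sq_integrable, of \<epsilon> _ "norm p"])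
     (auto intro: borel_measurable_vector_matrix_mult H_measurable norm_vector_matrix_mult_le)

lemma indicator_vH_integrable:
  assumes "0 < \<epsilon>" "0 < \<delta>"
  shows "integrable P (\<lambda>z. indicator {0..s} (fst z) * ((p v* H \<epsilon> z) \<bullet> (q v* H \<delta> z)))"
proof (rule Bochner_Integration.integrable_bound[OF integrable_inner_of_sq_integrable[OF
        vH_sq_integrable[OF assms(1), of p] vH_sq_integrable[OF assms(2), of q]]])
  have m: "(\<lambda>z. indicator {0..s} (fst z) :: real) \<in> borel_measurable P"
    by (rule measurable_compose[OF measurable_compose[OF measurable_fst measurable_lborel_upto_id]]) simp
  show "(\<lambda>z. indicator {0..s} (fst z) * ((p v* H \<epsilon> z) \<bullet> (q v* H \<delta> z))) \<in> borel_measurable P"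
    using sq_integrableD(1)[OF vH_sq_integrable[OF assms(1), of p]]
      sq_integrableD(1)[OF vH_sq_integrable[OF assms(2), of q]]
    by (intro borel_measurable_times m borel_measurable_inner)
qed (auto simp: indicator_def)

lemma J_second_moment:
  assumes \<epsilon>: "0 < \<epsilon>" and s: "s \<in> {0..t}"
  shows "(\<integral>\<omega>. (norm (J \<epsilon> s \<omega>))\<^sup>2 \<partial>M) \<le> real CARD('n) * (S\<^sup>2 * t)"
proof (rule expectation_norm_sq_le)
  have sT: "s \<in> {0..T}" using s tT by auto
  show "sq_integrable M (J \<epsilon> s)" by (rule J_sq_integrable[OF \<epsilon> sT])
  fix p :: "real ^ 'n" assume p: "norm p = 1"
  have "(\<integral>\<omega>. (p \<bullet> J \<epsilon> s \<omega>)\<^sup>2 \<partial>M) = (\<integral>z. indicator {0..s} (fst z) * ((p v* H \<epsilon> z) \<bullet> (p v* H \<epsilon> z)) \<partial>P)"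
    using J_covariance[OF \<epsilon> \<epsilon> s s, of p p] by (simp add: power2_eq_square)
  also have "\<dots> \<le> S\<^sup>2 * t"
  proof (rule integral_P_le[OF indicator_vH_integrable[OF \<epsilon> \<epsilon>]])
    fix z assume z: "z \<in> space P"
    have "norm (p v* H \<epsilon> z) \<le> S"
      using norm_vector_matrix_mult_le[of p "H \<epsilon> z"] norm_H_le[OF \<epsilon> z] p by simp
    then have "(norm (p v* H \<epsilon> z))\<^sup>2 \<le> S\<^sup>2" by (rule power_mono) simp
    then show "indicator {0..s} (fst z) * ((p v* H \<epsilon> z) \<bullet> (p v* H \<epsilon> z)) \<le> S\<^sup>2"
      by (auto simp: indicator_def power2_norm_eq_inner)
  qed
  finally show "(\<integral>\<omega>. (p \<bullet> J \<epsilon> s \<omega>)\<^sup>2 \<partial>M) \<le> S\<^sup>2 * t" .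
qed

text \<open>Expanding the square reduces this to the covariances, which recombine to the square of the
  difference of the integrands.\<close>

lemma J_difference_second_moment:
  assumes \<epsilon>: "0 < \<epsilon>" and \<delta>: "0 < \<delta>" and s: "s \<in> {0..t}"
  shows "(\<integral>\<omega>. (norm (J \<epsilon> s \<omega> - J \<delta> s \<omega>))\<^sup>2 \<partial>M) \<le> real CARD('n) * (\<integral>z. (norm (H \<epsilon> z - H \<delta> z))\<^sup>2 \<partial>P)"
proof (rule expectation_norm_sq_le)
  have sT: "s \<in> {0..T}" using s tT by auto
  note J\<epsilon> = J_sq_integrable[OF \<epsilon> sT] and J\<delta> = J_sq_integrable[OF \<delta> sT]
  show "sq_integrable M (\<lambda>\<omega>. J \<epsilon> s \<omega> - J \<delta> s \<omega>)" by (rule sq_integrable_diff[OF J\<epsilon> J\<delta>])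
  fix p :: "real ^ 'n" assume p: "norm p = 1"
  let ?a = "\<lambda>\<omega>. p \<bullet> J \<epsilon> s \<omega>" and ?b = "\<lambda>\<omega>. p \<bullet> J \<delta> s \<omega>"
  let ?i = "\<lambda>z. indicator {0..s} (fst z) :: real"
  let ?A = "\<lambda>z. p v* H \<epsilon> z" and ?inverse_bound = "\<lambda>z. p v* H \<delta> z"
  have i: "integrable M (\<lambda>\<omega>. ?a \<omega> * ?a \<omega>)" "integrable M (\<lambda>\<omega>. ?a \<omega> * ?b \<omega>)" "integrable M (\<lambda>\<omega>. ?b \<omega> * ?b \<omega>)"
    using integrable_inner_of_sq_integrable[OF sq_integrable_inner[OF J\<epsilon>, of p] sq_integrable_inner[OF J\<epsilon>, of p]]
      integrable_inner_of_sq_integrable[OF sq_integrable_inner[OF J\<epsilon>, of p] sq_integrable_inner[OF J\<delta>, of p]]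
      integrable_inner_of_sq_integrable[OF sq_integrable_inner[OF J\<delta>, of p] sq_integrable_inner[OF J\<delta>, of p]]
    by simp_all
  have iP: "integrable P (\<lambda>z. ?i z * (?A z \<bullet> ?A z))" "integrable P (\<lambda>z. ?i z * (?A z \<bullet> ?inverse_bound z))"
    "integrable P (\<lambda>z. ?i z * (?inverse_bound z \<bullet> ?inverse_bound z))"
    by (intro indicator_vH_integrable \<epsilon> \<delta>)+
  have "(\<integral>\<omega>. (p \<bullet> (J \<epsilon> s \<omega> - J \<delta> s \<omega>))\<^sup>2 \<partial>M) = (\<integral>\<omega>. ?a \<omega> * ?a \<omega> - 2 * (?a \<omega> * ?b \<omega>) + ?b \<omega> * ?b \<omega> \<partial>M)"
    by (simp add: inner_diff_right power2_eq_square algebra_simps)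
  also have "\<dots> = (\<integral>\<omega>. ?a \<omega> * ?a \<omega> \<partial>M) - 2 * (\<integral>\<omega>. ?a \<omega> * ?b \<omega> \<partial>M) + (\<integral>\<omega>. ?b \<omega> * ?b \<omega> \<partial>M)"
    using i by simp
  also have "\<dots> = (\<integral>z. ?i z * (?A z \<bullet> ?A z) \<partial>P) - 2 * (\<integral>z. ?i z * (?A z \<bullet> ?inverse_bound z) \<partial>P) + (\<integral>z. ?i z * (?inverse_bound z \<bullet> ?inverse_bound z) \<partial>P)"
    using J_covariance[OF \<epsilon> \<epsilon> s s, of p p] J_covariance[OF \<epsilon> \<delta> s s, of p p] J_covariance[OF \<delta> \<delta> s s, of p p]
    by simp
  also have "\<dots> = (\<integral>z. ?i z * (?A z \<bullet> ?A z) - 2 * (?i z * (?A z \<bullet> ?inverse_bound z)) + ?i z * (?inverse_bound z \<bullet> ?inverse_bound z) \<partial>P)"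
    using iP by simp
  also have "\<dots> \<le> (\<integral>z. (norm (H \<epsilon> z - H \<delta> z))\<^sup>2 \<partial>P)"
  proof (rule integral_mono)
    show "integrable P (\<lambda>z. ?i z * (?A z \<bullet> ?A z) - 2 * (?i z * (?A z \<bullet> ?inverse_bound z)) + ?i z * (?inverse_bound z \<bullet> ?inverse_bound z))"
      using iP by simp
    show "integrable P (\<lambda>z. (norm (H \<epsilon> z - H \<delta> z))\<^sup>2)"
      using sq_integrableD(2)[OF sq_integrable_diff[OF H_sq_integrable[OF \<epsilon>] H_sq_integrable[OF \<delta>]]] .
    fix z
    have "?i z * (?A z \<bullet> ?A z) - 2 * (?i z * (?A z \<bullet> ?inverse_bound z)) + ?i z * (?inverse_bound z \<bullet> ?inverse_bound z) = ?i z * (norm (?A z - ?inverse_bound z))\<^sup>2"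
      by (simp add: power2_norm_eq_inner inner_diff_left inner_diff_right inner_commute algebra_simps)
    also have "\<dots> \<le> (norm (?A z - ?inverse_bound z))\<^sup>2" by (auto simp: indicator_def)
    also have "\<dots> \<le> (norm (H \<epsilon> z - H \<delta> z))\<^sup>2"
      using norm_vector_matrix_mult_le[of p "H \<epsilon> z - H \<delta> z"] p
      by (intro power_mono) (simp_all add: vector_matrix_mult_diff)
    finally show "?i z * (?A z \<bullet> ?A z) - 2 * (?i z * (?A z \<bullet> ?inverse_bound z)) + ?i z * (?inverse_bound z \<bullet> ?inverse_bound z)
        \<le> (norm (H \<epsilon> z - H \<delta> z))\<^sup>2" .
  qed
  finally show "(\<integral>\<omega>. (p \<bullet> (J \<epsilon> s \<omega> - J \<delta> s \<omega>))\<^sup>2 \<partial>M) \<le> (\<integral>z. (norm (H \<epsilon> z - H \<delta> z))\<^sup>2 \<partial>P)" .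
qed

lemma JP_L2:
  assumes \<epsilon>: "0 < \<epsilon>"
  shows "sq_integrable P (JP \<epsilon>)" "(\<integral>z. (norm (JP \<epsilon> z))\<^sup>2 \<partial>P) \<le> real CARD('n) * (S\<^sup>2 * t) * t"
proof -
  have m: "JP \<epsilon> \<in> borel_measurable P" unfolding JP_def by (rule J_jointly_measurable[OF \<epsilon>])
  have sq: "sq_integrable M (\<lambda>\<omega>. JP \<epsilon> (s, \<omega>))" if "s \<in> {0..t}" for s
    using J_sq_integrable[OF \<epsilon>, of s] that tT by (simp add: JP_def)
  have c: "(\<integral>\<omega>. (norm (JP \<epsilon> (s, \<omega>)))\<^sup>2 \<partial>M) \<le> real CARD('n) * (S\<^sup>2 * t)" if "s \<in> {0..t}" for s
    using J_second_moment[OF \<epsilon> that] by (simp add: JP_def)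
  show "sq_integrable P (JP \<epsilon>)" "(\<integral>z. (norm (JP \<epsilon> z))\<^sup>2 \<partial>P) \<le> real CARD('n) * (S\<^sup>2 * t) * t"
    by (rule sq_integrable_P[OF m sq c]; assumption)+
qed

text \<open>A bound for the mean square of \<open>V\<close> that does not depend on \<open>\<epsilon>\<close>.\<close>

definition deviation_bound :: real where "deviation_bound = majorant_const * (real CARD('n) * (S\<^sup>2 * t) * t)"

lemma majorant_const_nonneg: "0 \<le> majorant_const"
  unfolding majorant_const_def using t0 by (intro add_nonneg_nonneg mult_nonneg_nonneg) auto

lemma deviation_bound_nonneg: "0 \<le> deviation_bound"
  unfolding deviation_bound_def using t0 majorant_const_nonneg by (intro mult_nonneg_nonneg) auto

lemma VP_L2:
  assumes \<epsilon>: "0 < \<epsilon>"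
  shows "sq_integrable P (VP \<epsilon>)" "(\<integral>z. (norm (VP \<epsilon> z))\<^sup>2 \<partial>P) \<le> deviation_bound"
proof -
  have m: "VP \<epsilon> \<in> borel_measurable P" unfolding VP_def by (rule V_jointly_measurable[OF \<epsilon>])
  note g = gronwall_majorant_L2[OF JP_L2(1)[OF \<epsilon>]]
  show sq: "sq_integrable P (VP \<epsilon>)"
    by (rule sq_integrable_bound[OF g(1) m, of 1])
       (use norm_VP_le[OF \<epsilon>] gronwall_majorant_nonneg in \<open>auto intro!: AE_I2\<close>)
  have "(\<integral>z. (norm (VP \<epsilon> z))\<^sup>2 \<partial>P) \<le> (\<integral>z. (gronwall_majorant (JP \<epsilon>) z)\<^sup>2 \<partial>P)"
    using sq_integrableD(2)[OF sq] sq_integrableD(2)[OF g(1)] norm_VP_le[OF \<epsilon>]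
    by (intro integral_mono power_mono) auto
  also have "\<dots> \<le> majorant_const * (\<integral>z. (norm (JP \<epsilon> z))\<^sup>2 \<partial>P)" by (rule g(2))
  also have "\<dots> \<le> deviation_bound"
    unfolding deviation_bound_def by (intro mult_left_mono JP_L2(2)[OF \<epsilon>] majorant_const_nonneg)
  finally show "(\<integral>z. (norm (VP \<epsilon> z))\<^sup>2 \<partial>P) \<le> deviation_bound" .
qed

text \<open>The Lipschitz bound on \<open>\<sigma>\<close> and \<open>y \<epsilon> - y \<delta> = \<epsilon> V - \<delta> V'\<close>, where both scaled deviations are bounded in
  mean square.\<close>

lemma H_difference:
  assumes \<epsilon>: "0 < \<epsilon>" and \<delta>: "0 < \<delta>"
  shows "(\<integral>z. (norm (H \<epsilon> z - H \<delta> z))\<^sup>2 \<partial>P) \<le> 2 * L\<^sup>2 * deviation_bound * (\<epsilon>\<^sup>2 + \<delta>\<^sup>2)"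
proof -
  note i = sq_integrableD(2)[OF VP_L2(1)[OF \<epsilon>]] sq_integrableD(2)[OF VP_L2(1)[OF \<delta>]]
  have "(\<integral>z. (norm (H \<epsilon> z - H \<delta> z))\<^sup>2 \<partial>P)
      \<le> (\<integral>z. L\<^sup>2 * (2 * \<epsilon>\<^sup>2 * (norm (VP \<epsilon> z))\<^sup>2 + 2 * \<delta>\<^sup>2 * (norm (VP \<delta> z))\<^sup>2) \<partial>P)"
  proof (rule integral_mono)
    show "integrable P (\<lambda>z. (norm (H \<epsilon> z - H \<delta> z))\<^sup>2)"
      using sq_integrableD(2)[OF sq_integrable_diff[OF H_sq_integrable[OF \<epsilon>] H_sq_integrable[OF \<delta>]]] .
    show "integrable P (\<lambda>z. L\<^sup>2 * (2 * \<epsilon>\<^sup>2 * (norm (VP \<epsilon> z))\<^sup>2 + 2 * \<delta>\<^sup>2 * (norm (VP \<delta> z))\<^sup>2))"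
      using i by simp
    fix z assume "z \<in> space P"
    then have "fst z \<in> {0..T}" using tT by (auto simp: space_P)
    then have "norm (H \<epsilon> z - H \<delta> z) \<le> L * norm (y \<epsilon> (fst z) (snd z) - y \<delta> (fst z) (snd z))"
      unfolding H_def by (rule \<sigma>_lipschitz)
    also have "y \<epsilon> (fst z) (snd z) - y \<delta> (fst z) (snd z) = \<epsilon> *\<^sub>R VP \<epsilon> z - \<delta> *\<^sub>R VP \<delta> z"
      using \<epsilon> \<delta> by (simp add: VP_def V_def)
    also have "norm \<dots> \<le> \<epsilon> * norm (VP \<epsilon> z) + \<delta> * norm (VP \<delta> z)"
      using norm_triangle_ineq4[of "\<epsilon> *\<^sub>R VP \<epsilon> z" "\<delta> *\<^sub>R VP \<delta> z"] \<epsilon> \<delta> by simp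
    finally have "norm (H \<epsilon> z - H \<delta> z) \<le> L * (\<epsilon> * norm (VP \<epsilon> z) + \<delta> * norm (VP \<delta> z))"
      using L by (simp add: mult_left_mono)
    then have "(norm (H \<epsilon> z - H \<delta> z))\<^sup>2 \<le> L\<^sup>2 * (\<epsilon> * norm (VP \<epsilon> z) + \<delta> * norm (VP \<delta> z))\<^sup>2"
      by (metis norm_ge_zero power_mono power_mult_distrib)
    also have "\<dots> \<le> L\<^sup>2 * (2 * \<epsilon>\<^sup>2 * (norm (VP \<epsilon> z))\<^sup>2 + 2 * \<delta>\<^sup>2 * (norm (VP \<delta> z))\<^sup>2)"
      using sum_squares_2[of "\<epsilon> * norm (VP \<epsilon> z)" "\<delta> * norm (VP \<delta> z)"]
      by (intro mult_left_mono) (simp_all add: power_mult_distrib)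
    finally show "(norm (H \<epsilon> z - H \<delta> z))\<^sup>2
        \<le> L\<^sup>2 * (2 * \<epsilon>\<^sup>2 * (norm (VP \<epsilon> z))\<^sup>2 + 2 * \<delta>\<^sup>2 * (norm (VP \<delta> z))\<^sup>2)" .
  qed
  also have "\<dots> = L\<^sup>2 * (2 * \<epsilon>\<^sup>2 * (\<integral>z. (norm (VP \<epsilon> z))\<^sup>2 \<partial>P) + 2 * \<delta>\<^sup>2 * (\<integral>z. (norm (VP \<delta> z))\<^sup>2 \<partial>P))"
    using i by simp
  also have "\<dots> \<le> L\<^sup>2 * (2 * \<epsilon>\<^sup>2 * deviation_bound + 2 * \<delta>\<^sup>2 * deviation_bound)"
    by (intro mult_left_mono add_mono VP_L2(2) \<epsilon> \<delta>) auto
  also have "\<dots> = 2 * L\<^sup>2 * deviation_bound * (\<epsilon>\<^sup>2 + \<delta>\<^sup>2)" by (simp add: algebra_simps)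
  finally show ?thesis .
qed

definition noise_diff_const :: real where "noise_diff_const = real CARD('n) * (2 * L\<^sup>2 * deviation_bound) * t"

lemma JP_difference:
  assumes \<epsilon>: "0 < \<epsilon>" and \<delta>: "0 < \<delta>"
  shows "(\<integral>z. (norm (JP \<epsilon> z - JP \<delta> z))\<^sup>2 \<partial>P) \<le> noise_diff_const * (\<epsilon>\<^sup>2 + \<delta>\<^sup>2)"
proof -
  let ?c = "real CARD('n) * (2 * L\<^sup>2 * deviation_bound * (\<epsilon>\<^sup>2 + \<delta>\<^sup>2))"
  have sq: "sq_integrable M (\<lambda>\<omega>. JP \<epsilon> (s, \<omega>) - JP \<delta> (s, \<omega>))" if "s \<in> {0..t}" for s
    using sq_integrable_diff[OF J_sq_integrable[OF \<epsilon>, of s] J_sq_integrable[OF \<delta>, of s]] that tT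
    by (simp add: JP_def)
  have "(\<integral>z. (norm (JP \<epsilon> z - JP \<delta> z))\<^sup>2 \<partial>P) \<le> ?c * t"
  proof (rule sq_integrable_P(2)[OF _ sq])
    show "(\<lambda>z. JP \<epsilon> z - JP \<delta> z) \<in> borel_measurable P"
      using sq_integrableD(1)[OF JP_L2(1)[OF \<epsilon>]] sq_integrableD(1)[OF JP_L2(1)[OF \<delta>]] by simp
    fix s assume "s \<in> {0..t}"
    then show "(\<integral>\<omega>. (norm (JP \<epsilon> (s, \<omega>) - JP \<delta> (s, \<omega>)))\<^sup>2 \<partial>M) \<le> ?c"
      unfolding JP_def fst_conv snd_conv
      by (intro order_trans[OF J_difference_second_moment[OF \<epsilon> \<delta>]] mult_left_mono H_difference \<epsilon> \<delta>) auto
  qed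
  then show ?thesis by (simp add: noise_diff_const_def mult_ac)
qed

subsection \<open>The linearisation error\<close>

text \<open>The scaled remainder of the first order Taylor expansion of \<open>u\<close> at the flow.\<close>

definition rem :: "real \<Rightarrow> real \<times> 'a \<Rightarrow> real ^ 'n" where
  "rem \<epsilon> z = (1 / \<epsilon>) *\<^sub>R (u (y \<epsilon> (fst z) (snd z)) (fst z) - u (x (fst z)) (fst z)
     - A (fst z) *v (y \<epsilon> (fst z) (snd z) - x (fst z)))"

lemma matrix_vector_mult_borel:
  fixes f :: "'x \<Rightarrow> real ^ 'n ^ 'n" and g :: "'x \<Rightarrow> real ^ 'n"
  assumes "f \<in> borel_measurable N" "g \<in> borel_measurable N"
  shows "(\<lambda>z. f z *v g z) \<in> borel_measurable N"
  by (rule borel_measurable_continuous_Pair[OF assms],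
      rule bounded_bilinear.continuous_on[OF bounded_bilinear_matrix_vector_mult]) (intro continuous_intros)+

context
  fixes \<epsilon> :: real
  assumes \<epsilon>: "0 < \<epsilon>"
begin

lemma rem_measurable: "rem \<epsilon> \<in> borel_measurable P"
proof -
  note ym = y_jointly_measurable[OF \<epsilon>]
  have xm: "(\<lambda>z. x (fst z)) \<in> borel_measurable P"
    by (rule measurable_compose[OF measurable_fst flow_path_measurable[OF tT]])
  have Am: "(\<lambda>z. A (fst z)) \<in> borel_measurable P"
    by (rule measurable_compose[OF measurable_fst A_measurable[OF tT]])
  show ?thesis
    unfolding rem_def
    by (intro borel_measurable_scaleR borel_measurable_const borel_measurable_diff
        u_along_measurable ym xm fst_measurable_restrict matrix_vector_mult_borel Am)
qed

lemma rem_eq: "rem \<epsilon> (r, \<omega>) = G \<epsilon> \<omega> r - A r *v V \<epsilon> r \<omega>"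
proof -
  have "A r *v V \<epsilon> r \<omega> = (1 / \<epsilon>) *\<^sub>R (A r *v (y \<epsilon> r \<omega> - x r))"
    unfolding V_def by (rule matrix_vector_mult_scaleR)
  then show ?thesis
    by (simp only: rem_def G_def[OF \<epsilon>] fst_conv snd_conv scaleR_diff_right)
qed

lemma norm_rem_le:
  assumes z: "z \<in> space P"
  shows "norm (rem \<epsilon> z) \<le> 2 * K * norm (VP \<epsilon> z)" "norm (rem \<epsilon> z) \<le> C * \<epsilon> * (norm (VP \<epsilon> z))\<^sup>2"
proof -
  obtain r \<omega> where zr: "z = (r, \<omega>)" by (cases z)
  have r: "r \<in> {0..T}" using z tT by (auto simp: space_P zr)
  have "norm (rem \<epsilon> z) \<le> norm (G \<epsilon> \<omega> r) + norm (A r *v V \<epsilon> r \<omega>)"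
    unfolding zr rem_eq by (rule norm_triangle_ineq4)
  also have "\<dots> \<le> K * norm (V \<epsilon> r \<omega>) + K * norm (V \<epsilon> r \<omega>)"
    by (intro add_mono norm_G_le[OF \<epsilon>] u_jacobian r)
  finally show "norm (rem \<epsilon> z) \<le> 2 * K * norm (VP \<epsilon> z)" by (simp add: VP_def zr)
  have d: "norm (y \<epsilon> r \<omega> - x r) = \<epsilon> * norm (V \<epsilon> r \<omega>)"
    using \<epsilon> by (simp add: V_def)
  have "norm (rem \<epsilon> z) = (1 / \<epsilon>) * norm (u (y \<epsilon> r \<omega>) r - u (x r) r - A r *v (y \<epsilon> r \<omega> - x r))"
    using \<epsilon> by (simp add: rem_def zr)
  also have "\<dots> \<le> (1 / \<epsilon>) * (C * (norm (y \<epsilon> r \<omega> - x r))\<^sup>2)"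
    using \<epsilon> by (intro mult_left_mono u_taylor r) auto
  also have "\<dots> = C * \<epsilon> * (norm (V \<epsilon> r \<omega>))\<^sup>2"
    unfolding d using \<epsilon> by (simp add: power2_eq_square)
  finally show "norm (rem \<epsilon> z) \<le> C * \<epsilon> * (norm (VP \<epsilon> z))\<^sup>2" by (simp add: VP_def zr)
qed

lemma rem_sq_integrable: "sq_integrable P (rem \<epsilon>)"
  by (rule sq_integrable_bound[OF VP_L2(1)[OF \<epsilon>] rem_measurable AE_I2[OF norm_rem_le(1)]])

lemma JP_path_integrable:
  assumes "\<omega> \<in> space M"
  shows "integrable (lborel_upto t) (\<lambda>r. JP \<epsilon> (r, \<omega>))"
proof (rule integrable_of_sq_integrable[OF finite_measure_lborel_upto])
  have c: "continuous_on {0..t} (\<lambda>r. JP \<epsilon> (r, \<omega>))"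
    unfolding JP_def fst_conv snd_conv
    by (rule continuous_on_subset[OF J_continuous[OF \<epsilon> assms]]) (use tT in auto)
  then have m: "(\<lambda>r. JP \<epsilon> (r, \<omega>)) \<in> borel_measurable (lborel_upto t)"
    unfolding measurable_lborel_upto_cong by (rule borel_measurable_continuous_on_restrict)
  have "integrable (lborel_upto t) (\<lambda>r. (norm (JP \<epsilon> (r, \<omega>)))\<^sup>2)"
    by (rule integrable_lborel_upto_continuous) (intro continuous_intros c)
  with m show "sq_integrable (lborel_upto t) (\<lambda>r. JP \<epsilon> (r, \<omega>))" by (simp add: sq_integrable_def)
qed

end

lemma gronwall_majorant_triangle:
  assumes \<epsilon>: "0 < \<epsilon>" and \<delta>: "0 < \<delta>" and z: "z \<in> space P"
  shows "gronwall_majorant (JP \<epsilon>) z \<le> gronwall_majorant (JP \<delta>) z + gronwall_majorant (\<lambda>z. JP \<epsilon> z - JP \<delta> z) z"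
proof -
  have \<omega>: "snd z \<in> space M" using z by (auto simp: space_P)
  note i = JP_path_integrable[OF \<epsilon> \<omega>] JP_path_integrable[OF \<delta> \<omega>]
  have le: "norm a \<le> norm b + norm (a - b)" for a b :: "real ^ 'n"
    using norm_triangle_sub by blast
  have "(\<integral>r. norm (JP \<epsilon> (r, snd z)) \<partial>lborel_upto t)
      \<le> (\<integral>r. norm (JP \<delta> (r, snd z)) + norm (JP \<epsilon> (r, snd z) - JP \<delta> (r, snd z)) \<partial>lborel_upto t)"
    using i by (intro integral_mono le) auto
  also have "\<dots> = (\<integral>r. norm (JP \<delta> (r, snd z)) \<partial>lborel_upto t)
      + (\<integral>r. norm (JP \<epsilon> (r, snd z) - JP \<delta> (r, snd z)) \<partial>lborel_upto t)"
    using i by simp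
  finally have "gronwall_const * (\<integral>r. norm (JP \<epsilon> (r, snd z)) \<partial>lborel_upto t) \<le> gronwall_const * \<dots>"
    by (rule mult_left_mono[OF _ gronwall_const_nonneg])
  then show ?thesis
    unfolding gronwall_majorant_def using le[of "JP \<epsilon> z" "JP \<delta> z"] by (simp add: distrib_left)
qed

text \<open>The part of Gronwall's bound at the reference strength \<open>\<delta>\<close> that exceeds the level \<open>N\<close>.\<close>

definition excess :: "real \<Rightarrow> real \<Rightarrow> real \<times> 'a \<Rightarrow> real" where
  "excess \<delta> N z = max 0 (gronwall_majorant (JP \<delta>) z - N)"

lemma excess_sq_integrable:
  assumes \<delta>: "0 < \<delta>" and N: "0 \<le> N"
  shows "sq_integrable P (excess \<delta> N)"
proof (rule sq_integrable_bound[OF gronwall_majorant_L2(1)[OF JP_L2(1)[OF \<delta>]], of _ 1])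
  show "excess \<delta> N \<in> borel_measurable P"
    unfolding excess_def using sq_integrableD(1)[OF gronwall_majorant_L2(1)[OF JP_L2(1)[OF \<delta>]]] by measurable
  show "AE z in P. norm (excess \<delta> N z) \<le> 1 * norm (gronwall_majorant (JP \<delta>) z)"
    using N gronwall_majorant_nonneg[of "JP \<delta>"] by (intro AE_I2) (auto simp: excess_def)
qed

lemma excess_tendsto:
  assumes \<delta>: "0 < \<delta>"
  shows "(\<lambda>n. \<integral>z. (excess \<delta> (real n) z)\<^sup>2 \<partial>P) \<longlonglongrightarrow> 0"
proof -
  note g = gronwall_majorant_L2(1)[OF JP_L2(1)[OF \<delta>]]
  have gi: "integrable P (\<lambda>z. (gronwall_majorant (JP \<delta>) z)\<^sup>2)" using sq_integrableD(2)[OF g] by simp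
  have "(\<lambda>n. \<integral>z. (excess \<delta> (real n) z)\<^sup>2 \<partial>P) \<longlonglongrightarrow> (\<integral>z. 0 \<partial>P)"
  proof (rule integral_dominated_convergence[OF _ _ gi])
    show "(\<lambda>z. (excess \<delta> (real n) z)\<^sup>2) \<in> borel_measurable P" for n
      using sq_integrableD(1)[OF excess_sq_integrable[OF \<delta>, of "real n"]] by simp
    show "AE z in P. (\<lambda>n. (excess \<delta> (real n) z)\<^sup>2) \<longlonglongrightarrow> 0"
    proof (rule AE_I2)
      fix z
      obtain n0 where n0: "gronwall_majorant (JP \<delta>) z \<le> real n0" using real_arch_simple by blast
      have "eventually (\<lambda>n. (excess \<delta> (real n) z)\<^sup>2 = 0) sequentially"
        using eventually_ge_at_top[of n0]
      proof eventually_elim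
        case (elim n)
        then have "gronwall_majorant (JP \<delta>) z \<le> real n" using n0 by linarith
        then show ?case by (simp add: excess_def)
      qed
      then show "(\<lambda>n. (excess \<delta> (real n) z)\<^sup>2) \<longlonglongrightarrow> 0" by (rule tendsto_eventually)
    qed
    show "AE z in P. norm ((excess \<delta> (real n) z)\<^sup>2) \<le> (gronwall_majorant (JP \<delta>) z)\<^sup>2" for n
    proof (rule AE_I2)
      fix z
      have "(excess \<delta> (real n) z)\<^sup>2 \<le> (gronwall_majorant (JP \<delta>) z)\<^sup>2"
        using gronwall_majorant_nonneg[of "JP \<delta>" z] by (intro power_mono) (auto simp: excess_def)
      then show "norm ((excess \<delta> (real n) z)\<^sup>2) \<le> (gronwall_majorant (JP \<delta>) z)\<^sup>2" by simp
    qed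
  qed simp
  then show ?thesis by simp
qed

text \<open>Where \<open>\<bar>V\<bar> \<le> N + h\<close>, the error \<open>\<bar>V\<bar> min (2K) (C \<epsilon> \<bar>V\<bar>)\<close> splits into a part of order \<open>\<epsilon>\<close> and a part
  controlled by \<open>h\<close>; here \<open>h\<close> collects the difference of the noise terms at \<open>\<epsilon>\<close> and at the fixed level
  \<open>\<delta>\<close>, and the excess of the latter over \<open>N\<close>. This replaces moments of order higher than two.\<close>

lemma rem_bound:
  assumes \<epsilon>: "0 < \<epsilon>" and \<delta>: "0 < \<delta>" and N: "0 \<le> N"
  shows "(\<integral>z. (norm (rem \<epsilon> z))\<^sup>2 \<partial>P)
    \<le> 12 * K\<^sup>2 * (majorant_const * noise_diff_const) * (\<epsilon>\<^sup>2 + \<delta>\<^sup>2) + 12 * K\<^sup>2 * (\<integral>z. (excess \<delta> N z)\<^sup>2 \<partial>P) + 3 * (N * C)\<^sup>2 * deviation_bound * \<epsilon>\<^sup>2"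
proof -
  let ?d = "gronwall_majorant (\<lambda>z. JP \<epsilon> z - JP \<delta> z)"
  have sqd: "sq_integrable P (\<lambda>z. JP \<epsilon> z - JP \<delta> z)"
    by (rule sq_integrable_diff[OF JP_L2(1)[OF \<epsilon>] JP_L2(1)[OF \<delta>]])
  note d = gronwall_majorant_L2[OF sqd]
  have i: "integrable P (\<lambda>z. (?d z)\<^sup>2)" "integrable P (\<lambda>z. (excess \<delta> N z)\<^sup>2)" "integrable P (\<lambda>z. (norm (VP \<epsilon> z))\<^sup>2)"
    using sq_integrableD(2)[OF d(1)] sq_integrableD(2)[OF excess_sq_integrable[OF \<delta> N]]
      sq_integrableD(2)[OF VP_L2(1)[OF \<epsilon>]] by simp_all
  have pw: "(norm (rem \<epsilon> z))\<^sup>2 \<le> 12 * K\<^sup>2 * (?d z)\<^sup>2 + 12 * K\<^sup>2 * (excess \<delta> N z)\<^sup>2 + 3 * (N * C)\<^sup>2 * \<epsilon>\<^sup>2 * (norm (VP \<epsilon> z))\<^sup>2"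
    if z: "z \<in> space P" for z
  proof -
    let ?a = "norm (VP \<epsilon> z)" and ?h = "?d z + excess \<delta> N z"
    let ?m = "min (2 * K) (C * \<epsilon> * ?a)"
    have a: "?a \<le> N + ?h"
      using norm_VP_le[OF \<epsilon> z] gronwall_majorant_triangle[OF \<epsilon> \<delta> z] unfolding excess_def by linarith
    have m0: "0 \<le> ?m" using K C \<epsilon> by simp
    have h0: "0 \<le> ?h" using gronwall_majorant_nonneg[of _ z] by (simp add: excess_def)
    have "norm (rem \<epsilon> z) \<le> ?m * ?a"
      using norm_rem_le[OF \<epsilon> z] by (cases "2 * K \<le> C * \<epsilon> * ?a") (simp_all add: min_def power2_eq_square mult.assoc)
    also have "\<dots> \<le> ?m * (N + ?h)" by (rule mult_left_mono[OF a m0])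
    also have "\<dots> = ?m * N + ?m * ?h" by (rule distrib_left)
    also have "\<dots> \<le> C * \<epsilon> * ?a * N + 2 * K * ?h"
      using N h0 by (intro add_mono mult_right_mono) auto
    finally have "norm (rem \<epsilon> z) \<le> 2 * K * ?d z + 2 * K * excess \<delta> N z + N * C * \<epsilon> * ?a"
      by (simp add: algebra_simps)
    then have "(norm (rem \<epsilon> z))\<^sup>2 \<le> (2 * K * ?d z + 2 * K * excess \<delta> N z + N * C * \<epsilon> * ?a)\<^sup>2"
      by (rule power_mono) simp
    also have "\<dots> \<le> 3 * (2 * K * ?d z)\<^sup>2 + 3 * (2 * K * excess \<delta> N z)\<^sup>2 + 3 * (N * C * \<epsilon> * ?a)\<^sup>2"
      by (rule sum_squares_3)
    also have "\<dots> = 12 * K\<^sup>2 * (?d z)\<^sup>2 + 12 * K\<^sup>2 * (excess \<delta> N z)\<^sup>2 + 3 * (N * C)\<^sup>2 * \<epsilon>\<^sup>2 * ?a\<^sup>2"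
      by (simp add: power_mult_distrib)
    finally show ?thesis .
  qed
  have "(\<integral>z. (norm (rem \<epsilon> z))\<^sup>2 \<partial>P)
      \<le> (\<integral>z. 12 * K\<^sup>2 * (?d z)\<^sup>2 + 12 * K\<^sup>2 * (excess \<delta> N z)\<^sup>2 + 3 * (N * C)\<^sup>2 * \<epsilon>\<^sup>2 * (norm (VP \<epsilon> z))\<^sup>2 \<partial>P)"
    by (rule integral_mono[OF sq_integrableD(2)[OF rem_sq_integrable[OF \<epsilon>]] _ pw]) (use i in simp)
  also have "\<dots> = 12 * K\<^sup>2 * (\<integral>z. (?d z)\<^sup>2 \<partial>P) + 12 * K\<^sup>2 * (\<integral>z. (excess \<delta> N z)\<^sup>2 \<partial>P)
      + 3 * (N * C)\<^sup>2 * \<epsilon>\<^sup>2 * (\<integral>z. (norm (VP \<epsilon> z))\<^sup>2 \<partial>P)"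
    using i by simp
  also have "\<dots> \<le> 12 * K\<^sup>2 * (majorant_const * (noise_diff_const * (\<epsilon>\<^sup>2 + \<delta>\<^sup>2))) + 12 * K\<^sup>2 * (\<integral>z. (excess \<delta> N z)\<^sup>2 \<partial>P)
      + 3 * (N * C)\<^sup>2 * \<epsilon>\<^sup>2 * deviation_bound"
    by (intro add_mono mult_left_mono order_refl VP_L2(2)[OF \<epsilon>] order_trans[OF d(2)] JP_difference \<epsilon> \<delta> majorant_const_nonneg) auto
  finally show ?thesis by (simp add: algebra_simps)
qed

lemma noise_diff_const_nonneg: "0 \<le> noise_diff_const"
  unfolding noise_diff_const_def using t0 deviation_bound_nonneg by (intro mult_nonneg_nonneg) auto

text \<open>First \<open>\<delta>\<close>, then \<open>N\<close> and finally \<open>\<epsilon>\<close> is chosen to make the three terms of the bound small.\<close>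

lemma rem_tendsto: "((\<lambda>\<epsilon>. \<integral>z. (norm (rem \<epsilon> z))\<^sup>2 \<partial>P) \<longlongrightarrow> 0) (at_right 0)"
proof (rule order_tendstoI)
  fix a :: real assume "a < 0"
  moreover have "0 \<le> (\<integral>z. (norm (rem \<epsilon> z))\<^sup>2 \<partial>P)" for \<epsilon> by simp
  ultimately show "\<forall>\<^sub>F \<epsilon> in at_right 0. a < (\<integral>z. (norm (rem \<epsilon> z))\<^sup>2 \<partial>P)"
    by (intro always_eventually allI) (rule order_less_le_trans)
next
  fix \<eta> :: real assume \<eta>: "0 < \<eta>"
  define a where "a = 12 * K\<^sup>2 * (majorant_const * noise_diff_const)"
  have a0: "0 \<le> a" unfolding a_def using majorant_const_nonneg noise_diff_const_nonneg by (intro mult_nonneg_nonneg) auto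
  define \<delta> where "\<delta> = sqrt (\<eta> / (3 * (a + 1)))"
  have "0 < \<eta> / (3 * (a + 1))" using \<eta> a0 by (intro divide_pos_pos) auto
  then have \<delta>: "0 < \<delta>" "\<delta>\<^sup>2 = \<eta> / (3 * (a + 1))" by (simp_all add: \<delta>_def)
  have "a * \<delta>\<^sup>2 \<le> (a + 1) * \<delta>\<^sup>2" by (intro mult_right_mono) auto
  also have "\<dots> = \<eta> / 3"
  proof -
    have *: "b * (\<eta> / (3 * b)) = \<eta> / 3" if "b \<noteq> 0" for b using that by simp
    show ?thesis unfolding \<delta>(2) by (rule *) (use a0 in simp)
  qed
  finally have 1: "a * \<delta>\<^sup>2 \<le> \<eta> / 3" .
  have "(\<lambda>n. 12 * K\<^sup>2 * (\<integral>z. (excess \<delta> (real n) z)\<^sup>2 \<partial>P)) \<longlonglongrightarrow> 12 * K\<^sup>2 * 0"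
    by (intro tendsto_mult tendsto_const excess_tendsto \<delta>)
  then have "\<forall>\<^sub>F n in sequentially. 12 * K\<^sup>2 * (\<integral>z. (excess \<delta> (real n) z)\<^sup>2 \<partial>P) < \<eta> / 3"
    by (rule order_tendstoD) (use \<eta> in simp)
  then obtain n where 2: "12 * K\<^sup>2 * (\<integral>z. (excess \<delta> (real n) z)\<^sup>2 \<partial>P) < \<eta> / 3"
    using eventually_happens by force
  let ?b = "a + 3 * (real n * C)\<^sup>2 * deviation_bound"
  have "((\<lambda>\<epsilon>. ?b * \<epsilon>\<^sup>2) \<longlongrightarrow> ?b * 0\<^sup>2) (at_right 0)"
    by (intro tendsto_mult tendsto_const tendsto_power tendsto_ident_at)
  then have "\<forall>\<^sub>F \<epsilon> in at_right 0. ?b * \<epsilon>\<^sup>2 < \<eta> / 3"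
    by (rule order_tendstoD) (use \<eta> in simp)
  then show "\<forall>\<^sub>F \<epsilon> in at_right 0. (\<integral>z. (norm (rem \<epsilon> z))\<^sup>2 \<partial>P) < \<eta>"
    using eventually_at_right_less[of 0]
  proof eventually_elim
    case (elim \<epsilon>)
    have "a * (\<epsilon>\<^sup>2 + \<delta>\<^sup>2) + 3 * (real n * C)\<^sup>2 * deviation_bound * \<epsilon>\<^sup>2 = a * \<delta>\<^sup>2 + ?b * \<epsilon>\<^sup>2"
      by (simp only: distrib_left distrib_right)
    then show ?case
      using rem_bound[OF elim(2) \<delta>(1), of "real n", folded a_def] 1 2 elim(1) by simp
  qed
qed

subsection \<open>The main term and its variance\<close>

abbreviation coA :: "real ^ 'n \<Rightarrow> real \<Rightarrow> real ^ 'n" where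
  "coA p r \<equiv> costate t p r v* A r"

definition main_term :: "real \<Rightarrow> real ^ 'n \<Rightarrow> 'a \<Rightarrow> real" where
  "main_term \<epsilon> p \<omega> = p \<bullet> J \<epsilon> t \<omega> + (\<integral>r. coA p r \<bullet> J \<epsilon> r \<omega> \<partial>lborel_upto t)"

definition error_term :: "real \<Rightarrow> real ^ 'n \<Rightarrow> 'a \<Rightarrow> real" where
  "error_term \<epsilon> p \<omega> = (\<integral>r. costate t p r \<bullet> rem \<epsilon> (r, \<omega>) \<partial>lborel_upto t)"

lemma norm_coA_le: "r \<in> {0..t} \<Longrightarrow> norm (coA p r) \<le> K * costate_bound * norm p"
  by (rule norm_costate_A_le[OF t]) (use tT in auto)

lemma coA_measurable: "coA p \<in> borel_measurable (lborel_upto t)"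
  by (rule costate_A_measurable[OF t])

text \<open>Integrating by parts against the costate solves the linearised equation: the terms in \<open>V\<close>
  cancel, and only the noise and the remainder are left.\<close>

lemma deviation_eq_main_plus_error:
  assumes \<epsilon>: "0 < \<epsilon>" and \<omega>: "\<omega> \<in> space M"
  shows "p \<bullet> V \<epsilon> t \<omega> = main_term \<epsilon> p \<omega> + error_term \<epsilon> p \<omega>"
proof -
  let ?P = "lborel_upto t"
  have sub: "{0..t} \<subseteq> {0..T}" using tT by auto
  have Vc: "continuous_on {0..t} (\<lambda>s. V \<epsilon> s \<omega>)"
    by (rule continuous_on_subset[OF V_continuous[OF \<epsilon> \<omega>] sub])
  then have "compact ((\<lambda>s. V \<epsilon> s \<omega>) ` {0..t})" by (rule compact_continuous_image) simp
  then obtain c where c: "\<And>s. s \<in> {0..t} \<Longrightarrow> norm (V \<epsilon> s \<omega>) \<le> c"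
    by (meson bounded_iff compact_imp_bounded imageI)
  have Vm: "(\<lambda>s. V \<epsilon> s \<omega>) \<in> borel_measurable ?P"
    unfolding measurable_lborel_upto_cong by (rule borel_measurable_continuous_on_restrict[OF Vc])
  have Gm: "G \<epsilon> \<omega> \<in> borel_measurable ?P" by (rule G_path(1)[OF \<epsilon> \<omega> t])
  have Gb: "norm (G \<epsilon> \<omega> r) \<le> K * c" if r: "r \<in> {0..t}" for r
    using norm_G_le[OF \<epsilon>, of r \<omega>] mult_left_mono[OF c[OF r] K] r sub by auto
  have AVm: "(\<lambda>r. A r *v V \<epsilon> r \<omega>) \<in> borel_measurable ?P"
    by (rule matrix_vector_mult_borel[OF A_measurable[OF tT] Vm])
  have AVb: "norm (A r *v V \<epsilon> r \<omega>) \<le> K * c" if r: "r \<in> {0..t}" for r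
    using u_jacobian[of r "x r" "V \<epsilon> r \<omega>"] mult_left_mono[OF c[OF r] K] r sub by auto
  have costb: "norm (costate t p r) \<le> costate_bound * norm p" if "r \<in> {0..t}" for r
    by (rule norm_costate_le[OF t]) (use that sub in auto)
  note sq = sq_integrable_bounded[OF finite_measure_lborel_upto]
  have sqG: "sq_integrable ?P (G \<epsilon> \<omega>)" by (rule sq[OF Gm, of "K * c"]) (use Gb in simp)
  have sqAV: "sq_integrable ?P (\<lambda>r. A r *v V \<epsilon> r \<omega>)" by (rule sq[OF AVm, of "K * c"]) (use AVb in simp)
  have sqV: "sq_integrable ?P (\<lambda>r. V \<epsilon> r \<omega>)" by (rule sq[OF Vm, of c]) (use c in simp)
  have sqJ: "sq_integrable ?P (\<lambda>r. J \<epsilon> r \<omega>)"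
  proof -
    have Jc: "continuous_on {0..t} (\<lambda>s. J \<epsilon> s \<omega>)"
      by (rule continuous_on_subset[OF J_continuous[OF \<epsilon> \<omega>] sub])
    have "(\<lambda>s. J \<epsilon> s \<omega>) \<in> borel_measurable ?P"
      unfolding measurable_lborel_upto_cong by (rule borel_measurable_continuous_on_restrict[OF Jc])
    moreover have "integrable ?P (\<lambda>s. (norm (J \<epsilon> s \<omega>))\<^sup>2)"
      by (rule integrable_lborel_upto_continuous) (intro continuous_intros Jc)
    ultimately show ?thesis by (simp add: sq_integrable_def)
  qed
  have sqa: "sq_integrable ?P (coA p)"
    by (rule sq[OF coA_measurable, where C = "K * costate_bound * norm p"]) (use norm_coA_le in simp)
  have sqc: "sq_integrable ?P (costate t p)"
    by (rule sq[OF costate_measurable[OF t], where C = "costate_bound * norm p"]) (use costb in simp)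
  have sqrem: "sq_integrable ?P (\<lambda>r. rem \<epsilon> (r, \<omega>))"
    unfolding rem_eq[OF \<epsilon>] by (rule sq_integrable_diff[OF sqG sqAV])
  have "p \<bullet> (\<integral>s. G \<epsilon> \<omega> s \<partial>?P)
      = (\<integral>s. (p + (\<integral>r. indicator {s..t} r *\<^sub>R coA p r \<partial>?P)) \<bullet> G \<epsilon> \<omega> s \<partial>?P)
        - (\<integral>r. coA p r \<bullet> (\<integral>s. G \<epsilon> \<omega> s \<partial>lborel_upto r) \<partial>?P)"
    by (rule integral_by_parts_lborel_upto[OF coA_measurable Gm norm_coA_le Gb t0])
  also have "(\<integral>s. (p + (\<integral>r. indicator {s..t} r *\<^sub>R coA p r \<partial>?P)) \<bullet> G \<epsilon> \<omega> s \<partial>?P)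
      = (\<integral>s. coA p s \<bullet> V \<epsilon> s \<omega> + costate t p s \<bullet> rem \<epsilon> (s, \<omega>) \<partial>?P)"
    by (rule Bochner_Integration.integral_cong[OF refl])
       (simp add: costate_equation[OF t, symmetric] rem_eq[OF \<epsilon>] inner_diff_right dot_lmul_matrix)
  also have "(\<integral>r. coA p r \<bullet> (\<integral>s. G \<epsilon> \<omega> s \<partial>lborel_upto r) \<partial>?P)
      = (\<integral>r. coA p r \<bullet> V \<epsilon> r \<omega> - coA p r \<bullet> J \<epsilon> r \<omega> \<partial>?P)"
  proof (rule Bochner_Integration.integral_cong[OF refl])
    fix r assume "r \<in> space ?P"
    then have "r \<in> {0..T}" using sub by auto
    then show "coA p r \<bullet> (\<integral>s. G \<epsilon> \<omega> s \<partial>lborel_upto r) = coA p r \<bullet> V \<epsilon> r \<omega> - coA p r \<bullet> J \<epsilon> r \<omega>"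
      using G_path(3)[OF \<epsilon> \<omega>, of r] by (simp add: inner_add_right)
  qed
  finally have "p \<bullet> (\<integral>s. G \<epsilon> \<omega> s \<partial>?P) = (\<integral>r. coA p r \<bullet> J \<epsilon> r \<omega> \<partial>?P) + error_term \<epsilon> p \<omega>"
    using integrable_inner_of_sq_integrable[OF sqa sqV] integrable_inner_of_sq_integrable[OF sqa sqJ]
      integrable_inner_of_sq_integrable[OF sqc sqrem]
    by (simp add: error_term_def)
  then show ?thesis
    using G_path(3)[OF \<epsilon> \<omega> t] by (simp add: main_term_def inner_add_right)
qed

lemma coA_JP_sq_integrable:
  assumes \<epsilon>: "0 < \<epsilon>"
  shows "sq_integrable P (\<lambda>z. coA p (fst z) \<bullet> JP \<epsilon> z)"
proof (rule sq_integrable_bound[OF JP_L2(1)[OF \<epsilon>]])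
  have "(\<lambda>z. coA p (fst z)) \<in> borel_measurable P"
    by (rule measurable_compose[OF measurable_fst coA_measurable])
  then show "(\<lambda>z. coA p (fst z) \<bullet> JP \<epsilon> z) \<in> borel_measurable P"
    by (rule borel_measurable_inner[OF _ sq_integrableD(1)[OF JP_L2(1)[OF \<epsilon>]]])
  show "AE z in P. norm (coA p (fst z) \<bullet> JP \<epsilon> z) \<le> K * costate_bound * norm p * norm (JP \<epsilon> z)"
  proof (rule AE_I2)
    fix z assume "z \<in> space P"
    then have "fst z \<in> {0..t}" by (auto simp: space_P)
    then show "norm (coA p (fst z) \<bullet> JP \<epsilon> z) \<le> K * costate_bound * norm p * norm (JP \<epsilon> z)"
      unfolding real_norm_def
      by (intro order_trans[OF Cauchy_Schwarz_ineq2] mult_right_mono norm_coA_le) auto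
  qed
qed

lemma main_term_sq_integrable:
  assumes \<epsilon>: "0 < \<epsilon>"
  shows "sq_integrable M (main_term \<epsilon> p)"
proof -
  have "sq_integrable M (\<lambda>\<omega>. \<integral>r. coA p r \<bullet> J \<epsilon> r \<omega> \<partial>lborel_upto t)"
    using time_integral(1)[OF coA_JP_sq_integrable[OF \<epsilon>, of p]] by (simp add: JP_def)
  then show ?thesis
    unfolding main_term_def by (rule sq_integrable_add[OF sq_integrable_inner[OF J_sq_integrable[OF \<epsilon> t]]])
qed

lemma costate_H_sq_integrable:
  assumes \<epsilon>: "0 < \<epsilon>"
  shows "sq_integrable P (\<lambda>z. costate t p (fst z) v* H \<epsilon> z)"
proof (rule sq_integrable_bound[OF H_sq_integrable[OF \<epsilon>], of _ "costate_bound * norm p"])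
  show "(\<lambda>z. costate t p (fst z) v* H \<epsilon> z) \<in> borel_measurable P"
    by (rule borel_measurable_continuous_Pair[OF measurable_compose[OF measurable_fst costate_measurable[OF t]]
          H_measurable[OF \<epsilon>]],
        rule bounded_bilinear.continuous_on[OF bounded_bilinear_vector_matrix_mult]) (intro continuous_intros)+
  show "AE z in P. norm (costate t p (fst z) v* H \<epsilon> z) \<le> costate_bound * norm p * norm (H \<epsilon> z)"
    using tT by (intro AE_I2 order_trans[OF norm_vector_matrix_mult_le] mult_right_mono norm_costate_le[OF t])
      (auto simp: space_P)
qed

text \<open>Fubini's theorem reduces the pairing of any \<open>Y\<close> with the main term to its pairings with the
  noise at the single times; the time integral of the integrands then is the costate again.\<close>

lemma expectation_times_main_term:
  fixes g :: "real \<times> 'a \<Rightarrow> real ^ 'm"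
  assumes \<epsilon>: "0 < \<epsilon>" and Y: "sq_integrable M Y"
    and g: "g \<in> borel_measurable P" and g_le: "\<And>z. z \<in> space P \<Longrightarrow> norm (g z) \<le> c"
    and pairing: "\<And>q s. s \<in> {0..t} \<Longrightarrow>
      (\<integral>\<omega>. Y \<omega> * (q \<bullet> J \<epsilon> s \<omega>) \<partial>M) = (\<integral>z. indicator {0..s} (fst z) * (g z \<bullet> (q v* H \<epsilon> z)) \<partial>P)"
  shows "(\<integral>\<omega>. Y \<omega> * main_term \<epsilon> p \<omega> \<partial>M) = (\<integral>z. g z \<bullet> (costate t p (fst z) v* H \<epsilon> z) \<partial>P)"
proof -
  interpret LM: pair_sigma_finite "lborel_upto t" M by (rule pair_sigma_finite_P)
  interpret PF: finite_measure P by (rule finite_P)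
  interpret LF: finite_measure "lborel_upto t" by (rule finite_measure_lborel_upto)
  interpret LP: pair_sigma_finite "lborel_upto t" P ..
  note measurable_lborel_upto_id [measurable]
  have Hm: "H \<epsilon> \<in> borel_measurable P" by (rule H_measurable[OF \<epsilon>])
  have sqg: "sq_integrable P g" by (rule sq_integrable_bounded[OF finite_P g g_le])
  have t_in: "t \<in> {0..t}" using t0 by simp
  have fin: "(\<integral>\<omega>. Y \<omega> * (p \<bullet> J \<epsilon> t \<omega>) \<partial>M) = (\<integral>z. g z \<bullet> (p v* H \<epsilon> z) \<partial>P)"
    unfolding pairing[OF t_in]
    by (rule Bochner_Integration.integral_cong[OF refl]) (auto simp: space_P)
  let ?f = "\<lambda>r \<omega>. Y \<omega> * (coA p r \<bullet> J \<epsilon> r \<omega>)"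
  have "integrable P (\<lambda>z. Y (snd z) \<bullet> (coA p (fst z) \<bullet> JP \<epsilon> z))"
    by (rule integrable_inner_of_sq_integrable[OF snd_sq_integrable(1)[OF Y] coA_JP_sq_integrable[OF \<epsilon>]])
  then have fi: "integrable P (case_prod ?f)"
    by (simp add: JP_def case_prod_unfold)
  have "(\<integral>\<omega>. Y \<omega> * (\<integral>r. coA p r \<bullet> J \<epsilon> r \<omega> \<partial>lborel_upto t) \<partial>M) = (\<integral>\<omega>. (\<integral>r. ?f r \<omega> \<partial>lborel_upto t) \<partial>M)"
    by simp
  also have "\<dots> = (\<integral>r. (\<integral>\<omega>. ?f r \<omega> \<partial>M) \<partial>lborel_upto t)"
    by (rule LM.Fubini_integral[OF fi])
  also have "\<dots> = (\<integral>r. (\<integral>z. indicator {0..r} (fst z) * (g z \<bullet> (coA p r v* H \<epsilon> z)) \<partial>P) \<partial>lborel_upto t)"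
    by (rule Bochner_Integration.integral_cong[OF refl]) (rule pairing, simp)
  also have "\<dots> = (\<integral>z. (\<integral>r. indicator {0..r} (fst z) * (g z \<bullet> (coA p r v* H \<epsilon> z)) \<partial>lborel_upto t) \<partial>P)"
  proof (rule LP.Fubini_integral[symmetric])
    let ?k = "\<lambda>w. indicator {0..fst w} (fst (snd w)) * (g (snd w) \<bullet> (coA p (fst w) v* H \<epsilon> (snd w)))"
    have km: "?k \<in> borel_measurable (lborel_upto t \<Otimes>\<^sub>M P)"
    proof (intro borel_measurable_times borel_measurable_inner)
      have "(\<lambda>w. indicator {0..fst w} (fst (snd w)) :: real)
          = (\<lambda>w :: real \<times> real \<times> 'a. if 0 \<le> fst (snd w) \<and> fst (snd w) \<le> fst w then 1 else 0)"
        by (auto simp: indicator_def)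
      moreover have "(\<lambda>w. if 0 \<le> fst (snd w) \<and> fst (snd w) \<le> fst w then 1 else 0 :: real)
          \<in> borel_measurable (lborel_upto t \<Otimes>\<^sub>M P)"
        by measurable
      ultimately show "(\<lambda>w. indicator {0..fst w} (fst (snd w)) :: real) \<in> borel_measurable (lborel_upto t \<Otimes>\<^sub>M P)"
        by simp
      show "(\<lambda>w. g (snd w)) \<in> borel_measurable (lborel_upto t \<Otimes>\<^sub>M P)"
        by (rule measurable_compose[OF measurable_snd g])
      show "(\<lambda>w. coA p (fst w) v* H \<epsilon> (snd w)) \<in> borel_measurable (lborel_upto t \<Otimes>\<^sub>M P)"
        by (rule borel_measurable_continuous_Pair[OF measurable_compose[OF measurable_fst coA_measurable]
              measurable_compose[OF measurable_snd Hm]],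
            rule bounded_bilinear.continuous_on[OF bounded_bilinear_vector_matrix_mult]) (intro continuous_intros)+
    qed
    have kb: "norm (?k w) \<le> c * (K * costate_bound * norm p * S)" if w: "w \<in> space (lborel_upto t \<Otimes>\<^sub>M P)" for w
    proof -
      have w': "fst w \<in> {0..t}" "snd w \<in> space P" using w by (auto simp: space_pair_measure)
      have c0: "0 \<le> c" by (rule order_trans[OF norm_ge_zero g_le[OF w'(2)]])
      have "norm (?k w) \<le> \<bar>g (snd w) \<bullet> (coA p (fst w) v* H \<epsilon> (snd w))\<bar>"
        by (auto simp: indicator_def)
      also have "\<dots> \<le> norm (g (snd w)) * (norm (coA p (fst w)) * norm (H \<epsilon> (snd w)))"
        by (intro order_trans[OF Cauchy_Schwarz_ineq2] mult_left_mono norm_vector_matrix_mult_le) auto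
      also have "\<dots> \<le> c * (K * costate_bound * norm p * S)"
        using c0 K costate_bound_nonneg[OF t]
        by (intro mult_mono g_le norm_coA_le norm_H_le[OF \<epsilon>] w') auto
      finally show ?thesis .
    qed
    have "AE w in lborel_upto t \<Otimes>\<^sub>M P. norm (?k w) \<le> c * (K * costate_bound * norm p * S)"
      by (rule AE_I2) (rule kb)
    then have "integrable (lborel_upto t \<Otimes>\<^sub>M P) ?k"
      by (rule finite_measure.integrable_const_bound[OF finite_measure_pair_measure
            [OF finite_P finite_measure_lborel_upto] _ km])
    then show "integrable (lborel_upto t \<Otimes>\<^sub>M P)
        (case_prod (\<lambda>r z. indicator {0..r} (fst z) * (g z \<bullet> (coA p r v* H \<epsilon> z))))"
      by (simp add: case_prod_unfold)
  qed
  also have "\<dots> = (\<integral>z. g z \<bullet> ((costate t p (fst z) - p) v* H \<epsilon> z) \<partial>P)"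
  proof (rule Bochner_Integration.integral_cong[OF refl])
    fix z assume "z \<in> space P"
    then have z: "fst z \<in> {0..t}" by (auto simp: space_P)
    have i: "integrable (lborel_upto t) (\<lambda>r. indicator {fst z..t} r *\<^sub>R coA p r)"
    proof (rule integrable_bounded_lborel_upto)
      show "(\<lambda>r. indicator {fst z..t} r *\<^sub>R coA p r) \<in> borel_measurable (lborel_upto t)"
        by (intro borel_measurable_scaleR coA_measurable measurable_compose[OF measurable_lborel_upto_id]) simp
      show "norm (indicator {fst z..t} s *\<^sub>R coA p s) \<le> K * costate_bound * norm p" if "s \<in> {0..t}" for s
        using norm_coA_le[OF that, of p] order_trans[OF norm_ge_zero norm_coA_le[OF that, of p]]
        by (auto simp: indicator_def)
    qed
    have flip: "g z \<bullet> (q v* H \<epsilon> z) = (H \<epsilon> z *v g z) \<bullet> q" for q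
      using dot_lmul_matrix[of q "H \<epsilon> z" "g z"] by (simp add: inner_commute)
    have "(\<integral>r. indicator {0..r} (fst z) * (g z \<bullet> (coA p r v* H \<epsilon> z)) \<partial>lborel_upto t)
        = (\<integral>r. (H \<epsilon> z *v g z) \<bullet> (indicator {fst z..t} r *\<^sub>R coA p r) \<partial>lborel_upto t)"
      unfolding flip
      by (rule Bochner_Integration.integral_cong[OF refl]) (use z in \<open>auto simp: indicator_def\<close>)
    also have "\<dots> = (H \<epsilon> z *v g z) \<bullet> (\<integral>r. indicator {fst z..t} r *\<^sub>R coA p r \<partial>lborel_upto t)"
      by (rule integral_inner_right[OF i])
    also have "(\<integral>r. indicator {fst z..t} r *\<^sub>R coA p r \<partial>lborel_upto t) = costate t p (fst z) - p"
      using costate_equation[OF t z, of p] by simp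
    finally show "(\<integral>r. indicator {0..r} (fst z) * (g z \<bullet> (coA p r v* H \<epsilon> z)) \<partial>lborel_upto t)
        = g z \<bullet> ((costate t p (fst z) - p) v* H \<epsilon> z)"
      unfolding flip .
  qed
  finally have int: "(\<integral>\<omega>. Y \<omega> * (\<integral>r. coA p r \<bullet> J \<epsilon> r \<omega> \<partial>lborel_upto t) \<partial>M)
      = (\<integral>z. g z \<bullet> ((costate t p (fst z) - p) v* H \<epsilon> z) \<partial>P)" .
  have costH: "sq_integrable P (\<lambda>z. costate t p (fst z) v* H \<epsilon> z)"
    by (rule costate_H_sq_integrable[OF \<epsilon>])
  have pH: "sq_integrable P (\<lambda>z. p v* H \<epsilon> z)" by (rule vH_sq_integrable[OF \<epsilon>])
  have split: "(costate t p (fst z) - p) v* H \<epsilon> z = costate t p (fst z) v* H \<epsilon> z - p v* H \<epsilon> z" for z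
    by (rule bounded_bilinear.diff_left[OF bounded_bilinear_vector_matrix_mult])
  have Yi: "integrable M (\<lambda>\<omega>. Y \<omega> * (p \<bullet> J \<epsilon> t \<omega>))"
    "integrable M (\<lambda>\<omega>. Y \<omega> * (\<integral>r. coA p r \<bullet> J \<epsilon> r \<omega> \<partial>lborel_upto t))"
    using integrable_inner_of_sq_integrable[OF Y sq_integrable_inner[OF J_sq_integrable[OF \<epsilon> t], of p]]
      integrable_inner_of_sq_integrable[OF Y time_integral(1)[OF coA_JP_sq_integrable[OF \<epsilon>, of p]]]
    by (simp_all add: JP_def)
  have "(\<integral>\<omega>. Y \<omega> * main_term \<epsilon> p \<omega> \<partial>M)
      = (\<integral>z. g z \<bullet> (p v* H \<epsilon> z) \<partial>P) + (\<integral>z. g z \<bullet> ((costate t p (fst z) - p) v* H \<epsilon> z) \<partial>P)"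
    unfolding main_term_def distrib_left using Yi by (simp add: fin int)
  also have "\<dots> = (\<integral>z. g z \<bullet> (costate t p (fst z) v* H \<epsilon> z) \<partial>P)"
    using integrable_inner_of_sq_integrable[OF sqg costH] integrable_inner_of_sq_integrable[OF sqg pH]
    by (simp add: split inner_diff_right)
  finally show ?thesis .
qed

text \<open>Pairing with the constant \<open>1\<close> has the integrand \<open>0\<close>.\<close>

lemma main_term_mean:
  assumes \<epsilon>: "0 < \<epsilon>"
  shows "(\<integral>\<omega>. main_term \<epsilon> p \<omega> \<partial>M) = 0"
proof -
  have "(\<integral>\<omega>. 1 * main_term \<epsilon> p \<omega> \<partial>M) = (\<integral>z. 0 \<bullet> (costate t p (fst z) v* H \<epsilon> z) \<partial>P)"
  proof (rule expectation_times_main_term[OF \<epsilon>, of _ _ 0])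
    show "sq_integrable M (\<lambda>_. 1 :: real)" by (simp add: sq_integrable_def)
    show "(\<integral>\<omega>. 1 * (q \<bullet> J \<epsilon> s \<omega>) \<partial>M) = (\<integral>z. indicator {0..s} (fst z) * (0 \<bullet> (q v* H \<epsilon> z)) \<partial>P)"
      if "s \<in> {0..t}" for q s
      using J_mean[OF \<epsilon>, of s q] that tT by simp
  qed auto
  then show ?thesis by simp
qed

text \<open>The pairing formula is used twice: first with the noise at a single time, which yields the pairing of
  that noise with the main term, then with the main term itself.\<close>

lemma main_term_second_moment:
  assumes \<epsilon>: "0 < \<epsilon>"
  shows "(\<integral>\<omega>. (main_term \<epsilon> p \<omega>)\<^sup>2 \<partial>M) = (\<integral>z. (norm (costate t p (fst z) v* H \<epsilon> z))\<^sup>2 \<partial>P)"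
proof -
  let ?g = "\<lambda>z. costate t p (fst z) v* H \<epsilon> z"
  have pairing: "(\<integral>\<omega>. main_term \<epsilon> p \<omega> * (q \<bullet> J \<epsilon> s \<omega>) \<partial>M)
      = (\<integral>z. indicator {0..s} (fst z) * (?g z \<bullet> (q v* H \<epsilon> z)) \<partial>P)" if s: "s \<in> {0..t}" for q s
  proof -
    have sT: "s \<in> {0..T}" using s tT by auto
    have m: "(\<lambda>z. indicator {0..s} (fst z) *\<^sub>R (q v* H \<epsilon> z)) \<in> borel_measurable P"
    proof (rule borel_measurable_scaleR[OF _ borel_measurable_vector_matrix_mult[OF H_measurable[OF \<epsilon>]]])
      show "(\<lambda>z. indicator {0..s} (fst z) :: real) \<in> borel_measurable P"
        by (rule measurable_compose[OF measurable_compose[OF measurable_fst measurable_lborel_upto_id]]) simp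
    qed
    have "(\<integral>\<omega>. (q \<bullet> J \<epsilon> s \<omega>) * main_term \<epsilon> p \<omega> \<partial>M)
        = (\<integral>z. (indicator {0..s} (fst z) *\<^sub>R (q v* H \<epsilon> z)) \<bullet> ?g z \<partial>P)"
    proof (rule expectation_times_main_term[OF \<epsilon> sq_integrable_inner[OF J_sq_integrable[OF \<epsilon> sT]] m])
      fix z assume z: "z \<in> space P"
      have "norm (indicator {0..s} (fst z) *\<^sub>R (q v* H \<epsilon> z)) \<le> norm (q v* H \<epsilon> z)"
        by (auto simp: indicator_def)
      also have "\<dots> \<le> norm q * S"
        by (intro order_trans[OF norm_vector_matrix_mult_le] mult_left_mono norm_H_le[OF \<epsilon> z]) simp
      finally show "norm (indicator {0..s} (fst z) *\<^sub>R (q v* H \<epsilon> z)) \<le> norm q * S" .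
    next
      fix q' s' assume s': "s' \<in> {0..t}"
      have ind: "indicator {0..min s s'} (fst z) = (indicator {0..s'} (fst z) * indicator {0..s} (fst z) :: real)" for z :: "real \<times> 'a"
        by (auto simp: indicator_def)
      show "(\<integral>\<omega>. (q \<bullet> J \<epsilon> s \<omega>) * (q' \<bullet> J \<epsilon> s' \<omega>) \<partial>M)
          = (\<integral>z. indicator {0..s'} (fst z) * ((indicator {0..s} (fst z) *\<^sub>R (q v* H \<epsilon> z)) \<bullet> (q' v* H \<epsilon> z)) \<partial>P)"
        unfolding J_covariance[OF \<epsilon> \<epsilon> s s'] ind by (simp add: mult.assoc)
    qed
    then show ?thesis by (simp add: mult.commute inner_commute)
  qed
  have gle: "norm (?g z) \<le> (costate_bound * norm p) * S" if z: "z \<in> space P" for z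
    using costate_bound_nonneg[OF t] z tT
    by (intro order_trans[OF norm_vector_matrix_mult_le] mult_mono norm_costate_le[OF t] norm_H_le[OF \<epsilon> z])
       (auto simp: space_P)
  have "(\<integral>\<omega>. main_term \<epsilon> p \<omega> * main_term \<epsilon> p \<omega> \<partial>M) = (\<integral>z. ?g z \<bullet> ?g z \<partial>P)"
    by (rule expectation_times_main_term[OF \<epsilon> main_term_sq_integrable[OF \<epsilon>]
          sq_integrableD(1)[OF costate_H_sq_integrable[OF \<epsilon>]] gle pairing])
  then show ?thesis unfolding power2_norm_eq_inner by (simp only: power2_eq_square)
qed

lemma error_term_L2:
  assumes \<epsilon>: "0 < \<epsilon>"
  shows "sq_integrable M (error_term \<epsilon> p)"
    "(\<integral>\<omega>. (error_term \<epsilon> p \<omega>)\<^sup>2 \<partial>M) \<le> t * ((costate_bound * norm p)\<^sup>2 * (\<integral>z. (norm (rem \<epsilon> z))\<^sup>2 \<partial>P))"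
proof -
  let ?f = "\<lambda>z. costate t p (fst z) \<bullet> rem \<epsilon> z"
  have le: "norm (?f z) \<le> costate_bound * norm p * norm (rem \<epsilon> z)" if "z \<in> space P" for z
    unfolding real_norm_def using that tT
    by (intro order_trans[OF Cauchy_Schwarz_ineq2] mult_right_mono norm_costate_le[OF t]) (auto simp: space_P)
  have sq: "sq_integrable P ?f"
    by (rule sq_integrable_bound[OF rem_sq_integrable[OF \<epsilon>] _ AE_I2[OF le]])
       (intro borel_measurable_inner rem_measurable[OF \<epsilon>] measurable_compose[OF measurable_fst costate_measurable[OF t]])
  show "sq_integrable M (error_term \<epsilon> p)"
    unfolding error_term_def using time_integral(1)[OF sq] by simp
  have "(\<integral>\<omega>. (error_term \<epsilon> p \<omega>)\<^sup>2 \<partial>M) \<le> t * (\<integral>z. (?f z)\<^sup>2 \<partial>P)"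
    unfolding error_term_def using time_integral(2)[OF sq] by simp
  also have "(\<integral>z. (?f z)\<^sup>2 \<partial>P) \<le> (\<integral>z. (costate_bound * norm p)\<^sup>2 * (norm (rem \<epsilon> z))\<^sup>2 \<partial>P)"
  proof (rule integral_mono)
    show "integrable P (\<lambda>z. (?f z)\<^sup>2)" using sq_integrableD(2)[OF sq] by simp
    show "integrable P (\<lambda>z. (costate_bound * norm p)\<^sup>2 * (norm (rem \<epsilon> z))\<^sup>2)"
      using sq_integrableD(2)[OF rem_sq_integrable[OF \<epsilon>]] by simp
    fix z assume "z \<in> space P"
    then have "\<bar>?f z\<bar>\<^sup>2 \<le> (costate_bound * norm p * norm (rem \<epsilon> z))\<^sup>2" using le by (intro power_mono) auto
    then show "(?f z)\<^sup>2 \<le> (costate_bound * norm p)\<^sup>2 * (norm (rem \<epsilon> z))\<^sup>2" by (simp add: power_mult_distrib)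
  qed
  finally show "(\<integral>\<omega>. (error_term \<epsilon> p \<omega>)\<^sup>2 \<partial>M) \<le> t * ((costate_bound * norm p)\<^sup>2 * (\<integral>z. (norm (rem \<epsilon> z))\<^sup>2 \<partial>P))"
    using t0 by (simp add: mult_left_mono)
qed

subsection \<open>The limit of the scaled variance\<close>

text \<open>The integrand of the limiting variance: the effect in direction \<open>p\<close> at time \<open>t\<close> of the noise that enters
  along the flow at time \<open>r\<close>.\<close>

definition response :: "real ^ 'n \<Rightarrow> real \<Rightarrow> real ^ 'm" where
  "response p r = costate t p r v* \<sigma> (x r) r"

lemma response_measurable: "response p \<in> borel_measurable (lborel_upto t)"
  unfolding response_def
  by (rule borel_measurable_continuous_Pair[OF costate_measurable[OF t]
        \<sigma>_along_measurable[OF flow_path_measurable[OF tT] lborel_upto_id_restrict[OF tT]]],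
      rule bounded_bilinear.continuous_on[OF bounded_bilinear_vector_matrix_mult]) (intro continuous_intros)+

lemma norm_response_le: "r \<in> {0..t} \<Longrightarrow> norm (response p r) \<le> costate_bound * norm p * S"
  unfolding response_def using costate_bound_nonneg[OF t] tT
  by (intro order_trans[OF norm_vector_matrix_mult_le] mult_mono norm_costate_le[OF t] \<sigma>_bound) auto

lemma response_sq_integrable: "sq_integrable (lborel_upto t) (response p)"
  by (rule sq_integrable_bounded[OF finite_measure_lborel_upto response_measurable])
     (use norm_response_le in auto)

definition qform :: "real ^ 'n \<Rightarrow> real" where
  "qform p = (\<integral>r. (norm (response p r))\<^sup>2 \<partial>lborel_upto t)"

lemma qform_le: "qform p \<le> (costate_bound * norm p * S)\<^sup>2 * t"
proof -
  have "qform p \<le> (\<integral>r. (costate_bound * norm p * S)\<^sup>2 \<partial>lborel_upto t)"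
    unfolding qform_def
    by (rule integral_mono[OF sq_integrableD(2)[OF response_sq_integrable]
          finite_measure.integrable_const[OF finite_measure_lborel_upto]])
       (use norm_response_le in \<open>auto intro!: power_mono\<close>)
  then show ?thesis using measure_lborel_upto[OF t0] by (simp add: mult.commute)
qed

lemma main_term_second_moment_close:
  assumes \<epsilon>: "0 < \<epsilon>" and p: "norm p = 1"
  shows "\<bar>(\<integral>\<omega>. (main_term \<epsilon> p \<omega>)\<^sup>2 \<partial>M) - qform p\<bar> \<le> 2 * costate_bound * S * (costate_bound * L * \<epsilon>) * (t + deviation_bound)"
proof -
  let ?a = "\<lambda>z. costate t p (fst z) v* H \<epsilon> z" and ?b = "\<lambda>z :: real \<times> 'a. response p (fst z)"
  let ?k = "2 * costate_bound * S * (costate_bound * L * \<epsilon>)"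
  have one: "integrable M (\<lambda>_. 1 :: real)" by simp
  have ri: "integrable (lborel_upto t) (\<lambda>r. (norm (response p r))\<^sup>2)"
    by (rule sq_integrableD(2)[OF response_sq_integrable])
  have bi: "integrable P (\<lambda>z. (norm (?b z))\<^sup>2)" and bq: "(\<integral>z. (norm (?b z))\<^sup>2 \<partial>P) = qform p"
    using integrable_pair_product[OF sigma_finite_lborel_upto sigma_finite_measure_axioms ri one]
      integral_pair_product[OF sigma_finite_lborel_upto sigma_finite_measure_axioms ri one]
    by (simp_all add: qform_def prob_space)
  note ai = sq_integrableD(2)[OF costate_H_sq_integrable[OF \<epsilon>, of p]]
  have vi: "integrable P (\<lambda>z. ?k * (1 + (norm (VP \<epsilon> z))\<^sup>2))"
    using sq_integrableD(2)[OF VP_L2(1)[OF \<epsilon>]] finite_measure.integrable_const[OF finite_P, of "1 :: real"]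
    by simp
  have nn: "0 \<le> costate_bound" "0 \<le> S" "0 \<le> costate_bound * S" using costate_bound_nonneg[OF t] S_nonneg by auto
  have pw: "\<bar>(norm (?a z))\<^sup>2 - (norm (?b z))\<^sup>2\<bar> \<le> ?k * (1 + (norm (VP \<epsilon> z))\<^sup>2)" if z: "z \<in> space P" for z
  proof -
    have fz: "fst z \<in> {0..t}" "fst z \<in> {0..T}" using z tT by (auto simp: space_P)
    have cz: "norm (costate t p (fst z)) \<le> costate_bound" using norm_costate_le[OF t fz(2), of p] p by simp
    have a: "norm (?a z) \<le> costate_bound * S"
      using nn by (intro order_trans[OF norm_vector_matrix_mult_le] mult_mono cz norm_H_le[OF \<epsilon> z]) auto
    have b: "norm (?b z) \<le> costate_bound * S" using norm_response_le[OF fz(1), of p] p by simp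
    have "norm (H \<epsilon> z - \<sigma> (x (fst z)) (fst z)) \<le> L * norm (y \<epsilon> (fst z) (snd z) - x (fst z))"
      unfolding H_def by (rule \<sigma>_lipschitz[OF fz(2)])
    also have "norm (y \<epsilon> (fst z) (snd z) - x (fst z)) = \<epsilon> * norm (VP \<epsilon> z)"
      using \<epsilon> by (simp add: VP_def V_def)
    finally have h: "norm (H \<epsilon> z - \<sigma> (x (fst z)) (fst z)) \<le> L * (\<epsilon> * norm (VP \<epsilon> z))" .
    have "?a z - ?b z = costate t p (fst z) v* (H \<epsilon> z - \<sigma> (x (fst z)) (fst z))"
      by (simp add: response_def vector_matrix_mult_diff)
    then have ab: "norm (?a z - ?b z) \<le> costate_bound * (L * (\<epsilon> * norm (VP \<epsilon> z)))"
      using nn by (auto intro!: order_trans[OF norm_vector_matrix_mult_le] mult_mono cz h)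
    have "(norm (?a z))\<^sup>2 - (norm (?b z))\<^sup>2 = (norm (?a z) - norm (?b z)) * (norm (?a z) + norm (?b z))"
      by (simp add: power2_eq_square algebra_simps)
    then have "\<bar>(norm (?a z))\<^sup>2 - (norm (?b z))\<^sup>2\<bar> = \<bar>norm (?a z) - norm (?b z)\<bar> * (norm (?a z) + norm (?b z))"
      by (simp add: abs_mult)
    also have "\<dots> \<le> (costate_bound * (L * (\<epsilon> * norm (VP \<epsilon> z)))) * (costate_bound * S + costate_bound * S)"
      using a b L \<epsilon> nn by (intro mult_mono add_mono order_trans[OF norm_triangle_ineq3 ab]) auto
    also have "\<dots> = ?k * norm (VP \<epsilon> z)" by (simp add: algebra_simps)
    also have "\<dots> \<le> ?k * (1 + (norm (VP \<epsilon> z))\<^sup>2)"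
    proof (rule mult_left_mono)
      have "2 * norm (VP \<epsilon> z) \<le> 1 + (norm (VP \<epsilon> z))\<^sup>2" using sum_squares_bound[of 1 "norm (VP \<epsilon> z)"] by simp
      moreover have "0 \<le> norm (VP \<epsilon> z)" by simp
      ultimately show "norm (VP \<epsilon> z) \<le> 1 + (norm (VP \<epsilon> z))\<^sup>2" by linarith
    qed (use nn L \<epsilon> in auto)
    finally show ?thesis .
  qed
  have "\<bar>(\<integral>\<omega>. (main_term \<epsilon> p \<omega>)\<^sup>2 \<partial>M) - qform p\<bar> = \<bar>\<integral>z. (norm (?a z))\<^sup>2 - (norm (?b z))\<^sup>2 \<partial>P\<bar>"
    unfolding main_term_second_moment[OF \<epsilon>] bq[symmetric] using ai bi by simp
  also have "\<dots> \<le> (\<integral>z. ?k * (1 + (norm (VP \<epsilon> z))\<^sup>2) \<partial>P)"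
    using ai bi by (intro order_trans[OF integral_abs_bound] integral_mono vi pw) auto
  also have "\<dots> = ?k * (t + (\<integral>z. (norm (VP \<epsilon> z))\<^sup>2 \<partial>P))"
    using sq_integrableD(2)[OF VP_L2(1)[OF \<epsilon>]] finite_measure.integrable_const[OF finite_P, of "1 :: real"] measure_P
    by simp
  also have "\<dots> \<le> ?k * (t + deviation_bound)"
    using nn L \<epsilon> by (intro mult_left_mono add_left_mono VP_L2(2)) auto
  finally show ?thesis .
qed

text \<open>The error in replacing the scaled variance by the quadratic form: \<open>k\<close> stems from evaluating \<open>\<sigma>\<close> along
  the solution instead of the flow, and \<open>R\<close> bounds the mean square of the error term.\<close>

definition variance_bound :: "real \<Rightarrow> real" where
  "variance_bound \<epsilon> = (let k = 2 * costate_bound * S * (costate_bound * L * \<epsilon>) * (t + deviation_bound); R = t * (costate_bound\<^sup>2 * (\<integral>z. (norm (rem \<epsilon> z))\<^sup>2 \<partial>P)) in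
     k + 2 * (sqrt ((costate_bound * S)\<^sup>2 * t + k) * sqrt R) + 2 * R)"

lemma variance_bound_tendsto: "(variance_bound \<longlongrightarrow> 0) (at_right 0)"
proof -
  let ?k = "\<lambda>\<epsilon>. 2 * costate_bound * S * (costate_bound * L * \<epsilon>) * (t + deviation_bound)"
  let ?R = "\<lambda>\<epsilon>. t * (costate_bound\<^sup>2 * (\<integral>z. (norm (rem \<epsilon> z))\<^sup>2 \<partial>P))"
  have k: "(?k \<longlongrightarrow> 2 * costate_bound * S * (costate_bound * L * 0) * (t + deviation_bound)) (at_right 0)"
    by (intro tendsto_mult tendsto_const tendsto_ident_at)
  have R: "(?R \<longlongrightarrow> t * (costate_bound\<^sup>2 * 0)) (at_right 0)"
    by (intro tendsto_mult tendsto_const rem_tendsto)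
  have "((\<lambda>\<epsilon>. ?k \<epsilon> + 2 * (sqrt ((costate_bound * S)\<^sup>2 * t + ?k \<epsilon>) * sqrt (?R \<epsilon>)) + 2 * ?R \<epsilon>) \<longlongrightarrow>
      2 * costate_bound * S * (costate_bound * L * 0) * (t + deviation_bound) + 2 * (sqrt ((costate_bound * S)\<^sup>2 * t + 2 * costate_bound * S * (costate_bound * L * 0) * (t + deviation_bound))
        * sqrt (t * (costate_bound\<^sup>2 * 0))) + 2 * (t * (costate_bound\<^sup>2 * 0))) (at_right 0)"
    by (intro tendsto_add tendsto_mult tendsto_real_sqrt k R tendsto_const)
  then show ?thesis by (simp add: variance_bound_def[abs_def] Let_def)
qed

lemma deviation_eq:
  assumes \<epsilon>: "0 < \<epsilon>" and \<omega>: "\<omega> \<in> space M"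
  shows "p \<bullet> (y \<epsilon> t \<omega> - F t x0) = \<epsilon> * (main_term \<epsilon> p \<omega> + error_term \<epsilon> p \<omega>)"
  unfolding deviation_eq_main_plus_error[OF \<epsilon> \<omega>, symmetric] using \<epsilon> by (simp add: V_def)

lemma deviation_sq_integrable:
  assumes \<epsilon>: "0 < \<epsilon>"
  shows "integrable M (\<lambda>\<omega>. (p \<bullet> (y \<epsilon> t \<omega> - F t x0))\<^sup>2)"
proof -
  have "sq_integrable M (\<lambda>\<omega>. main_term \<epsilon> p \<omega> + error_term \<epsilon> p \<omega>)"
    by (rule sq_integrable_add[OF main_term_sq_integrable[OF \<epsilon>] error_term_L2(1)[OF \<epsilon>]])
  then have "integrable M (\<lambda>\<omega>. \<epsilon>\<^sup>2 * (main_term \<epsilon> p \<omega> + error_term \<epsilon> p \<omega>)\<^sup>2)"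
    by (auto dest!: sq_integrableD(2))
  then show ?thesis
    by (rule Bochner_Integration.integrable_cong[OF refl, THEN iffD1, rotated])
       (simp add: deviation_eq[OF \<epsilon>] power_mult_distrib)
qed

lemma scaled_variance_close:
  assumes \<epsilon>: "0 < \<epsilon>" and p: "norm p = 1"
  shows "\<bar>1 / \<epsilon>\<^sup>2 * variance (\<lambda>\<omega>. p \<bullet> (y \<epsilon> t \<omega> - F t x0)) - qform p\<bar> \<le> variance_bound \<epsilon>"
proof -
  let ?Z = "\<lambda>\<omega>. main_term \<epsilon> p \<omega> + error_term \<epsilon> p \<omega>"
  let ?k = "2 * costate_bound * S * (costate_bound * L * \<epsilon>) * (t + deviation_bound)" and ?R = "t * (costate_bound\<^sup>2 * (\<integral>z. (norm (rem \<epsilon> z))\<^sup>2 \<partial>P))"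
  let ?l = "expectation (\<lambda>\<omega>. (main_term \<epsilon> p \<omega>)\<^sup>2)" and ?e = "expectation (\<lambda>\<omega>. (error_term \<epsilon> p \<omega>)\<^sup>2)"
  have m: "expectation (\<lambda>\<omega>. p \<bullet> (y \<epsilon> t \<omega> - F t x0)) = \<epsilon> * expectation ?Z"
  proof -
    have "expectation (\<lambda>\<omega>. p \<bullet> (y \<epsilon> t \<omega> - F t x0)) = expectation (\<lambda>\<omega>. \<epsilon> * ?Z \<omega>)"
      by (rule Bochner_Integration.integral_cong[OF refl]) (rule deviation_eq[OF \<epsilon>])
    then show ?thesis by (simp only: integral_mult_right_zero)
  qed
  have "variance (\<lambda>\<omega>. p \<bullet> (y \<epsilon> t \<omega> - F t x0)) = expectation (\<lambda>\<omega>. \<epsilon>\<^sup>2 * (?Z \<omega> - expectation ?Z)\<^sup>2)"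
    unfolding m
  proof (rule Bochner_Integration.integral_cong[OF refl])
    fix \<omega> assume "\<omega> \<in> space M"
    show "(p \<bullet> (y \<epsilon> t \<omega> - F t x0) - \<epsilon> * expectation ?Z)\<^sup>2 = \<epsilon>\<^sup>2 * (?Z \<omega> - expectation ?Z)\<^sup>2"
      unfolding deviation_eq[OF \<epsilon> \<open>\<omega> \<in> space M\<close>] power_mult_distrib[symmetric] right_diff_distrib
      by (rule refl)
  qed
  also have "\<dots> = \<epsilon>\<^sup>2 * variance ?Z" by (rule integral_mult_right_zero)
  finally have eq: "1 / \<epsilon>\<^sup>2 * variance (\<lambda>\<omega>. p \<bullet> (y \<epsilon> t \<omega> - F t x0)) = variance ?Z" using \<epsilon> by simp
  have close: "\<bar>?l - qform p\<bar> \<le> ?k" by (rule main_term_second_moment_close[OF \<epsilon> p])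
  have e: "?e \<le> ?R" using error_term_L2(2)[OF \<epsilon>, of p] p by simp
  have l: "?l \<le> (costate_bound * S)\<^sup>2 * t + ?k" using close qform_le[of p] p by simp
  have "0 \<le> ?l" by simp
  then have l0: "0 \<le> (costate_bound * S)\<^sup>2 * t + ?k" using l by (rule order_trans)
  have s: "sqrt ?l * sqrt ?e \<le> sqrt ((costate_bound * S)\<^sup>2 * t + ?k) * sqrt ?R"
    by (intro mult_mono real_sqrt_le_mono l e real_sqrt_ge_zero l0) simp
  have "\<bar>variance ?Z - ?l\<bar> \<le> 2 * (sqrt ?l * sqrt ?e) + 2 * ?e"
    by (rule variance_perturbation[OF main_term_sq_integrable[OF \<epsilon>] error_term_L2(1)[OF \<epsilon>] main_term_mean[OF \<epsilon>]])
  then show ?thesis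
    unfolding eq variance_bound_def Let_def using close e s by linarith
qed

lemma scaled_max_variance_tendsto:
  "(scaled_max_variance M F y x0 t \<longlongrightarrow> (SUP p\<in>{p. norm p = 1}. qform p)) (at_right 0)"
proof (rule LIM_zero_cancel, rule Lim_null_comparison[OF _ variance_bound_tendsto])
  show "\<forall>\<^sub>F \<epsilon> in at_right 0. norm (scaled_max_variance M F y x0 t \<epsilon> - (SUP p\<in>{p. norm p = 1}. qform p)) \<le> variance_bound \<epsilon>"
    using eventually_at_right_less[of 0]
  proof eventually_elim
    case (elim \<epsilon>)
    have "{p :: real ^ 'n. norm p = 1} \<noteq> {}"
      using norm_axis_1 by blast
    then show ?case
      unfolding scaled_max_variance_def real_norm_def
    proof (rule abs_SUP_diff_le[where c = "(costate_bound * S)\<^sup>2 * t"])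
      show "qform p \<le> (costate_bound * S)\<^sup>2 * t" if "p \<in> {p. norm p = 1}" for p
        using qform_le[of p] that by simp
      show "\<bar>1 / \<epsilon>\<^sup>2 * variance (\<lambda>\<omega>. p \<bullet> (y \<epsilon> t \<omega> - F t x0)) - qform p\<bar> \<le> variance_bound \<epsilon>" if "p \<in> {p. norm p = 1}" for p
        using scaled_variance_close[OF elim, of p] that by simp
    qed
  qed
qed

text \<open>The rows of the integrand of \<open>\<Sigma>\<close> are responses, up to a change of the final costate.\<close>

lemma Sigma_bilinear:
  "v \<bullet> (Sigma_matrix F \<sigma> x0 t *v w) = (\<integral>r. response v r \<bullet> response w r \<partial>lborel_upto t)"
proof -
  let ?L = "L_matrix F \<sigma> x0"
  let ?N = "\<chi> i j. LINT r:{0..t}|lborel. (?L r ** transpose (?L r)) $ i $ j"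
  have resp: "response p r = (p v* \<Phi> t) v* ?L r" for p r
    unfolding response_def costate_def L_matrix_def by (simp add: vector_matrix_mul_assoc matrix_mul_assoc)
  have row: "?L r $ i = response (axis i 1 v* \<Psi> t) r" for r i
  proof -
    have "(axis i 1 v* \<Psi> t) v* \<Phi> t = axis i 1"
      by (simp add: vector_matrix_mul_assoc \<Phi>_\<Psi>[OF t])
    moreover have "axis i 1 v* N = N $ i" for N :: "real ^ 'm ^ 'n"
    proof -
      have "axis i 1 v* N = (\<Sum>k\<in>UNIV. axis i 1 $ k *\<^sub>R N $ k)"
        by (simp add: vec_eq_iff vector_matrix_mult_def mult.commute)
      also have "\<dots> = (\<Sum>k\<in>UNIV. if k = i then N $ k else 0)"
        by (intro sum.cong) (auto simp: axis_def)
      finally show ?thesis by simp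
    qed
    ultimately show ?thesis unfolding resp by simp
  qed
  have rowi: "integrable (lborel_upto t) (\<lambda>r. ?L r $ i \<bullet> ?L r $ j)" for i j
    unfolding row by (rule integrable_inner_of_sq_integrable[OF response_sq_integrable response_sq_integrable])
  have N: "?N $ i $ j = (\<integral>r. ?L r $ i \<bullet> ?L r $ j \<partial>lborel_upto t)" for i j
    by (simp add: integral_lborel_upto matrix_matrix_mult_def transpose_def inner_vec_def)
  let ?c = "v v* \<Phi> t" and ?d = "w v* \<Phi> t"
  have "v \<bullet> (Sigma_matrix F \<sigma> x0 t *v w) = ?c \<bullet> (?N *v ?d)"
    unfolding Sigma_matrix_def
    by (simp add: matrix_vector_mul_assoc[symmetric] dot_lmul_matrix)
  also have "\<dots> = (\<Sum>i\<in>UNIV. \<Sum>j\<in>UNIV. ?c $ i * (?N $ i $ j * ?d $ j))"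
    by (simp only: inner_vec_sum matrix_vector_mult_def vec_lambda_beta sum_distrib_left)
  also have "\<dots> = (\<Sum>i\<in>UNIV. \<Sum>j\<in>UNIV. \<integral>r. ?c $ i * ((?L r $ i \<bullet> ?L r $ j) * ?d $ j) \<partial>lborel_upto t)"
    unfolding N using rowi by simp
  also have "\<dots> = (\<integral>r. (\<Sum>i\<in>UNIV. \<Sum>j\<in>UNIV. ?c $ i * ((?L r $ i \<bullet> ?L r $ j) * ?d $ j)) \<partial>lborel_upto t)"
  proof -
    have "integrable (lborel_upto t) (\<lambda>r. ?c $ i * ((?L r $ i \<bullet> ?L r $ j) * ?d $ j))" for i j
      using rowi[of i j] by simp
    then show ?thesis
      by (simp only: Bochner_Integration.integral_sum Bochner_Integration.integrable_sum)
  qed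
  also have "\<dots> = (\<integral>r. response v r \<bullet> response w r \<partial>lborel_upto t)"
  proof (rule Bochner_Integration.integral_cong[OF refl])
    fix r
    have vs: "p v* ?L r = (\<Sum>i\<in>UNIV. p $ i *\<^sub>R ?L r $ i)" for p
      by (simp add: vec_eq_iff vector_matrix_mult_def mult.commute)
    show "(\<Sum>i\<in>UNIV. \<Sum>j\<in>UNIV. ?c $ i * ((?L r $ i \<bullet> ?L r $ j) * ?d $ j)) = response v r \<bullet> response w r"
      unfolding resp vs inner_sum_left
      unfolding inner_sum_right inner_scaleR_left inner_scaleR_right by (simp add: mult_ac)
  qed
  finally show ?thesis .
qed

lemma Sigma_qform: "v \<bullet> (Sigma_matrix F \<sigma> x0 t *v v) = qform v"
  unfolding Sigma_bilinear qform_def by (simp add: power2_norm_eq_inner)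

lemma sensitivity_eq: "stochastic_sensitivity M F y x0 t = (SUP v\<in>{v. norm v = 1}. v \<bullet> (Sigma_matrix F \<sigma> x0 t *v v))"
  unfolding stochastic_sensitivity_def Sigma_qform
  by (rule tendsto_Lim[OF _ scaled_max_variance_tendsto]) simp

lemma sensitivity_spectrum:
  "stochastic_sensitivity M F y x0 t = spectral_norm (Sigma_matrix F \<sigma> x0 t)"
  "eigenvalue (Sigma_matrix F \<sigma> x0 t) (stochastic_sensitivity M F y x0 t)"
  "eigenvalue (Sigma_matrix F \<sigma> x0 t) c \<Longrightarrow> c \<le> stochastic_sensitivity M F y x0 t"
proof -
  have sym: "v \<bullet> (Sigma_matrix F \<sigma> x0 t *v w) = (Sigma_matrix F \<sigma> x0 t *v v) \<bullet> w" for v w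
    using Sigma_bilinear[of v w] Sigma_bilinear[of w v] by (simp add: inner_commute)
  have pos: "0 \<le> v \<bullet> (Sigma_matrix F \<sigma> x0 t *v v)" for v
    unfolding Sigma_qform qform_def by simp
  note r = rayleigh_quotient[OF sym pos, folded sensitivity_eq]
  show "stochastic_sensitivity M F y x0 t = spectral_norm (Sigma_matrix F \<sigma> x0 t)"
    using r(1) by simp
  show "eigenvalue (Sigma_matrix F \<sigma> x0 t) (stochastic_sensitivity M F y x0 t)" by (rule r(2))
  show "c \<le> stochastic_sensitivity M F y x0 t" if "eigenvalue (Sigma_matrix F \<sigma> x0 t) c"
    by (rule r(3)[OF that])
qed

end

section \<open>Stochastic sensitivity\<close>

theorem theorem3p1:
  fixes M :: "'a measure"
    and T t K_grad_u K_L K_grad_\<sigma> K_grad_grad_u K_\<sigma> :: real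
    and W :: "real \<Rightarrow> 'a \<Rightarrow> real ^ 'm"
    and u :: "real ^ 'n \<Rightarrow> real \<Rightarrow> real ^ 'n"
    and \<sigma> :: "real ^ 'n \<Rightarrow> real \<Rightarrow> real ^ 'm ^ 'n"
    and F :: "real \<Rightarrow> real ^ 'n \<Rightarrow> real ^ 'n"
    and x0 :: "real ^ 'n"
    and y :: "real \<Rightarrow> real \<Rightarrow> 'a \<Rightarrow> real ^ 'n"
  assumes T_pos: "0 < T"
    and wiener: "wiener_process M T W"
    and flow: "flow_map u T F"
    and flow_C1: "\<And>s. s \<in> {0..T} \<Longrightarrow> continuously_differentiable (F s)"
    and flow_invertible: "\<And>s z. s \<in> {0..T} \<Longrightarrow> invertible (jacobian (F s) (at z))"
    and u_C2: "\<And>s. s \<in> {0..T} \<Longrightarrow> twice_continuously_differentiable (\<lambda>z. u z s)"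
    and \<sigma>_differentiable:
      "\<And>s z i j. s \<in> {0..T} \<Longrightarrow> (\<lambda>x. \<sigma> x s $ i $ j) differentiable (at z)"
    and K_grad_u_nonneg: "0 \<le> K_grad_u"
    and grad_u_bound:
      "\<And>s z. s \<in> {0..T} \<Longrightarrow> spectral_norm (jacobian (\<lambda>x. u x s) (at z)) \<le> K_grad_u"
    and u_measurable: "\<And>z. (\<lambda>s. u z s) \<in> borel_measurable (restrict_space borel {0..T})"
    and \<sigma>_measurable:
      "\<And>z i j. (\<lambda>s. \<sigma> z s $ i $ j) \<in> borel_measurable (restrict_space borel {0..T})"
    and linear_growth:
      "\<And>s z. s \<in> {0..T} \<Longrightarrow> norm (u z s) + spectral_norm (\<sigma> z s) \<le> K_L * (1 + norm z)"
    and K_grad_\<sigma>_nonneg: "0 \<le> K_grad_\<sigma>"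
    and grad_\<sigma>_bound:
      "\<And>s z. s \<in> {0..T} \<Longrightarrow> tensor_norm (frechet_derivative (\<lambda>x. \<sigma> x s) (at z)) \<le> K_grad_\<sigma>"
    and K_grad_grad_u_nonneg: "0 \<le> K_grad_grad_u"
    and grad_grad_u_bound:
      "\<And>s z. s \<in> {0..T} \<Longrightarrow>
         tensor_norm (frechet_derivative (\<lambda>x. jacobian (\<lambda>x'. u x' s) (at x)) (at z)) \<le> K_grad_grad_u"
    and K_\<sigma>_nonneg: "0 \<le> K_\<sigma>"
    and \<sigma>_bound: "\<And>s z. s \<in> {0..T} \<Longrightarrow> spectral_norm (\<sigma> z s) \<le> K_\<sigma>"
    and solution: "\<And>\<epsilon>. 0 < \<epsilon> \<Longrightarrow> strong_solution M W T u (\<lambda>z s. \<epsilon> *\<^sub>R \<sigma> z s) x0 (y \<epsilon>)"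
    and t: "t \<in> {0..T}"
  shows "(\<forall>\<epsilon>>0. \<forall>p. integrable M (\<lambda>\<omega>. (p \<bullet> (y \<epsilon> t \<omega> - F t x0))\<^sup>2)) \<and>
    (scaled_max_variance M F y x0 t \<longlongrightarrow> stochastic_sensitivity M F y x0 t) (at_right 0) \<and>
    stochastic_sensitivity M F y x0 t = spectral_norm (Sigma_matrix F \<sigma> x0 t) \<and>
    eigenvalue (Sigma_matrix F \<sigma> x0 t) (stochastic_sensitivity M F y x0 t) \<and>
    (\<forall>c. eigenvalue (Sigma_matrix F \<sigma> x0 t) c \<longrightarrow> c \<le> stochastic_sensitivity M F y x0 t)"
proof -
  have "small_noise M T W K_grad_u (real CARD('n) * real CARD('n) * K_grad_grad_u) K_L u F x0
      \<sigma> (real CARD('n) * real CARD('m) * K_\<sigma>) (real CARD('n) * real CARD('m) * K_grad_\<sigma>) y t"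
  proof
    show "wiener_process M T W" by (rule wiener)
    show "flow_map u T F" by (rule flow)
    show "F s differentiable (at x0)" if "s \<in> {0..T}" for s
      using flow_C1[OF that] unfolding continuously_differentiable_def differentiable_def by blast
    show "invertible (jacobian (F s) (at x0))" if "s \<in> {0..T}" for s
      by (rule flow_invertible[OF that])
    show u_diff: "(\<lambda>z. u z s) differentiable (at z)" if "s \<in> {0..T}" for s z
      using u_C2[OF that] unfolding twice_continuously_differentiable_def by blast
    show "0 \<le> K_grad_u" by (rule K_grad_u_nonneg)
    show "norm (u z s - u w s) \<le> K_grad_u * norm (z - w)" if "s \<in> {0..T}" for s z w
      by (rule lipschitz_of_jacobian_bound[where f = "\<lambda>z. u z s", OF u_diff[OF that] grad_u_bound[OF that]])
    show "norm (jacobian (\<lambda>z. u z s) (at z) *v h) \<le> K_grad_u * norm h" if "s \<in> {0..T}" for s z h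
      by (rule order_trans[OF norm_matrix_vector_le_spectral_norm mult_right_mono[OF grad_u_bound[OF that]]]) simp
    show C: "0 \<le> real CARD('n) * real CARD('n) * K_grad_grad_u"
      using K_grad_grad_u_nonneg by simp
    show "norm (u z s - u w s - jacobian (\<lambda>z. u z s) (at w) *v (z - w))
        \<le> real CARD('n) * real CARD('n) * K_grad_grad_u * (norm (z - w))\<^sup>2" if s: "s \<in> {0..T}" for s z w
    proof (rule taylor_quadratic[where f = "\<lambda>z. u z s", OF u_diff[OF s] _ C])
      have "(\<lambda>x. jacobian (\<lambda>x'. u x' s) (at x)) differentiable (at z)" for z
        using u_C2[OF s]
        unfolding twice_continuously_differentiable_def continuously_differentiable_def differentiable_def
        by blast
      then show "norm (jacobian (\<lambda>z. u z s) (at z) - jacobian (\<lambda>z. u z s) (at w))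
          \<le> real CARD('n) * real CARD('n) * K_grad_grad_u * norm (z - w)" for z w
        by (rule lipschitz_of_tensor_norm_bound) (rule grad_grad_u_bound[OF s])
    qed
    show "(\<lambda>s. u z s) \<in> borel_measurable (restrict_space borel {0..T})" for z
      by (rule u_measurable)
    show "norm (u z s) \<le> K_L * (1 + norm z)" if "s \<in> {0..T}" for s z
      using linear_growth[OF that, of z] spectral_norm_nonneg[of "\<sigma> z s"] by linarith
    show "(\<lambda>s. \<sigma> z s $ i $ j) \<in> borel_measurable (restrict_space borel {0..T})" for z i j
      by (rule \<sigma>_measurable)
    show "norm (\<sigma> z s) \<le> real CARD('n) * real CARD('m) * K_\<sigma>" if "s \<in> {0..T}" for s z
      by (rule order_trans[OF norm_le_spectral_norm mult_left_mono[OF \<sigma>_bound[OF that]]]) simp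
    show "0 \<le> real CARD('n) * real CARD('m) * K_grad_\<sigma>"
      using K_grad_\<sigma>_nonneg by simp
    show "norm (\<sigma> z s - \<sigma> w s) \<le> real CARD('n) * real CARD('m) * K_grad_\<sigma> * norm (z - w)"
      if s: "s \<in> {0..T}" for s z w
      by (rule lipschitz_of_tensor_norm_bound[where f = "\<lambda>z. \<sigma> z s"],
          rule matrix_differentiableI, rule \<sigma>_differentiable[OF s], rule grad_\<sigma>_bound[OF s])
    show "strong_solution M W T u (\<lambda>z s. \<epsilon> *\<^sub>R \<sigma> z s) x0 (y \<epsilon>)" if "0 < \<epsilon>" for \<epsilon>
      by (rule solution[OF that])
    show "t \<in> {0..T}" by (rule t)
  qed
  then interpret small_noise M T W K_grad_u "real CARD('n) * real CARD('n) * K_grad_grad_u" K_L u F x0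
      \<sigma> "real CARD('n) * real CARD('m) * K_\<sigma>" "real CARD('n) * real CARD('m) * K_grad_\<sigma>" y t .
  have "(scaled_max_variance M F y x0 t \<longlongrightarrow> stochastic_sensitivity M F y x0 t) (at_right 0)"
    using scaled_max_variance_tendsto unfolding sensitivity_eq Sigma_qform .
  then show ?thesis
    using deviation_sq_integrable sensitivity_spectrum by blast
qed

end
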